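(* Let $K\geq 1$ and let $f\in\mathcal{S}_H^{0}$ be a $K$-quasiconformal harmonic mapping from $\mathbb{D}$ onto a bounded domain $\Omega$. Then $\Omega$ is a radial John disk (with respect to $f$) if and only if there are constants $M(K)>0$ and $\delta\in(0,1)$ such that for each $\zeta\in\partial\mathbb{D}$ and for $0\leq r\leq\rho<1$, $$\|D_{f}(\rho\zeta)\|\leq M(K)\,\|D_{f}(r\zeta)\|\left(\frac{1-\rho}{1-r}\right)^{\delta-1}.$$
   Context: $\mathbb{D}$ is the open unit disk in $\mathbb{C}$. A harmonic mapping in $\mathbb{D}$ is a complex-valued function whose real and imaginary parts are real harmonic; it can be written $f=h+\overline{g}$ with $h,g$ analytic, unique with $g(0)=0$. $\mathcal{S}_H$ is the family of sense-preserving univalent harmonic mappings $f=h+\overline{g}$ in $\mathbb{D}$ with $h(0)=g(0)=0$, $h'(0)=1$; $\mathcal{S}_H^{0}$ is the subfamily with $g'(0)=0$. $\|D_f\|=|f_z|+|f_{\overline z}|$, $l(D_f)=\big||f_z|-|f_{\overline z}|\big|$, where $f_z=\frac12(f_x-if_y)$, $f_{\overline z}=\frac12(f_x+if_y)$; $\det D_f=|f_z|^2-|f_{\overline z}|^2$. For $K\ge1$, a sense-preserving homeomorphism $f$ of a domain $\Omega_0$ onto a domain $\Omega_0'$, in the Sobolev class $W^{1,2}_{loc}(\Omega_0)$, is $K$-quasiconformal if $\|D_f(z)\|^2\le K\det D_f(z)$, i.e. $\|D_f(z)\|\le K\,l(D_f(z))$, for $z\in\Omega_0$. $d_\Omega(w)$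 is the Euclidean distance from $w$ to $\partial\Omega$. Radial John disk: for a univalent map $f$ on $\mathbb{D}$ with bounded simply connected image $G=f(\mathbb{D})$, $G$ is a radial $c$-John disk ($c\ge1$), with John center $w_0=f(0)$, if for each $w_1=f(z_1)\in G$, $z_1\in\mathbb{D}$, the curve $\gamma=f([0,z_1])$ (the image of the radial segment from $0$ to $z_1$) is rectifiable and satisfies $\sigma_\ell(w)\le c\,d_G(w)$ for all $w$ on $\gamma$, where $\sigma_\ell(w)$ is the Euclidean length of the subarc $\gamma[w_1,w]$ of $\gamma$ between $w_1$ and $w$. $G$ is a radial John disk if it is a radial $c$-John disk for some $c\ge1$.
   Formalization: The constant M(K) is allowed to depend on f as well as on K; a constant depending on K alone is impossible, as the dilated Koebe functions k(sz)/s with K=1 and s→1 show. *)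

theory Defs
  imports "HOL-Complex_Analysis.Complex_Analysis"
begin

abbreviation unit_disk :: "complex set" where
  "unit_disk \<equiv> ball 0 1"

definition domain :: "complex set \<Rightarrow> bool" where
  "domain S \<longleftrightarrow> open S \<and> connected S \<and> S \<noteq> {}"

definition dx :: "(complex \<Rightarrow> 'a::real_normed_vector) \<Rightarrow> complex \<Rightarrow> 'a" where
  "dx f z = vector_derivative (\<lambda>t. f (z + of_real t)) (at 0)"

definition dy :: "(complex \<Rightarrow> 'a::real_normed_vector) \<Rightarrow> complex \<Rightarrow> 'a" where
  "dy f z = vector_derivative (\<lambda>t. f (z + \<i> * of_real t)) (at 0)"

definition dz :: "(complex \<Rightarrow> complex) \<Rightarrow> complex \<Rightarrow> complex" where
  "dz f z = (dx f z - \<i> * dy f z) / 2"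

definition dzbar :: "(complex \<Rightarrow> complex) \<Rightarrow> complex \<Rightarrow> complex" where
  "dzbar f z = (dx f z + \<i> * dy f z) / 2"

definition norm_D :: "(complex \<Rightarrow> complex) \<Rightarrow> complex \<Rightarrow> real" where
  "norm_D f z = cmod (dz f z) + cmod (dzbar f z)"

definition det_D :: "(complex \<Rightarrow> complex) \<Rightarrow> complex \<Rightarrow> real" where
  "det_D f z = (cmod (dz f z))\<^sup>2 - (cmod (dzbar f z))\<^sup>2"

text \<open>\<^term>\<open>Ck_on k S f\<close>: the function is real \<open>k\<close> times continuously differentiable on
  the open set \<open>S\<close>.\<close>

primrec Ck_on :: "nat \<Rightarrow> complex set \<Rightarrow> (complex \<Rightarrow> 'a::real_normed_vector) \<Rightarrow> bool" where
  "Ck_on 0 S f \<longleftrightarrow> continuous_on S f"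
| "Ck_on (Suc k) S f \<longleftrightarrow>
     (\<forall>z\<in>S. f differentiable (at z)) \<and> Ck_on k S (dx f) \<and> Ck_on k S (dy f)"

definition real_harmonic_on :: "complex set \<Rightarrow> (complex \<Rightarrow> real) \<Rightarrow> bool" where
  "real_harmonic_on S u \<longleftrightarrow>
     Ck_on 2 S u \<and> (\<forall>z\<in>S. dx (dx u) z + dy (dy u) z = 0)"

definition harmonic_mapping_on :: "complex set \<Rightarrow> (complex \<Rightarrow> complex) \<Rightarrow> bool" where
  "harmonic_mapping_on S f \<longleftrightarrow>
     real_harmonic_on S (\<lambda>z. Re (f z)) \<and> real_harmonic_on S (\<lambda>z. Im (f z))"

text \<open>A topological definition, which does not need differentiability: the images of all small
  positively oriented circles about \<open>z\<close> wind exactly once around \<open>f z\<close>. It is meant for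
  functions that are continuous and injective on the open set \<open>S\<close>.\<close>

definition sense_preserving_on :: "complex set \<Rightarrow> (complex \<Rightarrow> complex) \<Rightarrow> bool" where
  "sense_preserving_on S f \<longleftrightarrow>
     (\<forall>z\<in>S. eventually (\<lambda>r. winding_number (f \<circ> circlepath z r) (f z) = 1) (at_right 0))"

definition canonical_rep :: "(complex \<Rightarrow> complex) \<Rightarrow> (complex \<Rightarrow> complex) \<Rightarrow> (complex \<Rightarrow> complex) \<Rightarrow> bool" where
  "canonical_rep f h g \<longleftrightarrow>
     h holomorphic_on unit_disk \<and> g holomorphic_on unit_disk \<and> g 0 = 0 \<and>
     (\<forall>z\<in>unit_disk. f z = h z + cnj (g z))"

definition S_H :: "(complex \<Rightarrow> complex) set" where
  "S_H = {f. harmonic_mapping_on unit_disk f \<and> inj_on f unit_disk \<and>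
             sense_preserving_on unit_disk f \<and>
             (\<exists>h g. canonical_rep f h g \<and> h 0 = 0 \<and> deriv h 0 = 1)}"

definition S_H0 :: "(complex \<Rightarrow> complex) set" where
  "S_H0 = {f \<in> S_H. \<exists>h g. canonical_rep f h g \<and> deriv g 0 = 0}"

definition L2_loc :: "complex set \<Rightarrow> (complex \<Rightarrow> complex) \<Rightarrow> bool" where
  "L2_loc S f \<longleftrightarrow>
     set_borel_measurable lebesgue S f \<and>
     (\<forall>C. compact C \<and> C \<subseteq> S \<longrightarrow> set_integrable lebesgue C (\<lambda>z. (cmod (f z))\<^sup>2))"

definition test_function :: "complex set \<Rightarrow> (complex \<Rightarrow> real) \<Rightarrow> bool" where
  "test_function S \<phi> \<longleftrightarrow>
     (\<forall>k. Ck_on k UNIV \<phi>) \<and> compact (closure {z. \<phi> z \<noteq> 0}) \<and> closure {z. \<phi> z \<noteq> 0} \<subseteq> S"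

definition W12_loc :: "complex set \<Rightarrow> (complex \<Rightarrow> complex) \<Rightarrow> bool" where
  "W12_loc S f \<longleftrightarrow>
     L2_loc S f \<and>
     (\<exists>p q. L2_loc S p \<and> L2_loc S q \<and>
        (\<forall>\<phi>. test_function S \<phi> \<longrightarrow>
           (LINT z:S|lebesgue. dx \<phi> z *\<^sub>R f z) = - (LINT z:S|lebesgue. \<phi> z *\<^sub>R p z) \<and>
           (LINT z:S|lebesgue. dy \<phi> z *\<^sub>R f z) = - (LINT z:S|lebesgue. \<phi> z *\<^sub>R q z)))"

text \<open>For a Sobolev homeomorphism the dilatation inequality is an almost-everywhere condition.
  The classical partial derivatives can be used in it: a continuous \<open>W\<^sup>1\<^sup>,\<^sup>2\<close>-function is absolutely
  continuous on almost all lines parallel to the axes, so they exist almost everywhere and agree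
  with the weak ones.\<close>

definition quasiconformal ::
  "real \<Rightarrow> complex set \<Rightarrow> complex set \<Rightarrow> (complex \<Rightarrow> complex) \<Rightarrow> bool" where
  "quasiconformal K S T f \<longleftrightarrow>
     K \<ge> 1 \<and> domain S \<and> domain T \<and>
     (\<exists>f'. homeomorphism S T f f') \<and> sense_preserving_on S f \<and> W12_loc S f \<and>
     (AE z in lebesgue. z \<in> S \<longrightarrow> (norm_D f z)\<^sup>2 \<le> K * det_D f z)"

definition curve_length :: "(real \<Rightarrow> complex) \<Rightarrow> ennreal" where
  "curve_length \<gamma> =
     (SUP ts \<in> {ts. sorted ts \<and> set ts \<subseteq> {0..1}}.
        \<Sum>i<length ts - 1. ennreal (dist (\<gamma> (ts ! i)) (\<gamma> (ts ! Suc i))))"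

definition rectifiable :: "(real \<Rightarrow> complex) \<Rightarrow> bool" where
  "rectifiable \<gamma> \<longleftrightarrow> path \<gamma> \<and> curve_length \<gamma> < \<infinity>"

text \<open>Since \<open>f\<close> is injective, the subarc of \<open>f([0, z\<^sub>1])\<close> between \<open>f z\<^sub>1\<close> and \<open>f z\<close> is
  \<open>f([z\<^sub>1, z])\<close>.\<close>

definition radial_c_John_disk :: "real \<Rightarrow> (complex \<Rightarrow> complex) \<Rightarrow> complex set \<Rightarrow> bool" where
  "radial_c_John_disk c f G \<longleftrightarrow>
     c \<ge> 1 \<and> inj_on f unit_disk \<and> G = f ` unit_disk \<and> bounded G \<and> simply_connected G \<and>
     (\<forall>z\<^sub>1\<in>unit_disk.
        rectifiable (f \<circ> linepath 0 z\<^sub>1) \<and>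
        (\<forall>z\<in>closed_segment 0 z\<^sub>1.
           curve_length (f \<circ> linepath z\<^sub>1 z) \<le> ennreal (c * infdist (f z) (frontier G))))"

definition radial_John_disk :: "(complex \<Rightarrow> complex) \<Rightarrow> complex set \<Rightarrow> bool" where
  "radial_John_disk f G \<longleftrightarrow> (\<exists>c. radial_c_John_disk c f G)"

end

theory Submission
  imports Defs
begin

text \<open>
  Write \<open>f = h + cnj g\<close> and \<open>stretch z = |h' z| + |g' z|\<close>, which is the norm of the differential, and let
  \<open>d(z)\<close> be the distance from \<open>f z\<close> to the boundary of the image of the disk. Quasiconformality and
  continuity of \<open>h'\<close> and \<open>g'\<close> give \<open>stretch\<^sup>2 \<le> K (|h'|\<^sup>2 - |g'|\<^sup>2)\<close> at every point. Everything follows from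
  the two-sided estimate
  \<open>c d(z) \<le> (1 - |z|) stretch z \<le> C d(z)\<close>,
  which for conformal maps follows from the Koebe quarter theorem and the Schwarz lemma
  (\<open>stretch_le_bdist\<close>, \<open>bdist_le_stretch\<close>),
  together with the fact that \<open>d\<close> grows by at most a constant factor within distance \<open>(1 - |z|) / 2\<close> of \<open>z\<close>
  (\<open>bdist_compare\<close>).

  Given these, suppose first that the growth condition holds. Integrating it along a radius bounds the
  length of \<open>f [r \<zeta>, \<rho> \<zeta>]\<close> by a multiple of \<open>(1 - r) stretch (r \<zeta>)\<close>, hence of \<open>d(r \<zeta>)\<close>, which is the John
  condition (\<open>John_of_growth\<close>). Conversely, let \<open>a\<^sub>n = (1 - r\<^sub>n) stretch (r\<^sub>n \<zeta>)\<close> at the radii with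
  \<open>1 - r\<^sub>n = (1 - r) / 2\<^sup>n\<close>. The distance of \<open>f (r\<^sub>n \<zeta>)\<close> and \<open>f (r\<^sub>n\<^sub>+\<^sub>1 \<zeta>)\<close> is at least a multiple of \<open>a\<^sub>n\<close>, so the
  John condition says that every tail \<open>a\<^sub>n + a\<^sub>n\<^sub>+\<^sub>1 + \<dots>\<close> is at most a multiple of its first term. Such a
  sequence decays geometrically, and the rate of decay is the exponent \<open>\<delta>\<close> (\<open>growth_of_John\<close>).

  The distortion estimates come from the length-area method. For a map that is injective and satisfies
  the dilatation inequality, the weight that charges each of \<open>N\<close> dyadic annuli in the image
  inversely to its radius has a square whose integral is at most a multiple of \<open>N\<close> (\<open>length_area\<close>), while
  every curve whose image crosses all the annuli has weighted length at least \<open>N\<close>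
  (\<open>dyadic_weight_crossing\<close>). Since \<open>N\<^sup>2\<close> beats \<open>N\<close>, a large family of curves cannot cross
  many annuli. Applied to circles about a point, this shows that
  \<open>|f - w|\<close> satisfies a Harnack inequality whenever \<open>w\<close> is an omitted value (\<open>omitted_value_harnack\<close>);
  with a gradient estimate for harmonic functions this is the upper bound for \<open>stretch\<close>. Applied to
  rays from \<open>z\<close> to the unit circle, it shows that a ball about \<open>z\<close> is not mapped into a tiny
  neighbourhood of \<open>f z\<close> (\<open>image_not_compressed\<close>), so \<open>|h'|\<close> is large somewhere near \<open>z\<close>. As \<open>h'\<close> has no
  zeros and is bounded by the first estimate, Harnack's inequality for \<open>log |h'|\<close> carries this lower bound
  to \<open>z\<close> itself. The function \<open>h'\<close> has no zeros, because at a zero of order \<open>n - 1\<close> the image under \<open>f\<close> of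
  a small circle winds \<open>n\<close> times around the image of its centre, and a sense-preserving map has
  \<open>n = 1\<close> (\<open>deriv_h_nonzero_of_sense_preserving\<close>).
\<close>

no_notation fps_nth (infixl "$" 75)

section \<open>Lebesgue measure on the complex plane\<close>

definition complex_of_vec :: "real^2 \<Rightarrow> complex" where "complex_of_vec v = Complex (v $ 1) (v $ 2)"
definition vec_of_complex :: "complex \<Rightarrow> real^2" where "vec_of_complex z = vector [Re z, Im z]"

lemma vec_complex_inverse [simp]: "complex_of_vec (vec_of_complex z) = z" "vec_of_complex (complex_of_vec v) = v"
  by (simp_all add: complex_of_vec_def vec_of_complex_def vec_eq_iff forall_2)

lemma bounded_linear_complex_of_vec: "bounded_linear complex_of_vec" and bounded_linear_vec_of_complex: "bounded_linear vec_of_complex"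
   by (auto simp: linear_conv_bounded_linear[symmetric] complex_of_vec_def vec_of_complex_def vec_eq_iff forall_2 complex_eq_iff intro!: linearI)

lemma measurable_complex_of_vec [measurable]: "complex_of_vec \<in> borel_measurable borel"
  by (intro borel_measurable_continuous_onI bounded_linear.continuous_on[OF bounded_linear_complex_of_vec] continuous_on_id)

lemma prod_Basis_complex: "(\<Prod>b\<in>Basis. f (b::complex)) = (f 1 * f \<i> :: real)"
  by (simp add: Basis_complex_def)

text \<open>Jacobians are determinants of matrices on \<open>real^2\<close>, iterated integrals live on \<open>real \<times> real\<close>, and derivatives
  of holomorphic functions on \<open>complex\<close>. The three measures are identified here and in \<open>distr_Complex\<close>.\<close>

lemma distr_complex_of_vec: "distr lborel borel complex_of_vec = (lborel :: complex measure)"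
proof (rule lborel_eqI[symmetric])
  fix l u :: complex assume lu: "\<And>b. b \<in> Basis \<Longrightarrow> l \<bullet> b \<le> u \<bullet> b"
  then have le: "Re l \<le> Re u" "Im l \<le> Im u" using lu[of 1] lu[of \<i>] by (auto simp: Basis_complex_def)
  have vle: "vec_of_complex l $ i \<le> vec_of_complex u $ i" for i
    using le exhaust_2[of i] by (auto simp: vec_of_complex_def)
  have "complex_of_vec -` box l u = box (vec_of_complex l) (vec_of_complex u)"
    by (auto simp: complex_of_vec_def vec_of_complex_def mem_box_cart forall_2 in_box_complex_iff)
  then have "emeasure (distr lborel borel complex_of_vec) (box l u) = emeasure lborel (box (vec_of_complex l) (vec_of_complex u))"
    by (simp add: emeasure_distr)
  also have "\<dots> = ennreal (\<Prod>b\<in>Basis. (vec_of_complex u - vec_of_complex l) \<bullet> b)"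
    by (rule emeasure_lborel_box) (use vle in \<open>auto simp: Basis_vec_def inner_axis\<close>)
  also have "(\<Prod>b\<in>Basis. (vec_of_complex u - vec_of_complex l) \<bullet> b) = (\<Prod>i\<in>UNIV. (vec_of_complex u - vec_of_complex l) $ i)"
    by (simp add: Basis_vec_def inner_axis UNION_singleton_eq_range prod.reindex inj_on_def axis_eq_axis)
  also have "\<dots> = (\<Prod>b\<in>Basis. (u - l) \<bullet> b)"
    by (simp add: prod_Basis_complex vec_of_complex_def UNIV_2)
  finally show "emeasure (distr lborel borel complex_of_vec) (box l u) = ennreal (\<Prod>b\<in>Basis. (u - l) \<bullet> b)" .
qed simp

lemma measurable_Complex [measurable]: "(\<lambda>p. Complex (fst p) (snd p)) \<in> borel_measurable borel"
  by (intro borel_measurable_continuous_onI) (auto simp: Complex_eq intro!: continuous_intros)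

lemma distr_Complex: "distr lborel borel (\<lambda>p. Complex (fst p) (snd p)) = (lborel :: complex measure)"
proof (rule lborel_eqI[symmetric])
  fix l u :: complex assume lu: "\<And>b. b \<in> Basis \<Longrightarrow> l \<bullet> b \<le> u \<bullet> b"
  then have le: "Re l \<le> Re u" "Im l \<le> Im u" using lu[of 1] lu[of \<i>] by (auto simp: Basis_complex_def)
  have "(\<lambda>p. Complex (fst p) (snd p)) -` box l u = box (Re l) (Re u) \<times> box (Im l) (Im u)"
    by (auto simp: in_box_complex_iff)
  then have "emeasure (distr lborel borel (\<lambda>p. Complex (fst p) (snd p))) (box l u)
      = emeasure (lborel \<Otimes>\<^sub>M lborel) (box (Re l) (Re u) \<times> box (Im l) (Im u))"
    by (simp add: emeasure_distr lborel_prod)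
  also have "\<dots> = emeasure lborel (box (Re l) (Re u)) * emeasure lborel (box (Im l) (Im u))"
    by (rule lborel.emeasure_pair_measure_Times) auto
  also have "\<dots> = ennreal (\<Prod>b\<in>Basis. (u - l) \<bullet> b)"
    using le by (simp add: prod_Basis_complex ennreal_mult)
  finally show "emeasure (distr lborel borel (\<lambda>p. Complex (fst p) (snd p))) (box l u) = ennreal (\<Prod>b\<in>Basis. (u - l) \<bullet> b)" .
qed simp

lemma nn_integral_complex_iterated:
  assumes [measurable]: "f \<in> borel_measurable borel"
  shows "(\<integral>\<^sup>+z. f z \<partial>(lborel::complex measure)) = (\<integral>\<^sup>+x. \<integral>\<^sup>+y. f (Complex x y) \<partial>lborel \<partial>lborel)"
    and "(\<integral>\<^sup>+z. f z \<partial>(lborel::complex measure)) = (\<integral>\<^sup>+y. \<integral>\<^sup>+x. f (Complex x y) \<partial>lborel \<partial>lborel)"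
proof -
  have m: "(\<lambda>p. f (Complex (fst p) (snd p))) \<in> borel_measurable borel" by measurable
  have "(\<integral>\<^sup>+z. f z \<partial>(lborel::complex measure)) = (\<integral>\<^sup>+p. f (Complex (fst p) (snd p)) \<partial>(lborel :: (real \<times> real) measure))"
    by (subst distr_Complex[symmetric]) (simp add: nn_integral_distr)
  also have "\<dots> = (\<integral>\<^sup>+p. f (Complex (fst p) (snd p)) \<partial>((lborel::real measure) \<Otimes>\<^sub>M (lborel::real measure)))"
    by (simp add: lborel_prod)
  finally have *: "(\<integral>\<^sup>+z. f z \<partial>(lborel::complex measure)) = \<dots>" .
  have m': "(\<lambda>p. f (Complex (fst p) (snd p))) \<in> borel_measurable ((lborel::real measure) \<Otimes>\<^sub>M (lborel::real measure))"
    using m by (simp add: lborel_prod)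
  show "(\<integral>\<^sup>+z. f z \<partial>(lborel::complex measure)) = (\<integral>\<^sup>+x. \<integral>\<^sup>+y. f (Complex x y) \<partial>lborel \<partial>lborel)"
    using * lborel.nn_integral_fst[OF m'] by simp
  show "(\<integral>\<^sup>+z. f z \<partial>(lborel::complex measure)) = (\<integral>\<^sup>+y. \<integral>\<^sup>+x. f (Complex x y) \<partial>lborel \<partial>lborel)"
    using * lborel_pair.nn_integral_snd[OF m'[unfolded split_beta']] by simp
qed

section \<open>The area of the image of a harmonic map\<close>

lemma has_derivative_harmonic:
  assumes "(H has_field_derivative H') (at z)" "(G has_field_derivative G') (at z)"
  shows "((\<lambda>z. H z + cnj (G z)) has_derivative (\<lambda>v. H' * v + cnj (G' * v))) (at z within S)"
  by (rule has_derivative_at_withinI,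
      intro has_derivative_add has_derivative_cnj assms[unfolded has_field_derivative_def])

lemma has_derivative_in_coordinates:
  assumes "(f has_derivative f') (at (complex_of_vec v))"
  shows "((\<lambda>v. vec_of_complex (f (complex_of_vec v))) has_derivative (\<lambda>u. vec_of_complex (f' (complex_of_vec u)))) (at v within S)"
proof -
  have "(complex_of_vec has_derivative complex_of_vec) (at v)"
    by (rule bounded_linear_imp_has_derivative[OF bounded_linear_complex_of_vec])
  from has_derivative_compose[OF this assms]
  have "((\<lambda>v. f (complex_of_vec v)) has_derivative (\<lambda>u. f' (complex_of_vec u))) (at v)" .
  from bounded_linear.has_derivative[OF bounded_linear_vec_of_complex this] show ?thesis
    by (rule has_derivative_at_withinI)
qed

lemma det_harmonic:
  "det (matrix (\<lambda>u. vec_of_complex (a * complex_of_vec u + cnj (b * complex_of_vec u)))) = (cmod a)\<^sup>2 - (cmod b)\<^sup>2"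
  by (simp add: det_2 matrix_def vec_of_complex_def complex_of_vec_def axis_def cmod_power2, simp add: power2_eq_square algebra_simps)

text \<open>The Jacobian of \<open>H + cnj G\<close> is \<open>|H'|\<^sup>2 - |G'|\<^sup>2\<close>, so its integral is the area of the image, and the
  image lies in a square of side \<open>2 r\<close>.\<close>

lemma nn_integral_jacobian_harmonic_le:
  fixes H G :: "complex \<Rightarrow> complex"
  assumes S[measurable]: "S \<in> sets borel"
    and H: "\<And>z. z \<in> S \<Longrightarrow> (H has_field_derivative H' z) (at z)"
    and G: "\<And>z. z \<in> S \<Longrightarrow> (G has_field_derivative G' z) (at z)"
    and inj: "inj_on (\<lambda>z. H z + cnj (G z)) S"
    and img: "\<And>z. z \<in> S \<Longrightarrow> H z + cnj (G z) \<in> cball w r" and r: "r \<ge> 0"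
    and pos: "\<And>z. z \<in> S \<Longrightarrow> cmod (G' z) \<le> cmod (H' z)"
    and meas: "(\<lambda>z. indicator S z * ((cmod (H' z))\<^sup>2 - (cmod (G' z))\<^sup>2)) \<in> borel_measurable borel"
  shows "(\<integral>\<^sup>+z. ennreal (indicator S z * ((cmod (H' z))\<^sup>2 - (cmod (G' z))\<^sup>2)) \<partial>lborel) \<le> ennreal (4 * r\<^sup>2)"
proof -
  define J where "J z = (cmod (H' z))\<^sup>2 - (cmod (G' z))\<^sup>2" for z
  define f where "f v = vec_of_complex (H (complex_of_vec v) + cnj (G (complex_of_vec v)))" for v
  define f' where "f' v u = vec_of_complex (H' (complex_of_vec v) * complex_of_vec u + cnj (G' (complex_of_vec v) * complex_of_vec u))" for v u
  define V where "V = complex_of_vec -` S"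
  define B where "B = cbox (vec_of_complex (w - Complex r r)) (vec_of_complex (w + Complex r r))"
  have Vb: "V \<in> sets borel" unfolding V_def
    using measurable_sets[OF measurable_complex_of_vec S] by simp
  then have V: "V \<in> sets lebesgue" by simp
  have der: "(f has_derivative f' v) (at v within V)" if "v \<in> V" for v
    unfolding f_def f'_def
    using that by (intro has_derivative_in_coordinates has_derivative_harmonic H G) (auto simp: V_def)
  have inj_to_vec: "vec_of_complex x = vec_of_complex y \<longleftrightarrow> x = y" for x y by (metis vec_complex_inverse(1))
  have inj_to_complex: "complex_of_vec x = complex_of_vec y \<longleftrightarrow> x = y" for x y by (metis vec_complex_inverse(2))
  have injf: "inj_on f V"
  proof (rule inj_onI)
    fix v u assume "v \<in> V" "u \<in> V" "f v = f u"
    then have "complex_of_vec v = complex_of_vec u"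
      using inj_onD[OF inj, of "complex_of_vec v" "complex_of_vec u"] by (simp add: f_def V_def inj_to_vec)
    then show "v = u" by (simp add: inj_to_complex)
  qed
  have J0: "J z \<ge> 0" if "z \<in> S" for z
    using pos[OF that] by (simp add: J_def power_mono)
  have detJ: "\<bar>det (matrix (f' v))\<bar> = J (complex_of_vec v)" if "v \<in> V" for v
    using J0[of "complex_of_vec v"] that unfolding f'_def det_harmonic J_def by (simp add: V_def)
  have fB: "f ` V \<subseteq> B"
  proof (clarify)
    fix v assume "v \<in> V"
    then have "cmod (H (complex_of_vec v) + cnj (G (complex_of_vec v)) - w) \<le> r"
      using img[of "complex_of_vec v"] by (simp add: V_def dist_norm norm_minus_commute)
    then have "\<bar>Re (H (complex_of_vec v) + cnj (G (complex_of_vec v)) - w)\<bar> \<le> r" "\<bar>Im (H (complex_of_vec v) + cnj (G (complex_of_vec v)) - w)\<bar> \<le> r"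
      using abs_Re_le_cmod abs_Im_le_cmod order_trans by blast+
    then show "f v \<in> B"
      by (auto simp: f_def B_def vec_of_complex_def mem_box_cart forall_2)
  qed
  have fS: "f ` V \<in> sets lebesgue"
    by (rule differentiable_image_in_sets_lebesgue[OF V]) (auto simp: differentiable_on_def intro: differentiableI der)
  have Bm: "B \<in> lmeasurable" unfolding B_def by (rule lmeasurable_cbox)
  have fl: "f ` V \<in> lmeasurable"
    by (rule bounded_set_imp_lmeasurable[OF bounded_subset[OF bounded_cbox fB[unfolded B_def]] fS])
  have mB: "measure lebesgue B = 4 * r\<^sup>2"
  proof -
    have "vec_of_complex w \<in> B"
      using r by (auto simp: B_def vec_of_complex_def mem_box_cart forall_2)
    then have "measure lborel B = (\<Prod>i\<in>UNIV. vec_of_complex (w + Complex r r) $ i - vec_of_complex (w - Complex r r) $ i)"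
      unfolding B_def by (intro content_cbox_cart) auto
    moreover have "measure lebesgue B = measure lborel B"
      unfolding B_def by simp
    ultimately have "measure lebesgue B = (\<Prod>i\<in>UNIV. vec_of_complex (w + Complex r r) $ i - vec_of_complex (w - Complex r r) $ i)"
      by simp
    then show ?thesis by (simp add: UNIV_2 vec_of_complex_def power2_eq_square)
  qed
  have le: "measure lebesgue (f ` V) \<le> 4 * r\<^sup>2"
    using measure_mono_fmeasurable[OF fB fS Bm] unfolding mB .
  have "((\<lambda>v. \<bar>det (matrix (f' v))\<bar>) has_integral measure lebesgue (f ` V)) V"
    by (rule iffD1[OF has_measure_differentiable_image[OF V der injf], OF _ conjI[OF fl refl]])
  then have "((\<lambda>v. J (complex_of_vec v)) has_integral measure lebesgue (f ` V)) V"
    by (rule has_integral_eq[rotated]) (simp add: detJ)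
  then have hi: "((\<lambda>v. indicator S (complex_of_vec v) * J (complex_of_vec v)) has_integral measure lebesgue (f ` V)) UNIV"
  proof -
    assume "((\<lambda>v. J (complex_of_vec v)) has_integral measure lebesgue (f ` V)) V"
    then have "((\<lambda>v. if v \<in> V then J (complex_of_vec v) else 0) has_integral measure lebesgue (f ` V)) UNIV"
      by (simp only: has_integral_restrict_UNIV)
    moreover have "(\<lambda>v. if v \<in> V then J (complex_of_vec v) else 0) = (\<lambda>v. indicator S (complex_of_vec v) * J (complex_of_vec v))"
      by (auto simp: V_def indicator_def)
    ultimately show ?thesis by simp
  qed
  define \<phi> where "\<phi> z = indicator S z * J z" for z
  have [measurable]: "\<phi> \<in> borel_measurable borel"
    using meas by (simp add: J_def \<phi>_def[abs_def])
  have \<phi>0: "\<phi> z \<ge> 0" for z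
    using J0[of z] by (auto simp: \<phi>_def indicator_def)
  have "(\<integral>\<^sup>+z. ennreal (\<phi> z) \<partial>lborel) = (\<integral>\<^sup>+v. ennreal (\<phi> (complex_of_vec v)) \<partial>lborel)"
    unfolding distr_complex_of_vec[symmetric] by (rule nn_integral_distr) auto
  also have "\<dots> = ennreal (measure lebesgue (f ` V))"
    by (rule nn_integral_has_integral_lborel[OF _ \<phi>0 hi[folded \<phi>_def]]) measurable
  also have "\<dots> \<le> ennreal (4 * r\<^sup>2)" using le by (simp add: ennreal_leI)
  finally show ?thesis unfolding J_def \<phi>_def .
qed

section \<open>Curves that cross an annulus\<close>

text \<open>The point \<open>d\<close> is the first one where the upper level is reached, and \<open>c\<close> the last one before it where \<open>q\<close>
  is still at or below the lower level.\<close>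

lemma crossing_subinterval:
  fixes q :: "real \<Rightarrow> real"
  assumes uv: "u \<le> v" and cont: "continuous_on {u..v} q" and q: "q u \<le> a" "b \<le> q v" and ab: "a < b"
  obtains c d where "u \<le> c" "c \<le> d" "d \<le> v" "q c \<le> a" "b \<le> q d" "\<And>t. t \<in> {c<..<d} \<Longrightarrow> a < q t \<and> q t < b"
proof -
  have clo: "compact {t \<in> {x..y}. b \<le> q t}" "compact {t \<in> {x..y}. q t \<le> a}" if "u \<le> x" "y \<le> v" for x y
  proof -
    have c: "continuous_on {x..y} q" using cont by (rule continuous_on_subset) (use that in auto)
    have "closed {t \<in> {x..y}. b \<le> q t}" "closed {t \<in> {x..y}. q t \<le> a}"
      by (intro continuous_on_closed_Collect_le continuous_on_const c closed_atLeastAtMost)+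
    then show "compact {t \<in> {x..y}. b \<le> q t}" "compact {t \<in> {x..y}. q t \<le> a}"
      by (auto simp: compact_eq_bounded_closed intro: bounded_subset[OF bounded_closed_interval[of x y]])
  qed
  have "{t \<in> {u..v}. b \<le> q t} \<noteq> {}" using uv q by auto
  then obtain d where d: "d \<in> {u..v}" "b \<le> q d" "\<And>t. t \<in> {u..v} \<Longrightarrow> b \<le> q t \<Longrightarrow> d \<le> t"
    using compact_attains_inf[OF clo(1)[of u v]] by auto
  have "{t \<in> {u..d}. q t \<le> a} \<noteq> {}" using d q by auto
  then obtain c where c: "c \<in> {u..d}" "q c \<le> a" "\<And>t. t \<in> {u..d} \<Longrightarrow> q t \<le> a \<Longrightarrow> t \<le> c"
    using compact_attains_sup[OF clo(2)[of u d]] d by auto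
  show thesis
  proof (rule that[of c d])
    fix t assume "t \<in> {c<..<d}"
    then show "a < q t \<and> q t < b"
      using c(1) c(3)[of t] d(1) d(3)[of t] by force
  qed (use c d in auto)
qed

lemma crossing_subinterval_either:
  fixes q :: "real \<Rightarrow> real"
  assumes uv: "u \<le> v" and cont: "continuous_on {u..v} q" and ab: "a < b"
    and q: "q u \<le> a \<and> b \<le> q v \<or> b \<le> q u \<and> q v \<le> a"
  obtains c d where "u \<le> c" "c \<le> d" "d \<le> v" "b - a \<le> \<bar>q d - q c\<bar>" "\<And>t. t \<in> {c<..<d} \<Longrightarrow> a < q t \<and> q t < b"
  using q
proof
  assume "q u \<le> a \<and> b \<le> q v"
  then obtain c d where "u \<le> c" "c \<le> d" "d \<le> v" "q c \<le> a" "b \<le> q d" "\<And>t. t \<in> {c<..<d} \<Longrightarrow> a < q t \<and> q t < b"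
    using crossing_subinterval[OF uv cont _ _ ab] by blast
  then show thesis by (intro that[of c d]) auto
next
  assume q': "b \<le> q u \<and> q v \<le> a"
  have "continuous_on {u..v} (\<lambda>t. a + b - q t)" by (intro continuous_intros cont)
  then obtain c d where "u \<le> c" "c \<le> d" "d \<le> v" "a + b - q c \<le> a" "b \<le> a + b - q d"
     and *: "\<And>t. t \<in> {c<..<d} \<Longrightarrow> a < a + b - q t \<and> a + b - q t < b"
    using crossing_subinterval[OF uv, of "\<lambda>t. a + b - q t" a b] q' ab by (smt (verit, best))
  moreover have "a < q t \<and> q t < b" if "t \<in> {c<..<d}" for t
    using *[OF that] by simp
  ultimately show thesis by (intro that[of c d]) auto
qed

text \<open>Between the two parameters provided by \<open>crossing_subinterval\<close> the curve stays inside the annulus, and its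
  increment over that interval is at least \<open>b - a\<close> in modulus.\<close>

lemma crossing_length:
  fixes \<gamma> :: "real \<Rightarrow> complex"
  assumes uv: "u \<le> v" and der: "\<And>t. t \<in> {u..v} \<Longrightarrow> (\<gamma> has_vector_derivative \<gamma>' t) (at t within {u..v})"
    and cont: "continuous_on {u..v} \<gamma>'" and ab: "a < b"
    and q: "cmod (\<gamma> u) \<le> a \<and> b \<le> cmod (\<gamma> v) \<or> b \<le> cmod (\<gamma> u) \<and> cmod (\<gamma> v) \<le> a"
  shows "ennreal (b - a) \<le> (\<integral>\<^sup>+t. ennreal (indicator {t \<in> {u..v}. a < cmod (\<gamma> t) \<and> cmod (\<gamma> t) < b} t * cmod (\<gamma>' t)) \<partial>lborel)"
proof -
  have c\<gamma>: "continuous_on {u..v} \<gamma>"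
    using der by (meson continuous_on_eq_continuous_within has_vector_derivative_continuous)
  have cq: "continuous_on {u..v} (\<lambda>t. cmod (\<gamma> t))"
    by (intro continuous_intros c\<gamma>)
  obtain c d where cd: "u \<le> c" "c \<le> d" "d \<le> v" and le: "b - a \<le> \<bar>cmod (\<gamma> d) - cmod (\<gamma> c)\<bar>"
    and in_: "\<And>t. t \<in> {c<..<d} \<Longrightarrow> a < cmod (\<gamma> t) \<and> cmod (\<gamma> t) < b"
    using crossing_subinterval_either[OF uv cq ab q] by blast
  have sub: "{c..d} \<subseteq> {u..v}" using cd by auto
  have hi: "(\<gamma>' has_integral (\<gamma> d - \<gamma> c)) {c..d}"
    using cd sub by (intro fundamental_theorem_of_calculus has_vector_derivative_within_subset[OF der sub]) auto
  have cn: "continuous_on {c..d} (\<lambda>t. cmod (\<gamma>' t))"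
    using continuous_on_subset[OF cont sub] by (intro continuous_intros)
  have ni: "((\<lambda>t. cmod (\<gamma>' t)) has_integral integral {c..d} (\<lambda>t. cmod (\<gamma>' t))) {c..d}"
    using integrable_continuous_real[OF cn] by (rule integrable_integral)
  have "b - a \<le> cmod (\<gamma> d - \<gamma> c)" using le norm_triangle_ineq3[of "\<gamma> d" "\<gamma> c"] by linarith
  also have "\<dots> = cmod (integral {c..d} \<gamma>')" using hi by (simp add: integral_unique)
  also have "\<dots> \<le> integral {c..d} (\<lambda>t. cmod (\<gamma>' t))"
    by (rule integral_norm_bound_integral) (use hi ni in \<open>auto simp: has_integral_iff\<close>)
  finally have "ennreal (b - a) \<le> ennreal (integral {c..d} (\<lambda>t. cmod (\<gamma>' t)))" by (rule ennreal_leI)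
  also have "\<dots> = (\<integral>\<^sup>+t. ennreal (indicator {c<..<d} t * cmod (\<gamma>' t)) \<partial>lborel)"
    by (rule nn_integral_has_integral_lebesgue[symmetric]) (use ni in \<open>auto simp: has_integral_Icc_iff_Ioo\<close>)
  also have "\<dots> \<le> (\<integral>\<^sup>+t. ennreal (indicator {t \<in> {u..v}. a < cmod (\<gamma> t) \<and> cmod (\<gamma> t) < b} t * cmod (\<gamma>' t)) \<partial>lborel)"
    using in_ sub by (intro nn_integral_mono ennreal_leI mult_right_mono) (auto simp: indicator_def)
  finally show ?thesis .
qed

section \<open>The length-area inequality\<close>

definition dyadic_annulus :: "real \<Rightarrow> nat \<Rightarrow> complex set" where
  "dyadic_annulus m j = {w. m * 2 ^ j < cmod w \<and> cmod w < m * 2 ^ Suc j}"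

text \<open>A discrete substitute for the metric \<open>|dw| / |w|\<close> in logarithmic coordinates: crossing one annulus
  \<open>m 2\<^sup>j < |w| < m 2\<^sup>j\<^sup>+\<^sup>1\<close> costs at least one unit of weighted length.\<close>

definition dyadic_weight :: "real \<Rightarrow> nat \<Rightarrow> complex \<Rightarrow> real" where
  "dyadic_weight m N w = (\<Sum>j<N. indicator (dyadic_annulus m j) w / (m * 2 ^ j))"

lemma dyadic_annulus_borel [measurable]: "dyadic_annulus m j \<in> sets borel"
  unfolding dyadic_annulus_def by measurable

lemma dyadic_weight_nonneg: "m > 0 \<Longrightarrow> dyadic_weight m N w \<ge> 0"
  by (auto simp: dyadic_weight_def intro!: sum_nonneg)

lemma disjoint_dyadic_annulus:
  assumes "m > 0" shows "disjoint_family (dyadic_annulus m)"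
proof -
  have "dyadic_annulus m i \<inter> dyadic_annulus m j = {}" if "i < j" for i j
  proof -
    have "m * 2 ^ Suc i \<le> m * 2 ^ j"
      using that assms by (intro mult_left_mono power_increasing) auto
    then show ?thesis by (auto simp: dyadic_annulus_def)
  qed
  then show ?thesis
    unfolding disjoint_family_on_def by (metis inf_commute linorder_neqE_nat)
qed

lemma dyadic_weight_crossing:
  fixes \<gamma> :: "real \<Rightarrow> complex"
  assumes uv: "u \<le> v" and der: "\<And>t. t \<in> {u..v} \<Longrightarrow> (\<gamma> has_vector_derivative \<gamma>' t) (at t within {u..v})"
    and cont: "continuous_on {u..v} \<gamma>'" and m: "m > 0"
    and q: "cmod (\<gamma> u) \<le> m \<and> m * 2 ^ N \<le> cmod (\<gamma> v) \<or> m * 2 ^ N \<le> cmod (\<gamma> u) \<and> cmod (\<gamma> v) \<le> m"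
  shows "ennreal (real N) \<le> (\<integral>\<^sup>+t. ennreal (indicator {u..v} t * (dyadic_weight m N (\<gamma> t) * cmod (\<gamma>' t))) \<partial>lborel)"
proof -
  have c\<gamma>: "continuous_on {u..v} \<gamma>"
    using der by (meson continuous_on_eq_continuous_within has_vector_derivative_continuous)
  define I where "I j t = indicator {t \<in> {u..v}. m * 2 ^ j < cmod (\<gamma> t) \<and> cmod (\<gamma> t) < m * 2 ^ Suc j} t * cmod (\<gamma>' t)" for j t
  have [measurable]: "(\<lambda>t. ennreal (I j t / (m * 2 ^ j))) \<in> borel_measurable borel" for j
  proof -
    have [measurable]: "(\<lambda>t. indicator {u..v} t *\<^sub>R cmod (\<gamma> t)) \<in> borel_measurable borel"
      "(\<lambda>t. indicator {u..v} t *\<^sub>R cmod (\<gamma>' t)) \<in> borel_measurable borel"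
      by (intro borel_measurable_continuous_on_indicator continuous_intros c\<gamma> cont; simp)+
    have *: "I j t = indicator {x. m * 2 ^ j < x \<and> x < m * 2 ^ Suc j} (indicator {u..v} t *\<^sub>R cmod (\<gamma> t)) * (indicator {u..v} t *\<^sub>R cmod (\<gamma>' t))" for t
      by (auto simp: I_def indicator_def)
    have "I j \<in> borel_measurable borel" unfolding *[abs_def] by measurable
    then show ?thesis by measurable
  qed
  have one: "1 \<le> (\<integral>\<^sup>+t. ennreal (I j t / (m * 2 ^ j)) \<partial>lborel)" if "j < N" for j
  proof -
    have "m * 1 \<le> m * 2 ^ j" "m * 2 ^ Suc j \<le> m * 2 ^ N" "m * 2 ^ j < m * 2 ^ Suc j"
      using m that by (auto intro!: mult_left_mono power_increasing simp del: power_Suc)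
    then have le: "m \<le> m * 2 ^ j" "m * 2 ^ Suc j \<le> m * 2 ^ N" "m * 2 ^ j < m * 2 ^ Suc j"
      by (simp_all del: power_Suc)
    have "ennreal (m * 2 ^ Suc j - m * 2 ^ j) \<le> (\<integral>\<^sup>+t. ennreal (I j t) \<partial>lborel)"
      unfolding I_def
    proof (rule crossing_length[OF uv der cont le(3)])
      show "cmod (\<gamma> u) \<le> m * 2 ^ j \<and> m * 2 ^ Suc j \<le> cmod (\<gamma> v) \<or>
            m * 2 ^ Suc j \<le> cmod (\<gamma> u) \<and> cmod (\<gamma> v) \<le> m * 2 ^ j"
        using q le(1,2) by (meson order_trans)
    qed
    then have "ennreal (1 / (m * 2 ^ j)) * ennreal (m * 2 ^ j) \<le> ennreal (1 / (m * 2 ^ j)) * (\<integral>\<^sup>+t. ennreal (I j t) \<partial>lborel)"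
      by (intro mult_left_mono) auto
    also have "\<dots> = (\<integral>\<^sup>+t. ennreal (1 / (m * 2 ^ j)) * ennreal (I j t) \<partial>lborel)"
    proof (rule nn_integral_cmult[symmetric])
      have "(\<lambda>t. ennreal (m * 2 ^ j) * ennreal (I j t / (m * 2 ^ j))) \<in> borel_measurable borel" by measurable
      then show "(\<lambda>t. ennreal (I j t)) \<in> borel_measurable lborel"
        using m by (simp add: ennreal_mult'[symmetric])
    qed
    also have "\<dots> = (\<integral>\<^sup>+t. ennreal (I j t / (m * 2 ^ j)) \<partial>lborel)"
      using m by (simp add: ennreal_mult'[symmetric])
    finally show ?thesis using m by (simp add: ennreal_mult'[symmetric])
  qed
  have "ennreal (real N) = (\<Sum>j<N. 1)" by (simp add: ennreal_of_nat_eq_real_of_nat)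
  also have "\<dots> \<le> (\<Sum>j<N. (\<integral>\<^sup>+t. ennreal (I j t / (m * 2 ^ j)) \<partial>lborel))"
    by (intro sum_mono one) auto
  also have "\<dots> = (\<integral>\<^sup>+t. (\<Sum>j<N. ennreal (I j t / (m * 2 ^ j))) \<partial>lborel)"
    by (rule nn_integral_sum[symmetric]) measurable
  also have "\<dots> = (\<integral>\<^sup>+t. ennreal (\<Sum>j<N. I j t / (m * 2 ^ j)) \<partial>lborel)"
    using m by (subst sum_ennreal) (auto simp: I_def)
  also have "(\<lambda>t. \<Sum>j<N. I j t / (m * 2 ^ j)) = (\<lambda>t. indicator {u..v} t * (dyadic_weight m N (\<gamma> t) * cmod (\<gamma>' t)))"
    by (auto simp: fun_eq_iff I_def dyadic_weight_def dyadic_annulus_def indicator_def sum_distrib_left sum_distrib_right intro!: sum.cong)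
  finally show ?thesis .
qed

text \<open>The square of the weighted stretching is at most \<open>K / (m 2\<^sup>j)\<^sup>2\<close> times the Jacobian over the annulus with
  index \<open>j\<close>. The image of that part has area at most \<open>16 (m 2\<^sup>j)\<^sup>2\<close>, so each annulus contributes
  \<open>16 K\<close> to the integral of the square. The parameter \<open>\<epsilon>\<close> comes from using
  \<open>x \<le> (\<epsilon> x\<^sup>2 + 1 / \<epsilon>) / 2\<close> in place of the Cauchy-Schwarz inequality.\<close>

lemma length_area:
  fixes H G :: "complex \<Rightarrow> complex"
  assumes U: "open U" and holH: "H holomorphic_on U" and holG: "G holomorphic_on U"
    and S: "S \<in> sets borel" "S \<subseteq> U"
    and inj: "inj_on (\<lambda>z. H z + cnj (G z)) S"
    and K: "K \<ge> 1"
    and dil: "\<And>z. z \<in> S \<Longrightarrow> (cmod (deriv H z) + cmod (deriv G z))\<^sup>2 \<le> K * ((cmod (deriv H z))\<^sup>2 - (cmod (deriv G z))\<^sup>2)"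
    and A: "emeasure lborel S \<le> ennreal A" "A \<ge> 0" and m: "m > 0" and \<epsilon>: "\<epsilon> > 0"
  shows "(\<integral>\<^sup>+z. ennreal (indicator S z * (dyadic_weight m N (H z + cnj (G z) - w) * (cmod (deriv H z) + cmod (deriv G z)))) \<partial>lborel)
           \<le> ennreal (8 * \<epsilon> * K * real N + A / (2 * \<epsilon>))"
proof -
  define F where "F z = H z + cnj (G z) - w" for z
  define stretch where "stretch z = cmod (deriv H z) + cmod (deriv G z)" for z
  define J where "J z = (cmod (deriv H z))\<^sup>2 - (cmod (deriv G z))\<^sup>2" for z
  define Sj where "Sj j = {z \<in> S. F z \<in> dyadic_annulus m j}" for j
  have J0: "J z \<ge> 0" if "z \<in> S" for z
  proof -
    have "0 \<le> K * J z" using dil[OF that] by (simp add: J_def) (metis order_trans zero_le_power2)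
    then show ?thesis using K by (simp add: zero_le_mult_iff)
  qed
  have [measurable]: "S \<in> sets borel" by fact
  have cont: "continuous_on S F" "continuous_on S J"
  proof -
    have "continuous_on S H" "continuous_on S G" "continuous_on S (deriv H)" "continuous_on S (deriv G)"
      using holH holG holomorphic_deriv[OF holH U] holomorphic_deriv[OF holG U]
      by (meson S(2) continuous_on_subset holomorphic_on_imp_continuous_on)+
    then show "continuous_on S F" "continuous_on S J"
      unfolding F_def J_def by (auto intro!: continuous_intros)
  qed
  have [measurable]: "(\<lambda>z. indicator S z *\<^sub>R F z) \<in> borel_measurable borel"
     "(\<lambda>z. indicator S z *\<^sub>R J z) \<in> borel_measurable borel"
    by (intro borel_measurable_continuous_on_indicator S cont)+
  have Sj: "Sj j \<in> sets borel" for j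
  proof -
    have "Sj j = S \<inter> (\<lambda>z. indicator S z *\<^sub>R F z) -` dyadic_annulus m j"
      by (auto simp: Sj_def indicator_def)
    moreover have "(\<lambda>z. indicator S z *\<^sub>R F z) -` dyadic_annulus m j \<inter> space borel \<in> sets borel"
      by (rule measurable_sets[where A = borel]) measurable
    ultimately show ?thesis by simp
  qed
  have mJ: "(\<lambda>z. indicator (Sj j) z * J z) \<in> borel_measurable borel" for j
  proof -
    have "(\<lambda>z. indicator (Sj j) z * J z) = (\<lambda>z. indicator (Sj j) z * (indicator S z *\<^sub>R J z))"
      by (auto simp: Sj_def indicator_def)
    also have "\<dots> \<in> borel_measurable borel" using Sj[of j] by measurable
    finally show ?thesis .
  qed
  have area: "(\<integral>\<^sup>+z. ennreal (indicator (Sj j) z * J z) \<partial>lborel) \<le> ennreal (4 * (m * 2 ^ Suc j)\<^sup>2)" for j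
    unfolding J_def
  proof (rule nn_integral_jacobian_harmonic_le[where H = H and G = G and w = w])
    show "Sj j \<in> sets borel" by (rule Sj)
    show "inj_on (\<lambda>z. H z + cnj (G z)) (Sj j)"
      using inj by (rule inj_on_subset) (auto simp: Sj_def)
    show "0 \<le> m * 2 ^ Suc j" using m by simp
    show "(\<lambda>z. indicator (Sj j) z * ((cmod (deriv H z))\<^sup>2 - (cmod (deriv G z))\<^sup>2)) \<in> borel_measurable borel"
      using mJ[of j] by (simp add: J_def)
    fix z assume z: "z \<in> Sj j"
    then have zS: "z \<in> S" "z \<in> U" using S by (auto simp: Sj_def)
    show "(H has_field_derivative deriv H z) (at z)" "(G has_field_derivative deriv G z) (at z)"
      using holH holG U zS by (auto intro: holomorphic_derivI)
    show "H z + cnj (G z) \<in> cball w (m * 2 ^ Suc j)"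
      using z by (auto simp: Sj_def F_def dyadic_annulus_def dist_norm norm_minus_commute algebra_simps)
    show "cmod (deriv G z) \<le> cmod (deriv H z)"
      using J0[OF zS(1)] by (simp add: J_def)
  qed
  define c where "c j = \<epsilon> * K / (2 * (m * 2 ^ j)\<^sup>2)" for j
  have c0: "c j \<ge> 0" for j using \<epsilon> K by (simp add: c_def)
  have pw: "indicator S z * (dyadic_weight m N (F z) * stretch z)
      \<le> (\<Sum>j<N. c j * (indicator (Sj j) z * J z)) + indicator S z * (1 / (2 * \<epsilon>))" for z
  proof (cases "z \<in> S")
    case True
    have nn: "(\<Sum>j<N. c j * (indicator (Sj j) z * J z)) \<ge> 0"
      using c0 J0 True by (intro sum_nonneg mult_nonneg_nonneg) auto
    show ?thesis
    proof (cases "\<exists>j<N. F z \<in> dyadic_annulus m j")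
      case False
      then have "dyadic_weight m N (F z) = 0" by (auto simp: dyadic_weight_def)
      then show ?thesis using nn \<epsilon> by simp
    next
      case ex: True
      then obtain j where j: "j < N" "F z \<in> dyadic_annulus m j" by auto
      define x where "x = stretch z / (m * 2 ^ j)"
      have dj: "disjoint_family_on (dyadic_annulus m) {..<N}"
        using disjoint_dyadic_annulus[OF m] by (rule disjoint_family_on_mono[rotated]) auto
      have "dyadic_weight m N (F z) = (\<Sum>i<N. (1 / (m * 2 ^ i)) * indicator (dyadic_annulus m i) (F z))"
        unfolding dyadic_weight_def by (intro sum.cong) auto
      also have "\<dots> = 1 / (m * 2 ^ j)"
        by (rule sum_indicator_disjoint_family[OF dj j(2)]) (use j in auto)
      finally have 1: "dyadic_weight m N (F z) * stretch z = x" by (simp add: x_def)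
      have "(\<epsilon> * x - 1)\<^sup>2 \<ge> 0" by simp
      then have amgm: "x \<le> \<epsilon> * x\<^sup>2 / 2 + 1 / (2 * \<epsilon>)"
        using \<epsilon> by (simp add: power2_diff field_simps power2_eq_square)
      have "x\<^sup>2 \<le> K * J z / (m * 2 ^ j)\<^sup>2"
        unfolding x_def power_divide using dil[OF True] by (intro divide_right_mono) (auto simp: stretch_def J_def)
      then have "\<epsilon> / 2 * x\<^sup>2 \<le> \<epsilon> / 2 * (K * J z / (m * 2 ^ j)\<^sup>2)"
        using \<epsilon> by (intro mult_left_mono) auto
      then have "\<epsilon> * x\<^sup>2 / 2 \<le> c j * (indicator (Sj j) z * J z)"
        using j True by (simp add: Sj_def c_def)
      also have "\<dots> \<le> (\<Sum>j<N. c j * (indicator (Sj j) z * J z))"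
        using c0 J0 True j by (intro member_le_sum) auto
      finally show ?thesis using 1 True amgm by simp
    qed
  qed (auto simp: Sj_def)
  have "(\<integral>\<^sup>+z. ennreal (indicator S z * (dyadic_weight m N (F z) * stretch z)) \<partial>lborel)
     \<le> (\<integral>\<^sup>+z. (\<Sum>j<N. ennreal (c j) * ennreal (indicator (Sj j) z * J z)) + ennreal (1 / (2 * \<epsilon>)) * indicator S z \<partial>lborel)"
  proof (rule nn_integral_mono)
    fix z
    have "ennreal (indicator S z * (dyadic_weight m N (F z) * stretch z))
       \<le> ennreal ((\<Sum>j<N. c j * (indicator (Sj j) z * J z)) + indicator S z * (1 / (2 * \<epsilon>)))"
      by (rule ennreal_leI[OF pw])
    also have "\<dots> = (\<Sum>j<N. ennreal (c j * (indicator (Sj j) z * J z))) + ennreal (indicator S z * (1 / (2 * \<epsilon>)))"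
      using c0 J0 \<epsilon> by (subst ennreal_plus) (auto intro!: sum_nonneg simp: Sj_def indicator_def sum_ennreal)
    also have "\<dots> = (\<Sum>j<N. ennreal (c j) * ennreal (indicator (Sj j) z * J z)) + ennreal (1 / (2 * \<epsilon>)) * indicator S z"
      using c0 by (auto simp: ennreal_mult' indicator_def)
    finally show "ennreal (indicator S z * (dyadic_weight m N (F z) * stretch z)) \<le> \<dots>" .
  qed
  also have "\<dots> = (\<integral>\<^sup>+z. (\<Sum>j<N. ennreal (c j) * ennreal (indicator (Sj j) z * J z)) \<partial>lborel)
      + (\<integral>\<^sup>+z. ennreal (1 / (2 * \<epsilon>)) * indicator S z \<partial>lborel)"
    using mJ by (intro nn_integral_add borel_measurable_sum borel_measurable_times_ennreal measurable_compose[OF _ measurable_ennreal]) auto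
  also have "(\<integral>\<^sup>+z. ennreal (1 / (2 * \<epsilon>)) * indicator S z \<partial>lborel) = ennreal (1 / (2 * \<epsilon>)) * emeasure lborel S"
    by (rule nn_integral_cmult_indicator) simp
  also have "(\<integral>\<^sup>+z. (\<Sum>j<N. ennreal (c j) * ennreal (indicator (Sj j) z * J z)) \<partial>lborel) + ennreal (1 / (2 * \<epsilon>)) * emeasure lborel S
      = (\<Sum>j<N. (\<integral>\<^sup>+z. ennreal (c j) * ennreal (indicator (Sj j) z * J z) \<partial>lborel)) + ennreal (1 / (2 * \<epsilon>)) * emeasure lborel S"
    using mJ by (intro arg_cong2[where f = plus] refl nn_integral_sum borel_measurable_times_ennreal measurable_compose[OF _ measurable_ennreal]) auto
  also have "\<dots> = (\<Sum>j<N. ennreal (c j) * (\<integral>\<^sup>+z. ennreal (indicator (Sj j) z * J z) \<partial>lborel)) + ennreal (1 / (2 * \<epsilon>)) * emeasure lborel S"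
    using mJ by (intro arg_cong2[where f = plus] refl sum.cong nn_integral_cmult measurable_compose[OF _ measurable_ennreal]) auto
  also have "\<dots> \<le> (\<Sum>j<N. ennreal (c j) * ennreal (4 * (m * 2 ^ Suc j)\<^sup>2)) + ennreal (1 / (2 * \<epsilon>)) * ennreal A"
    by (intro add_mono sum_mono mult_left_mono area A) auto
  also have "\<dots> = ennreal ((\<Sum>j<N. c j * (4 * (m * 2 ^ Suc j)\<^sup>2)) + 1 / (2 * \<epsilon>) * A)"
  proof -
    have "ennreal ((\<Sum>j<N. c j * (4 * (m * 2 ^ Suc j)\<^sup>2)) + 1 / (2 * \<epsilon>) * A)
        = ennreal (\<Sum>j<N. c j * (4 * (m * 2 ^ Suc j)\<^sup>2)) + ennreal (1 / (2 * \<epsilon>) * A)"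
      using c0 A(2) \<epsilon> by (intro ennreal_plus sum_nonneg mult_nonneg_nonneg) auto
    also have "ennreal (\<Sum>j<N. c j * (4 * (m * 2 ^ Suc j)\<^sup>2)) = (\<Sum>j<N. ennreal (c j * (4 * (m * 2 ^ Suc j)\<^sup>2)))"
      using c0 by (intro sum_ennreal[symmetric] mult_nonneg_nonneg) auto
    also have "\<dots> = (\<Sum>j<N. ennreal (c j) * ennreal (4 * (m * 2 ^ Suc j)\<^sup>2))"
      using c0 by (intro sum.cong refl ennreal_mult) auto
    also have "ennreal (1 / (2 * \<epsilon>) * A) = ennreal (1 / (2 * \<epsilon>)) * ennreal A"
      using A(2) \<epsilon> by (intro ennreal_mult) auto
    finally show ?thesis by (rule sym)
  qed
  also have "(\<Sum>j<N. c j * (4 * (m * 2 ^ Suc j)\<^sup>2)) = 8 * \<epsilon> * K * real N"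
  proof -
    have *: "c j * (4 * (m * 2 ^ Suc j)\<^sup>2) = 8 * \<epsilon> * K" for j
      using m by (simp add: c_def field_simps power2_eq_square)
    show ?thesis unfolding * by simp
  qed
  finally show ?thesis unfolding F_def stretch_def by simp
qed

section \<open>Extremal values on circles and a gradient bound\<close>

text \<open>By invariance of domain the image of the open ball is open, so neither the farthest point from \<open>w\<close> nor,
  if \<open>w\<close> is not attained, the closest one can be the value at an interior point.\<close>

lemma extreme_on_sphere:
  fixes f :: "complex \<Rightarrow> complex"
  assumes cont: "continuous_on (cball z0 t) f" and inj: "inj_on f (cball z0 t)" and z: "z \<in> cball z0 t"
  shows "\<exists>z1\<in>sphere z0 t. cmod (f z - w) \<le> cmod (f z1 - w)"
    and "w \<notin> f ` cball z0 t \<Longrightarrow> \<exists>z1\<in>sphere z0 t. cmod (f z1 - w) \<le> cmod (f z - w)"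
proof -
  have t: "cball z0 t \<noteq> {}" using z by blast
  have cd: "continuous_on (cball z0 t) (\<lambda>z. cmod (f z - w))" by (intro continuous_intros cont)
  have op: "open (f ` ball z0 t)"
    by (intro invariance_of_domain continuous_on_subset[OF cont] inj_on_subset[OF inj]) auto
  have nbhd: "\<exists>e>0. \<forall>y. cmod (y - f z1) < e \<longrightarrow> y \<in> f ` cball z0 t"
    if "z1 \<in> cball z0 t" "z1 \<notin> sphere z0 t" for z1
  proof -
    have "f z1 \<in> f ` ball z0 t" using that by auto
    then obtain e where "e > 0" "ball (f z1) e \<subseteq> f ` ball z0 t" using op open_contains_ball by blast
    moreover have "f ` ball z0 t \<subseteq> f ` cball z0 t" by (rule image_mono) auto
    ultimately show ?thesis
      by (intro exI[of _ e]) (auto simp: dist_norm norm_minus_commute subset_iff)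
  qed
  obtain z1 where z1: "z1 \<in> cball z0 t" "\<And>y. y \<in> cball z0 t \<Longrightarrow> cmod (f y - w) \<le> cmod (f z1 - w)"
    using continuous_attains_sup[OF compact_cball t cd] by auto
  have "z1 \<in> sphere z0 t"
  proof (rule ccontr)
    assume "z1 \<notin> sphere z0 t"
    then obtain e where e: "e > 0" "\<And>y. cmod (y - f z1) < e \<Longrightarrow> y \<in> f ` cball z0 t"
      using nbhd[OF z1(1)] by blast
    define u where "u = (if f z1 = w then 1 else sgn (f z1 - w))"
    have u: "cmod u = 1" by (simp add: u_def norm_sgn)
    have "f z1 - w = of_real (cmod (f z1 - w)) * u"
      by (simp add: u_def sgn_eq)
    then have "f z1 + of_real (e/2) * u - w = of_real (cmod (f z1 - w) + e/2) * u"
      by (simp add: algebra_simps)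
    then have "cmod (f z1 + of_real (e/2) * u - w) = cmod (f z1 - w) + e/2"
      using u e by (simp only: norm_mult norm_of_real) simp
    moreover have "f z1 + of_real (e/2) * u \<in> f ` cball z0 t"
      by (rule e(2)) (use u e in \<open>simp add: norm_mult\<close>)
    then obtain y where "y \<in> cball z0 t" "f y = f z1 + of_real (e/2) * u" by (metis imageE)
    ultimately show False using z1(2)[of y] e by simp
  qed
  then show "\<exists>z1\<in>sphere z0 t. cmod (f z - w) \<le> cmod (f z1 - w)" using z1 z by blast
  assume w: "w \<notin> f ` cball z0 t"
  obtain z2 where z2: "z2 \<in> cball z0 t" "\<And>y. y \<in> cball z0 t \<Longrightarrow> cmod (f z2 - w) \<le> cmod (f y - w)"
    using continuous_attains_inf[OF compact_cball t cd] by auto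
  have "z2 \<in> sphere z0 t"
  proof (rule ccontr)
    assume "z2 \<notin> sphere z0 t"
    then obtain e where e: "e > 0" "\<And>y. cmod (y - f z2) < e \<Longrightarrow> y \<in> f ` cball z0 t"
      using nbhd[OF z2(1)] by blast
    have pos: "cmod (f z2 - w) > 0" using w z2 by auto
    define s where "s = min (1/2) (e / (2 * cmod (f z2 - w)))"
    have s: "0 < s" "s < 1" using e pos by (auto simp: s_def)
    have "s * cmod (f z2 - w) \<le> e / (2 * cmod (f z2 - w)) * cmod (f z2 - w)"
      by (intro mult_right_mono) (auto simp: s_def)
    then have sl: "s * cmod (f z2 - w) < e" using e pos by simp
    have "f z2 - of_real s * (f z2 - w) \<in> f ` cball z0 t"
      by (rule e(2)) (use sl s in \<open>simp add: norm_mult\<close>)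
    then obtain y where y: "y \<in> cball z0 t" "f y = f z2 - of_real s * (f z2 - w)" by (metis imageE)
    then have "f y - w = of_real (1 - s) * (f z2 - w)" by (simp add: algebra_simps)
    then have "cmod (f y - w) = (1 - s) * cmod (f z2 - w)"
      using s by (simp only: norm_mult norm_of_real)
    then show False using z2(2)[OF y(1)] mult_pos_pos[OF s(1) pos] by (simp add: algebra_simps)
  qed
  then show "\<exists>z1\<in>sphere z0 t. cmod (f z1 - w) \<le> cmod (f z - w)" using z2 z by blast
qed

text \<open>The function \<open>exp (P / M)\<close> takes values between \<open>1/e\<close> and \<open>e\<close> in modulus, and Cauchy's
  inequality for its derivative gives the factor \<open>e\<^sup>2 \<le> 9\<close>.\<close>

lemma deriv_bound_of_Re_bound:
  assumes S: "open S" "cball z0 r \<subseteq> S" and P: "P holomorphic_on S" and r: "r > 0" and M: "M > 0"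
    and bd: "\<And>z. z \<in> cball z0 r \<Longrightarrow> \<bar>Re (P z)\<bar> \<le> M"
  shows "cmod (deriv P z0) * r \<le> 9 * M"
proof -
  define E where "E z = exp (P z / of_real M)" for z
  have z0: "z0 \<in> S" using S r by auto
  have hol: "E holomorphic_on S" unfolding E_def using P M by (intro holomorphic_intros) auto
  have "(P has_field_derivative deriv P z0) (at z0)" using holomorphic_derivI[OF P S(1) z0] .
  then have "(E has_field_derivative E z0 * (deriv P z0 / of_real M)) (at z0)"
    unfolding E_def using M by (auto intro!: derivative_eq_intros)
  then have dE: "deriv E z0 = E z0 * (deriv P z0 / of_real M)" by (rule DERIV_imp_deriv)
  have nE: "exp (-1) \<le> cmod (E z) \<and> cmod (E z) \<le> exp 1" if "z \<in> cball z0 r" for z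
    using bd[OF that] M by (auto simp: E_def abs_le_iff field_simps)
  have "cmod ((deriv ^^ 1) E z0) \<le> fact 1 * exp 1 / r ^ 1"
  proof (rule Cauchy_inequality)
    show "E holomorphic_on ball z0 r"
      using ball_subset_cball S(2) by (blast intro: holomorphic_on_subset[OF hol])
    show "continuous_on (cball z0 r) E"
      using S(2) by (blast intro: holomorphic_on_imp_continuous_on holomorphic_on_subset[OF hol])
  qed (use r nE in \<open>auto simp: dist_norm\<close>)
  then have "cmod (deriv E z0) \<le> exp 1 / r" by simp
  then have 1: "cmod (E z0) * cmod (deriv P z0) * r \<le> exp 1 * M"
    unfolding dE using r M by (simp add: norm_mult norm_divide field_simps)
  have "cmod (deriv P z0) * r = exp 1 * (exp (-1) * (cmod (deriv P z0) * r))"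
    by (simp add: exp_minus)
  also have "\<dots> \<le> exp 1 * (cmod (E z0) * (cmod (deriv P z0) * r))"
    using nE[of z0] r by (intro mult_left_mono mult_right_mono) auto
  also have "\<dots> \<le> exp 1 * (exp 1 * M)" using 1 by (intro mult_left_mono) (auto simp: mult.assoc)
  also have "\<dots> \<le> 3 * (3 * M)" using exp_le M by (intro mult_mono) auto
  finally show ?thesis by simp
qed

section \<open>Quasiconformal harmonic maps in logarithmic coordinates\<close>

locale harmonic_qc =
  fixes V :: "complex set" and K :: real and h g :: "complex \<Rightarrow> complex"
  assumes openV: "open V" and holh: "h holomorphic_on V" and holg: "g holomorphic_on V"
    and K1: "K \<ge> 1"
    and dil: "\<And>z. z \<in> V \<Longrightarrow> (cmod (deriv h z) + cmod (deriv g z))\<^sup>2 \<le> K * ((cmod (deriv h z))\<^sup>2 - (cmod (deriv g z))\<^sup>2)"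
    and inj: "inj_on (\<lambda>z. h z + cnj (g z)) V"
begin

definition f :: "complex \<Rightarrow> complex" where "f z = h z + cnj (g z)"
definition stretch :: "complex \<Rightarrow> real" where "stretch z = cmod (deriv h z) + cmod (deriv g z)"

lemma stretch_nonneg: "stretch z \<ge> 0" by (simp add: stretch_def)

lemma continuous_f: "continuous_on V f"
  unfolding f_def using holomorphic_on_imp_continuous_on[OF holh] holomorphic_on_imp_continuous_on[OF holg]
  by (intro continuous_intros)

lemma inj_f: "inj_on f V" using inj unfolding f_def[abs_def] .

text \<open>In the coordinate \<open>\<zeta> = log ((z - z0) / c)\<close> the circles about \<open>z0\<close> and the radii from \<open>z0\<close> become
  vertical and horizontal segments, so that only Fubini's theorem is needed to integrate over families
  of them. The map \<open>\<zeta> \<mapsto> z0 + c exp \<zeta>\<close> is conformal, hence does not affect the dilatation.\<close>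

lemma log_length_area:
  assumes c: "c \<noteq> 0" and S: "S \<in> sets borel" "\<And>\<zeta>. \<zeta> \<in> S \<Longrightarrow> z0 + c * exp \<zeta> \<in> V"
    and strip: "\<And>\<zeta> \<xi>. \<zeta> \<in> S \<Longrightarrow> \<xi> \<in> S \<Longrightarrow> \<bar>Im \<zeta> - Im \<xi>\<bar> < 2 * pi"
    and A: "emeasure lborel S \<le> ennreal A" "A \<ge> 0" and m: "m > 0" and \<epsilon>: "\<epsilon> > 0"
  shows "(\<integral>\<^sup>+\<zeta>. ennreal (indicator S \<zeta> * (dyadic_weight m N (f (z0 + c * exp \<zeta>) - w) * (stretch (z0 + c * exp \<zeta>) * cmod (c * exp \<zeta>)))) \<partial>lborel)
           \<le> ennreal (8 * \<epsilon> * K * real N + A / (2 * \<epsilon>))"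
proof -
  define E where "E \<zeta> = z0 + c * exp \<zeta>" for \<zeta>
  define U where "U = E -` V"
  have [continuous_intros]: "continuous_on X E" for X unfolding E_def by (intro continuous_intros)
  have U: "open U" unfolding U_def by (intro open_vimage openV continuous_intros)
  have derE: "(E has_field_derivative c * exp \<zeta>) (at \<zeta>)" for \<zeta>
    unfolding E_def by (auto intro!: derivative_eq_intros)
  have der: "((\<lambda>\<zeta>. k (E \<zeta>)) has_field_derivative deriv k (E \<zeta>) * (c * exp \<zeta>)) (at \<zeta>)"
    if "k holomorphic_on V" "\<zeta> \<in> U" for k \<zeta>
    using DERIV_chain2[OF holomorphic_derivI[OF that(1) openV] derE] that by (auto simp: U_def)
  have hol: "(\<lambda>\<zeta>. k (E \<zeta>)) holomorphic_on U" if "k holomorphic_on V" for k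
    using der[OF that] unfolding holomorphic_on_open[OF U] by blast
  have d: "deriv (\<lambda>\<zeta>. k (E \<zeta>)) \<zeta> = deriv k (E \<zeta>) * (c * exp \<zeta>)" if "k holomorphic_on V" "\<zeta> \<in> U" for k \<zeta>
    by (rule DERIV_imp_deriv[OF der[OF that]])
  have SU: "S \<subseteq> U" using S by (auto simp: U_def E_def)
  have injE: "inj_on (\<lambda>z. h (E z) + cnj (g (E z))) S"
  proof (rule inj_onI)
    fix \<zeta> \<xi> assume *: "\<zeta> \<in> S" "\<xi> \<in> S" "h (E \<zeta>) + cnj (g (E \<zeta>)) = h (E \<xi>) + cnj (g (E \<xi>))"
    moreover have "E \<zeta> \<in> V" "E \<xi> \<in> V" using * SU by (auto simp: U_def)
    ultimately have "E \<zeta> = E \<xi>" using inj_onD[OF inj, of "E \<zeta>" "E \<xi>"] by simp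
    then have "exp \<zeta> = exp \<xi>" using c by (simp add: E_def)
    with strip[OF *(1,2)] show "\<zeta> = \<xi>" by (rule exp_complex_eqI)
  qed
  have dl: "(cmod (deriv (\<lambda>\<zeta>. h (E \<zeta>)) z) + cmod (deriv (\<lambda>\<zeta>. g (E \<zeta>)) z))\<^sup>2
         \<le> K * ((cmod (deriv (\<lambda>\<zeta>. h (E \<zeta>)) z))\<^sup>2 - (cmod (deriv (\<lambda>\<zeta>. g (E \<zeta>)) z))\<^sup>2)" if "z \<in> S" for z
  proof -
    have zU: "z \<in> U" "E z \<in> V" using that SU by (auto simp: U_def)
    have "(cmod (deriv h (E z)) + cmod (deriv g (E z)))\<^sup>2 * (cmod (c * exp z))\<^sup>2
        \<le> K * ((cmod (deriv h (E z)))\<^sup>2 - (cmod (deriv g (E z)))\<^sup>2) * (cmod (c * exp z))\<^sup>2"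
      by (intro mult_right_mono dil zU) auto
    then show ?thesis
      unfolding d[OF holh zU(1)] d[OF holg zU(1)] norm_mult by (simp add: power_mult_distrib algebra_simps power2_eq_square)
  qed
  have "(\<integral>\<^sup>+z. ennreal (indicator S z * (dyadic_weight m N (h (E z) + cnj (g (E z)) - w) * (cmod (deriv (\<lambda>\<zeta>. h (E \<zeta>)) z) + cmod (deriv (\<lambda>\<zeta>. g (E \<zeta>)) z)))) \<partial>lborel)
           \<le> ennreal (8 * \<epsilon> * K * real N + A / (2 * \<epsilon>))"
    by (rule length_area[OF U hol[OF holh] hol[OF holg] S(1) SU injE K1 dl A m \<epsilon>])
  also have "(\<lambda>z. ennreal (indicator S z * (dyadic_weight m N (h (E z) + cnj (g (E z)) - w) * (cmod (deriv (\<lambda>\<zeta>. h (E \<zeta>)) z) + cmod (deriv (\<lambda>\<zeta>. g (E \<zeta>)) z)))))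
     = (\<lambda>\<zeta>. ennreal (indicator S \<zeta> * (dyadic_weight m N (f (E \<zeta>) - w) * (stretch (E \<zeta>) * cmod (c * exp \<zeta>)))))"
  proof (rule ext)
    fix z
    show "ennreal (indicator S z * (dyadic_weight m N (h (E z) + cnj (g (E z)) - w) * (cmod (deriv (\<lambda>\<zeta>. h (E \<zeta>)) z) + cmod (deriv (\<lambda>\<zeta>. g (E \<zeta>)) z))))
     = ennreal (indicator S z * (dyadic_weight m N (f (E z) - w) * (stretch (E z) * cmod (c * exp z))))"
    proof (cases "z \<in> S")
      case True
      then have zU: "z \<in> U" using SU by auto
      show ?thesis unfolding d[OF holh zU(1)] d[OF holg zU(1)] f_def stretch_def
        by (simp add: norm_mult algebra_simps)
    qed simp
  qed
  finally show ?thesis unfolding E_def .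
qed

lemma log_crossing:
  assumes uv: "u \<le> v" and V: "\<And>t. t \<in> {u..v} \<Longrightarrow> z0 + c * exp (p + of_real t * q) \<in> V"
    and q: "cmod q = 1" and m: "m > 0"
    and ends: "cmod (f (z0 + c * exp (p + of_real u * q)) - w) \<le> m \<and> m * 2 ^ N \<le> cmod (f (z0 + c * exp (p + of_real v * q)) - w)
       \<or> m * 2 ^ N \<le> cmod (f (z0 + c * exp (p + of_real u * q)) - w) \<and> cmod (f (z0 + c * exp (p + of_real v * q)) - w) \<le> m"
  shows "ennreal (real N) \<le> (\<integral>\<^sup>+t. ennreal (indicator {u..v} t * (dyadic_weight m N (f (z0 + c * exp (p + of_real t * q)) - w) *
      (stretch (z0 + c * exp (p + of_real t * q)) * cmod (c * exp (p + of_real t * q))))) \<partial>lborel)"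
proof -
  define E where "E t = z0 + c * exp (p + of_real t * q)" for t :: real
  define E' where "E' t = c * exp (p + of_real t * q) * q" for t :: real
  have derE: "(E has_vector_derivative E' t) (at t within {u..v})" for t
  proof -
    have "((\<lambda>x. z0 + c * exp (p + x * q)) has_field_derivative E' t) (at (of_real t))"
      unfolding E'_def by (auto intro!: derivative_eq_intros)
    from has_vector_derivative_real_field[OF this] show ?thesis
      unfolding E_def by (rule has_vector_derivative_at_within)
  qed
  have derk: "((\<lambda>t. k (E t)) has_vector_derivative (deriv k (E t) * E' t)) (at t within {u..v})"
    if "k holomorphic_on V" "t \<in> {u..v}" for k t
  proof -
    have "(k has_field_derivative deriv k (E t)) (at (E t))"
      using that V[OF that(2)] by (auto simp: E_def intro: holomorphic_derivI[OF _ openV])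
    from field_vector_diff_chain_within[OF derE has_field_derivative_at_within[OF this]]
    show ?thesis by (simp add: o_def mult.commute)
  qed
  define \<gamma> where "\<gamma> t = f (E t) - w" for t
  define \<gamma>' where "\<gamma>' t = deriv h (E t) * E' t + cnj (deriv g (E t) * E' t)" for t
  have der: "(\<gamma> has_vector_derivative \<gamma>' t) (at t within {u..v})" if "t \<in> {u..v}" for t
  proof -
    have "((\<lambda>t. h (E t) + cnj (g (E t)) - w) has_vector_derivative \<gamma>' t - 0) (at t within {u..v})"
      unfolding \<gamma>'_def
      by (rule has_vector_derivative_diff[OF has_vector_derivative_add[OF derk[OF holh that]
            has_vector_derivative_cnj[OF derk[OF holg that]]] has_vector_derivative_const])
    then show ?thesis unfolding \<gamma>_def f_def by simp
  qed
  have cE: "continuous_on {u..v} E" "continuous_on {u..v} E'"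
    unfolding E_def E'_def by (intro continuous_intros)+
  have "continuous_on V (deriv h)" "continuous_on V (deriv g)"
    using holomorphic_deriv[OF holh openV] holomorphic_deriv[OF holg openV]
    by (simp_all add: holomorphic_on_imp_continuous_on)
  moreover have "E ` {u..v} \<subseteq> V" using V by (auto simp: E_def)
  ultimately have "continuous_on {u..v} (\<lambda>t. deriv h (E t))" "continuous_on {u..v} (\<lambda>t. deriv g (E t))"
    using continuous_on_compose2[OF _ cE(1)] by blast+
  then have cont: "continuous_on {u..v} \<gamma>'"
    unfolding \<gamma>'_def using cE by (intro continuous_intros)
  have "ennreal (real N) \<le> (\<integral>\<^sup>+t. ennreal (indicator {u..v} t * (dyadic_weight m N (\<gamma> t) * cmod (\<gamma>' t))) \<partial>lborel)"
    by (rule dyadic_weight_crossing[OF uv der cont m ends[folded E_def, folded \<gamma>_def]])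
  also have "\<dots> \<le> (\<integral>\<^sup>+t. ennreal (indicator {u..v} t * (dyadic_weight m N (f (E t) - w) * (stretch (E t) * cmod (c * exp (p + of_real t * q))))) \<partial>lborel)"
  proof (intro nn_integral_mono ennreal_leI mult_left_mono)
    fix t
    have E': "cmod (E' t) = cmod (c * exp (p + of_real t * q))" using q by (simp add: E'_def norm_mult)
    have "cmod (\<gamma>' t) \<le> cmod (deriv h (E t) * E' t) + cmod (cnj (deriv g (E t) * E' t))"
      unfolding \<gamma>'_def by (rule norm_triangle_ineq)
    also have "\<dots> = stretch (E t) * cmod (E' t)" by (simp only: complex_mod_cnj norm_mult stretch_def distrib_right)
    finally have "cmod (\<gamma>' t) \<le> stretch (E t) * cmod (c * exp (p + of_real t * q))" unfolding E' .
    then show "dyadic_weight m N (\<gamma> t) * cmod (\<gamma>' t) \<le> dyadic_weight m N (f (E t) - w) * (stretch (E t) * cmod (c * exp (p + of_real t * q)))"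
      unfolding \<gamma>_def using dyadic_weight_nonneg[OF m] by (intro mult_left_mono)
  qed auto
  finally show ?thesis unfolding E_def .
qed

end

section \<open>A Harnack inequality for omitted values\<close>

lemma nn_integral_complex_ge:
  fixes \<Phi> :: "complex \<Rightarrow> ennreal"
  assumes "\<Phi> \<in> borel_measurable borel" "a \<le> b" "c \<ge> 0"
  shows "(\<And>x. x \<in> {a..b} \<Longrightarrow> ennreal c \<le> (\<integral>\<^sup>+y. \<Phi> (Complex x y) \<partial>lborel)) \<Longrightarrow> ennreal (c * (b - a)) \<le> (\<integral>\<^sup>+z. \<Phi> z \<partial>lborel)"
    and "(\<And>y. y \<in> {a..b} \<Longrightarrow> ennreal c \<le> (\<integral>\<^sup>+x. \<Phi> (Complex x y) \<partial>lborel)) \<Longrightarrow> ennreal (c * (b - a)) \<le> (\<integral>\<^sup>+z. \<Phi> z \<partial>lborel)"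
proof -
  have eq: "(\<integral>\<^sup>+x. ennreal c * indicator {a..b} x \<partial>lborel) = ennreal (c * (b - a))"
    using assms by (simp add: nn_integral_cmult_indicator ennreal_mult)
  show "ennreal (c * (b - a)) \<le> (\<integral>\<^sup>+z. \<Phi> z \<partial>lborel)"
    if *: "\<And>x. x \<in> {a..b} \<Longrightarrow> ennreal c \<le> (\<integral>\<^sup>+y. \<Phi> (Complex x y) \<partial>lborel)"
    unfolding nn_integral_complex_iterated(1)[OF assms(1)] eq[symmetric]
    by (rule nn_integral_mono) (use * in \<open>auto simp: indicator_def\<close>)
  show "ennreal (c * (b - a)) \<le> (\<integral>\<^sup>+z. \<Phi> z \<partial>lborel)"
    if *: "\<And>y. y \<in> {a..b} \<Longrightarrow> ennreal c \<le> (\<integral>\<^sup>+x. \<Phi> (Complex x y) \<partial>lborel)"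
    unfolding nn_integral_complex_iterated(2)[OF assms(1)] eq[symmetric]
    by (rule nn_integral_mono) (use * in \<open>auto simp: indicator_def\<close>)
qed

lemma emeasure_subset_cbox_complex:
  assumes "S \<subseteq> cbox l u" "Re l \<le> Re u" "Im l \<le> Im u"
  shows "emeasure lborel S \<le> ennreal ((Re u - Re l) * (Im u - Im l))"
proof -
  have "emeasure lborel S \<le> emeasure lborel (cbox l u)" by (rule emeasure_mono[OF assms(1)]) simp
  also have "\<dots> = ennreal (\<Prod>b\<in>Basis. (u - l) \<bullet> b)"
    by (rule emeasure_lborel_cbox) (use assms in \<open>auto simp: Basis_complex_def\<close>)
  also have "(\<Prod>b\<in>Basis. (u - l) \<bullet> b) = (Re u - Re l) * (Im u - Im l)"
    by (simp add: prod_Basis_complex)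
  finally show ?thesis .
qed

lemma measurable_dyadic_weight [measurable]: "dyadic_weight m N \<in> borel_measurable borel"
  unfolding dyadic_weight_def[abs_def] by measurable

context harmonic_qc
begin

lemma continuous_stretch: "continuous_on V stretch"
proof -
  have "continuous_on V (deriv h)" "continuous_on V (deriv g)"
    using holomorphic_deriv[OF holh openV] holomorphic_deriv[OF holg openV]
    by (simp_all add: holomorphic_on_imp_continuous_on)
  then show ?thesis unfolding stretch_def[abs_def] by (intro continuous_intros)
qed

lemma measurable_log_weight:
  assumes S: "S \<in> sets borel" "\<And>\<zeta>. \<zeta> \<in> S \<Longrightarrow> z0 + c * exp \<zeta> \<in> V"
  shows "(\<lambda>\<zeta>. ennreal (indicator S \<zeta> * (dyadic_weight m N (f (z0 + c * exp \<zeta>) - w) * (stretch (z0 + c * exp \<zeta>) * cmod (c * exp \<zeta>)))))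
     \<in> borel_measurable borel"
proof -
  have cE: "continuous_on S (\<lambda>\<zeta>. z0 + c * exp \<zeta>)" by (intro continuous_intros)
  have img: "(\<lambda>\<zeta>. z0 + c * exp \<zeta>) ` S \<subseteq> V" using S(2) by auto
  have c1: "continuous_on S (\<lambda>\<zeta>. f (z0 + c * exp \<zeta>) - w)" "continuous_on S (\<lambda>\<zeta>. stretch (z0 + c * exp \<zeta>) * cmod (c * exp \<zeta>))"
    by (intro continuous_intros continuous_on_compose2[OF continuous_f cE img] continuous_on_compose2[OF continuous_stretch cE img])+
  have [measurable]: "S \<in> sets borel"
    "(\<lambda>\<zeta>. indicator S \<zeta> *\<^sub>R (f (z0 + c * exp \<zeta>) - w)) \<in> borel_measurable borel"
    "(\<lambda>\<zeta>. indicator S \<zeta> *\<^sub>R (stretch (z0 + c * exp \<zeta>) * cmod (c * exp \<zeta>))) \<in> borel_measurable borel"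
    by (intro S borel_measurable_continuous_on_indicator c1)+
  have "(\<lambda>\<zeta>. indicator S \<zeta> * (dyadic_weight m N (f (z0 + c * exp \<zeta>) - w) * (stretch (z0 + c * exp \<zeta>) * cmod (c * exp \<zeta>))))
     = (\<lambda>\<zeta>. dyadic_weight m N (indicator S \<zeta> *\<^sub>R (f (z0 + c * exp \<zeta>) - w)) * (indicator S \<zeta> *\<^sub>R (stretch (z0 + c * exp \<zeta>) * cmod (c * exp \<zeta>))))"
    by (auto simp: fun_eq_iff indicator_def)
  also have "\<dots> \<in> borel_measurable borel" by measurable
  finally show ?thesis by measurable
qed

text \<open>If the ratio exceeded \<open>2\<^sup>N\<close>, then by the maximum and minimum principles every circle about \<open>z0\<close> of
  radius between \<open>R / 2\<close> and \<open>exp (1/2) R / 2 < R\<close> would be mapped to a curve that crosses \<open>N\<close> dyadic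
  annuli about \<open>w\<close>. In logarithmic coordinates these circles are vertical segments, which fill a strip of width \<open>1/2\<close>.\<close>

lemma omitted_value_harnack:
  assumes ball: "ball z0 R \<subseteq> V" and R: "R > 0" and w: "w \<notin> f ` ball z0 R"
    and z: "z \<in> cball z0 (R/2)" "z' \<in> cball z0 (R/2)" and N: "real N > 64 * pi * K"
  shows "cmod (f z - w) \<le> 2 ^ N * cmod (f z' - w)"
proof (rule ccontr)
  define m where "m = cmod (f z' - w)"
  assume "\<not> ?thesis"
  then have big: "m * 2 ^ N < cmod (f z - w)" by (simp add: m_def mult.commute)
  have "z' \<in> ball z0 R" using z R by auto
  then have "f z' \<noteq> w" using w by blast
  then have m: "m > 0" by (simp add: m_def)
  define c where "c = complex_of_real (R / 2)"
  have c: "c \<noteq> 0" using R by (simp add: c_def)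
  define S where "S = {\<zeta>. 0 \<le> Re \<zeta> \<and> Re \<zeta> \<le> 1/2 \<and> 0 \<le> Im \<zeta> \<and> Im \<zeta> < 2 * pi}"
  have S: "S \<in> sets borel" unfolding S_def by measurable
  have exp_half: "exp (1/2) < (2::real)"
  proof -
    have "(exp (1/2))\<^sup>2 < (2::real)\<^sup>2"
      using exp_le by (simp add: power2_eq_square exp_add[symmetric])
    then show ?thesis by (rule power2_less_imp_less) simp
  qed
  have rad: "R / 2 \<le> R / 2 * exp x" "R / 2 * exp x < R" if "x \<in> {0..1/2}" for x
  proof -
    have "exp x \<le> exp (1/2)" using that by simp
    then have "exp x < 2" using exp_half by linarith
    then show "R / 2 * exp x < R" using R by simp
    show "R / 2 \<le> R / 2 * exp x" using R that by simp
  qed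
  have dist: "dist z0 (z0 + c * exp \<zeta>) = R / 2 * exp (Re \<zeta>)" for \<zeta>
    using R by (simp add: dist_norm c_def norm_mult)
  have SV: "z0 + c * exp \<zeta> \<in> V" if "\<zeta> \<in> S" for \<zeta>
    using ball rad(2)[of "Re \<zeta>"] that dist[of \<zeta>] by (auto simp: S_def)
  have strip: "\<bar>Im \<zeta> - Im \<xi>\<bar> < 2 * pi" if "\<zeta> \<in> S" "\<xi> \<in> S" for \<zeta> \<xi> using that by (auto simp: S_def)
  have "S \<subseteq> cbox 0 (Complex (1/2) (2 * pi))" by (auto simp: S_def in_cbox_complex_iff)
  from emeasure_subset_cbox_complex[OF this] have A: "emeasure lborel S \<le> ennreal pi" by simp
  define \<Phi> where "\<Phi> = (\<lambda>\<zeta>. ennreal (indicator S \<zeta> * (dyadic_weight m N (f (z0 + c * exp \<zeta>) - w) * (stretch (z0 + c * exp \<zeta>) * cmod (c * exp \<zeta>)))))"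
  have \<Phi>m: "\<Phi> \<in> borel_measurable borel" unfolding \<Phi>_def by (rule measurable_log_weight[OF S SV])
  \<comment> \<open>\<open>\<epsilon> = 1 / (32 K)\<close> makes the first term \<open>N / 4\<close>, half of the lower bound \<open>N / 2\<close> found below\<close>
  have upper: "(\<integral>\<^sup>+\<zeta>. \<Phi> \<zeta> \<partial>lborel) \<le> ennreal (8 * (1 / (32 * K)) * K * real N + pi / (2 * (1 / (32 * K))))"
    unfolding \<Phi>_def by (rule log_length_area[OF c S SV strip A]) (use m K1 in auto)
  have on_circle: "\<exists>\<theta>. 0 \<le> \<theta> \<and> \<theta> < 2 * pi \<and> y = z0 + c * exp (of_real x + of_real \<theta> * \<i>)"
    if "y \<in> sphere z0 (R / 2 * exp x)" for x y
  proof (intro exI[of _ "Arg2pi (y - z0)"] conjI)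
    have "y - z0 = of_real (cmod (y - z0)) * exp (\<i> * of_real (Arg2pi (y - z0)))" by (rule Arg2pi_eq)
    also have "cmod (y - z0) = R / 2 * exp x" using that by (simp add: dist_norm norm_minus_commute)
    finally have "y - z0 = of_real (R / 2 * exp x) * exp (\<i> * of_real (Arg2pi (y - z0)))" .
    moreover have "of_real (R / 2 * exp x) * exp (\<i> * of_real (Arg2pi (y - z0))) = c * exp (of_real x + of_real (Arg2pi (y - z0)) * \<i>)"
      by (simp add: c_def exp_add exp_of_real mult_ac)
    ultimately have "y - z0 = c * exp (of_real x + of_real (Arg2pi (y - z0)) * \<i>)" by (rule trans)
    then show "y = z0 + c * exp (of_real x + of_real (Arg2pi (y - z0)) * \<i>)"
      by (simp only: diff_eq_eq add.commute)
  qed (use Arg2pi in auto)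
  have line: "ennreal (real N) \<le> (\<integral>\<^sup>+y. \<Phi> (Complex x y) \<partial>lborel)" if x: "x \<in> {0..1/2}" for x
  proof -
    define t where "t = R / 2 * exp x"
    have cb: "cball z0 t \<subseteq> ball z0 R" using rad(2)[OF x] by (auto simp: t_def)
    have ct: "continuous_on (cball z0 t) f" "inj_on f (cball z0 t)"
      using cb ball continuous_f inj_f by (blast intro: continuous_on_subset inj_on_subset)+
    have zt: "z \<in> cball z0 t" "z' \<in> cball z0 t" using z rad(1)[OF x] by (auto simp: t_def)
    have wt: "w \<notin> f ` cball z0 t" using w cb by auto
    obtain z1 where z1: "z1 \<in> sphere z0 t" "m * 2 ^ N \<le> cmod (f z1 - w)"
      using extreme_on_sphere(1)[OF ct zt(1), of w] big by (meson less_imp_le order_trans)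
    obtain z2 where z2: "z2 \<in> sphere z0 t" "cmod (f z2 - w) \<le> m"
      using extreme_on_sphere(2)[OF ct zt(2) wt] by (auto simp: m_def)
    obtain \<theta>1 where 1: "0 \<le> \<theta>1" "\<theta>1 < 2 * pi" "z1 = z0 + c * exp (of_real x + of_real \<theta>1 * \<i>)"
      using on_circle z1(1) unfolding t_def by blast
    obtain \<theta>2 where 2: "0 \<le> \<theta>2" "\<theta>2 < 2 * pi" "z2 = z0 + c * exp (of_real x + of_real \<theta>2 * \<i>)"
      using on_circle z2(1) unfolding t_def by blast
    define u where "u = min \<theta>1 \<theta>2"
    define v where "v = max \<theta>1 \<theta>2"
    have coord: "of_real x + of_real y * \<i> = Complex x y" for y by (simp add: complex_eq_iff)
    have inS: "Complex x y \<in> S" if "y \<in> {u..v}" for y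
      using that x 1 2 by (auto simp: S_def u_def v_def)
    have "ennreal (real N) \<le> (\<integral>\<^sup>+y. ennreal (indicator {u..v} y * (dyadic_weight m N (f (z0 + c * exp (of_real x + of_real y * \<i>)) - w) *
      (stretch (z0 + c * exp (of_real x + of_real y * \<i>)) * cmod (c * exp (of_real x + of_real y * \<i>))))) \<partial>lborel)"
    proof (rule log_crossing)
      show "u \<le> v" by (simp add: u_def v_def)
      show "z0 + c * exp (of_real x + of_real y * \<i>) \<in> V" if "y \<in> {u..v}" for y
        unfolding coord by (rule SV[OF inS[OF that]])
    qed (use m 1 2 z1 z2 in \<open>auto simp: u_def v_def min_def max_def\<close>)
    also have "\<dots> \<le> (\<integral>\<^sup>+y. \<Phi> (Complex x y) \<partial>lborel)"
      unfolding \<Phi>_def coord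
      by (intro nn_integral_mono ennreal_leI mult_right_mono mult_nonneg_nonneg dyadic_weight_nonneg stretch_nonneg m)
         (use inS in \<open>auto simp: indicator_def\<close>)
    finally show ?thesis .
  qed
  have "ennreal (real N * (1/2 - 0)) \<le> (\<integral>\<^sup>+\<zeta>. \<Phi> \<zeta> \<partial>lborel)"
    by (rule nn_integral_complex_ge(1)[OF \<Phi>m _ _ line]) auto
  also note upper
  finally have "real N * (1/2 - 0) \<le> 8 * (1 / (32 * K)) * K * real N + pi / (2 * (1 / (32 * K)))"
    using K1 by (subst (asm) ennreal_le_iff) (auto intro!: add_nonneg_nonneg)
  then show False using N K1 by (simp add: field_simps)
qed

text \<open>An analogue of the Koebe quarter theorem: \<open>f - w\<close> is bounded by a multiple of \<open>|f z0 - w|\<close> on the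
  half-size ball, and the real parts of \<open>h + g - w\<close> and of \<open>- \<i> (h - g - w)\<close> are the real and the imaginary
  part of \<open>f - w\<close>, so that the derivatives of both combinations are controlled.\<close>

lemma stretch_le_omitted_value:
  assumes ball: "ball z0 R \<subseteq> V" and R: "R > 0" and w: "w \<notin> f ` ball z0 R" and N: "real N > 64 * pi * K"
  shows "stretch z0 * R \<le> 36 * 2 ^ N * cmod (f z0 - w)"
proof -
  define M where "M = 2 ^ N * cmod (f z0 - w)"
  have "z0 \<in> ball z0 R" using R by simp
  then have "f z0 \<noteq> w" using w by blast
  then have M: "M > 0" by (simp add: M_def)
  have bd: "cmod (f z - w) \<le> M" if "z \<in> cball z0 (R/2)" for z
    unfolding M_def by (rule omitted_value_harnack[OF ball R w that _ N]) (use R in auto)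
  have sub: "cball z0 (R/2) \<subseteq> V" using ball R by (auto simp: subset_iff)
  have z0: "z0 \<in> V" using ball R by auto
  define P where "P z = h z + g z - w" for z
  define Q where "Q z = - \<i> * (h z - g z - w)" for z
  have hol: "P holomorphic_on V" "Q holomorphic_on V"
    unfolding P_def Q_def by (intro holomorphic_intros holh holg)+
  have "\<bar>Re (P z)\<bar> \<le> M" "\<bar>Re (Q z)\<bar> \<le> M" if "z \<in> cball z0 (R/2)" for z
  proof -
    have "Re (P z) = Re (f z - w)" "Re (Q z) = Im (f z - w)"
      by (simp_all add: P_def Q_def f_def)
    then show "\<bar>Re (P z)\<bar> \<le> M" "\<bar>Re (Q z)\<bar> \<le> M"
      using bd[OF that] abs_Re_le_cmod[of "f z - w"] abs_Im_le_cmod[of "f z - w"] by linarith+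
  qed
  note RePQ = this
  have d: "cmod (deriv P z0) * (R/2) \<le> 9 * M" "cmod (deriv Q z0) * (R/2) \<le> 9 * M"
    by (rule deriv_bound_of_Re_bound[OF openV sub _ _ M]; use R hol RePQ in \<open>simp del: mem_cball\<close>)+
  have dh: "(h has_field_derivative deriv h z0) (at z0)" "(g has_field_derivative deriv g z0) (at z0)"
    using holomorphic_derivI[OF holh openV z0] holomorphic_derivI[OF holg openV z0] by auto
  have dP: "deriv P z0 = deriv h z0 + deriv g z0"
    unfolding P_def by (rule DERIV_imp_deriv) (auto intro!: derivative_eq_intros dh)
  have dQ: "deriv Q z0 = - \<i> * (deriv h z0 - deriv g z0)"
    unfolding Q_def by (rule DERIV_imp_deriv) (auto intro!: derivative_eq_intros dh)
  have "2 * deriv h z0 = deriv P z0 + \<i> * deriv Q z0" "2 * deriv g z0 = deriv P z0 - \<i> * deriv Q z0"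
    unfolding dP dQ by (simp_all add: algebra_simps)
  then have "cmod (2 * deriv h z0) \<le> cmod (deriv P z0) + cmod (deriv Q z0)"
    "cmod (2 * deriv g z0) \<le> cmod (deriv P z0) + cmod (deriv Q z0)"
    using norm_triangle_ineq[of "deriv P z0" "\<i> * deriv Q z0"] norm_triangle_ineq4[of "deriv P z0" "\<i> * deriv Q z0"]
    by (simp_all add: norm_mult)
  then have "stretch z0 \<le> cmod (deriv P z0) + cmod (deriv Q z0)" by (simp add: stretch_def norm_mult)
  then have "stretch z0 * R \<le> (cmod (deriv P z0) + cmod (deriv Q z0)) * R"
    using R by (intro mult_right_mono) auto
  also have "\<dots> \<le> 36 * M" using d by (simp add: algebra_simps)
  finally show ?thesis by (simp add: M_def)
qed

end

section \<open>Balls are not compressed\<close>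

text \<open>Harnack's inequality for the positive harmonic function \<open>- log |\<phi>|\<close> with ratio \<open>(1 + 1/2) / (1 - 1/2) = 3\<close>.
  It is obtained from the Schwarz lemma for the Cayley transform of \<open>- log \<phi>\<close>.\<close>

lemma zero_free_harnack:
  assumes hol: "\<phi> holomorphic_on ball z1 r" and nz: "\<And>z. z \<in> ball z1 r \<Longrightarrow> \<phi> z \<noteq> 0"
    and bd: "\<And>z. z \<in> ball z1 r \<Longrightarrow> cmod (\<phi> z) < 1" and z0: "z0 \<in> cball z1 (r/2)" and r: "r > 0"
  shows "cmod (\<phi> z1) ^ 3 \<le> cmod (\<phi> z0)"
proof -
  obtain \<psi> where \<psi>: "\<psi> holomorphic_on ball z1 r" "\<And>z. z \<in> ball z1 r \<Longrightarrow> \<phi> z = exp (\<psi> z)"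
    using contractible_imp_holomorphic_log[OF hol convex_imp_contractible[OF convex_ball] nz] by blast
  have neg: "Re (\<psi> z) < 0" if "z \<in> ball z1 r" for z
    using bd[OF that] \<psi>(2)[OF that] by simp
  have z1: "z1 \<in> ball z1 r" using r by simp
  define a where "a = - Re (\<psi> z1)"
  have a: "a > 0" using neg[OF z1] by (simp add: a_def)
  define p where "p z = - \<psi> z + \<i> * Im (\<psi> z1)" for z
  have p1: "p z1 = of_real a" by (simp add: p_def a_def complex_eq_iff)
  have Rep: "Re (p z) > 0" if "z \<in> ball z1 r" for z using neg[OF that] by (simp add: p_def)
  \<comment> \<open>the Cayley transform sends the right half-plane to the unit disk and \<open>a = p z1\<close> to 0\<close>
  define v where "v t = (p (z1 + of_real r * t) - of_real a) / (p (z1 + of_real r * t) + of_real a)" for t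
  have inb: "z1 + of_real r * t \<in> ball z1 r" if "cmod t < 1" for t
    using that r by (simp add: dist_norm norm_mult)
  have nza: "p z + of_real a \<noteq> 0" if "z \<in> ball z1 r" for z
    using Rep[OF that] a by (auto simp: complex_eq_iff)
  have "p holomorphic_on ball z1 r" unfolding p_def by (intro holomorphic_intros \<psi>)
  then have "(p \<circ> (\<lambda>t. z1 + of_real r * t)) holomorphic_on ball 0 1"
    by (intro holomorphic_on_compose_gen[where t = "ball z1 r"] holomorphic_intros) (use inb in auto)
  then have hp: "(\<lambda>t. p (z1 + of_real r * t)) holomorphic_on ball 0 1" by (simp add: o_def)
  have hv: "v holomorphic_on ball 0 1"
    unfolding v_def by (intro holomorphic_intros hp nza inb) auto
  have v0: "v 0 = 0" by (simp add: v_def p1)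
  have vle: "cmod (v t) < 1" if "cmod t < 1" for t
  proof -
    let ?w = "p (z1 + of_real r * t)"
    have "Re ?w > 0" by (rule Rep[OF inb[OF that]])
    then have "0 < a * Re ?w" using a by simp
    then have "(cmod (?w - of_real a))\<^sup>2 < (cmod (?w + of_real a))\<^sup>2"
      unfolding cmod_power2 by (simp add: power2_eq_square algebra_simps)
    then have "cmod (?w - of_real a) < cmod (?w + of_real a)" by (rule power2_less_imp_less) simp
    then show ?thesis unfolding v_def norm_divide using norm_ge_zero[of "?w - of_real a"] by (simp add: divide_less_eq)
  qed
  define t where "t = (z0 - z1) / of_real r"
  have t: "cmod t \<le> 1/2" using z0 r by (simp add: t_def norm_divide dist_norm norm_minus_commute divide_le_eq)
  have z0t: "z0 = z1 + of_real r * t" using r by (simp add: t_def)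
  have vt: "cmod (v t) \<le> 1/2"
    using Schwarz_Lemma(1)[OF hv v0 vle, of t] t by simp
  have z0b: "z0 \<in> ball z1 r" using z0 r by auto
  have pe: "p z0 - of_real a = v t * (p z0 + of_real a)"
    using nza[OF z0b] by (simp add: v_def z0t[symmetric])
  then have pe2: "p z0 - of_real a = v t * ((p z0 - of_real a) + of_real (2 * a))"
    by (simp add: algebra_simps)
  have "cmod (p z0 - of_real a) = cmod (v t) * cmod ((p z0 - of_real a) + of_real (2 * a))"
    by (subst pe2) (rule norm_mult)
  also have "\<dots> \<le> 1/2 * (cmod (p z0 - of_real a) + cmod (of_real (2 * a)))"
    by (intro mult_mono vt norm_triangle_ineq) auto
  also have "cmod (of_real (2 * a)) = 2 * a" using a by (simp only: norm_of_real)
  finally have "cmod (p z0 - of_real a) \<le> 2 * a" by simp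
  moreover have "Re (p z0) - a \<le> cmod (p z0 - of_real a)"
    using complex_Re_le_cmod[of "p z0 - of_real a"] by simp
  ultimately have "Re (p z0) \<le> 3 * a" by simp
  then have "3 * Re (\<psi> z1) \<le> Re (\<psi> z0)" by (simp add: p_def a_def)
  then have "exp (3 * Re (\<psi> z1)) \<le> exp (Re (\<psi> z0))" by simp
  moreover have "exp (3 * Re (\<psi> z1)) = exp (Re (\<psi> z1)) ^ 3" by (simp add: exp_of_nat_mult[symmetric])
  ultimately show ?thesis using \<psi>(2)[OF z1] \<psi>(2)[OF z0b] by simp
qed

locale harmonic_qc_disk = harmonic_qc "ball 0 1" K h g for K h g
begin

text \<open>The inverse of \<open>f\<close> is continuous by invariance of domain. This is how the boundary behaviour enters:
  near the unit circle, \<open>f\<close> leaves every compact part of the image.\<close>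

lemma compact_preimage_cball:
  assumes "ball w d \<subseteq> f ` ball 0 1" "b < d"
  shows "compact {z \<in> ball 0 1. cmod (f z - w) \<le> b}"
proof -
  obtain f' where f': "homeomorphism (ball 0 1) (f ` ball 0 1) f f'"
    using invariance_of_domain_homeomorphism[OF open_ball continuous_f _ inj_f] by auto
  have sub: "cball w b \<subseteq> f ` ball 0 1" using assms by (auto simp: subset_iff)
  have "{z \<in> ball 0 1. cmod (f z - w) \<le> b} = f' ` cball w b"
  proof (intro equalityI subsetI)
    fix z assume "z \<in> {z \<in> ball 0 1. cmod (f z - w) \<le> b}"
    then have "f z \<in> cball w b" "z = f' (f z)"
      using f' by (auto simp: dist_norm norm_minus_commute homeomorphism_def)
    then show "z \<in> f' ` cball w b" by blast
  next
    fix z assume "z \<in> f' ` cball w b"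
    then obtain y where y: "y \<in> cball w b" "z = f' y" by auto
    then have "y \<in> f ` ball 0 1" using sub by auto
    then have "f z = y" "z \<in> ball 0 1" using f' y by (auto simp: homeomorphism_def)
    then show "z \<in> {z \<in> ball 0 1. cmod (f z - w) \<le> b}" using y by (simp add: dist_norm norm_minus_commute)
  qed
  moreover have "continuous_on (cball w b) f'"
    using f' sub by (meson continuous_on_subset homeomorphism_cont2)
  ultimately show ?thesis using compact_continuous_image[OF _ compact_cball] by simp
qed

text \<open>Otherwise \<open>f\<close> maps the ball of radius \<open>R / 8\<close> about \<open>z0\<close>, where \<open>R = 1 - |z0|\<close>, into the small disk of
  radius \<open>m\<close>, and each path from there to the unit circle must cross all annuli up to radius \<open>m 2\<^sup>N\<close>.
  The rays from \<open>z0\<close> that make an angle of at most \<open>\<pi> / 3\<close> with the outward radius leave the unit disk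
  within distance \<open>2 R\<close>, so in logarithmic coordinates they are horizontal segments of length at most
  \<open>log 16\<close>.\<close>

lemma image_not_compressed:
  assumes z0: "cmod z0 < 1" and bd: "ball (f z0) d \<subseteq> f ` ball 0 1" and m: "m > 0" "m * 2 ^ N < d"
    and N: "real N > 32 * K"
  shows "\<exists>z\<in>cball z0 ((1 - cmod z0) / 8). cmod (f z - f z0) > m"
proof (rule ccontr)
  assume "\<not> ?thesis"
  then have small: "cmod (f z - f z0) \<le> m" if "z \<in> cball z0 ((1 - cmod z0) / 8)" for z
    using that by force
  define R where "R = 1 - cmod z0"
  have R: "R > 0" using z0 by (simp add: R_def)
  \<comment> \<open>the direction of the outward radius; if \<open>z0 = 0\<close>, any direction will do\<close>
  define u where "u = (if z0 = 0 then 1 else sgn z0)"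
  have u: "cmod u = 1" "z0 = of_real (cmod z0) * u" by (simp add: u_def norm_sgn) (simp add: u_def sgn_eq)
  define c where "c = of_real R * u"
  have c: "c \<noteq> 0" "cmod c = R" using u R by (auto simp: c_def norm_mult)
  define E where "E \<zeta> = z0 + c * exp \<zeta>" for \<zeta>
  define S where "S = {\<zeta>. - ln 8 \<le> Re \<zeta> \<and> Re \<zeta> \<le> ln 2 \<and> - (pi/3) \<le> Im \<zeta> \<and> Im \<zeta> \<le> pi/3 \<and> E \<zeta> \<in> ball 0 1}"
  have S: "S \<in> sets borel"
  proof -
    have "continuous_on UNIV E" unfolding E_def by (intro continuous_intros)
    then have "open (E -` ball 0 1)" by (intro open_vimage) auto
    then have "cbox (Complex (- ln 8) (- (pi/3))) (Complex (ln 2) (pi/3)) \<inter> E -` ball 0 1 \<in> sets borel" by auto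
    also have "cbox (Complex (- ln 8) (- (pi/3))) (Complex (ln 2) (pi/3)) \<inter> E -` ball 0 1 = S"
      by (auto simp: S_def in_cbox_complex_iff)
    finally show ?thesis .
  qed
  have SV: "z0 + c * exp \<zeta> \<in> ball 0 1" if "\<zeta> \<in> S" for \<zeta> using that by (simp add: S_def E_def)
  have strip: "\<bar>Im \<zeta> - Im \<xi>\<bar> < 2 * pi" if "\<zeta> \<in> S" "\<xi> \<in> S" for \<zeta> \<xi>
  proof -
    have "- (pi/3) \<le> Im \<zeta>" "Im \<zeta> \<le> pi/3" "- (pi/3) \<le> Im \<xi>" "Im \<xi> \<le> pi/3"
      using that by (auto simp: S_def)
    then show ?thesis using pi_gt_zero by linarith
  qed
  have lnle: "- ln 8 \<le> ln (2::real)" using ln_ge_zero[of "8::real"] ln_ge_zero[of "2::real"] by linarith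
  have ln16: "ln 2 + ln 8 \<le> (4::real)"
  proof -
    have "(2::real) ^ 4 \<le> exp 1 ^ 4" using exp_ge_add_one_self[of 1] by (intro power_mono) auto
    also have "\<dots> = exp (4::real)" by (simp add: exp_of_nat_mult[symmetric])
    finally have "ln (16::real) \<le> ln (exp 4)" by (subst ln_le_cancel_iff) auto
    then show ?thesis using ln_mult[of 2 "8::real"] by simp
  qed
  have "S \<subseteq> cbox (Complex (- ln 8) (- (pi/3))) (Complex (ln 2) (pi/3))"
    by (auto simp: S_def in_cbox_complex_iff)
  from emeasure_subset_cbox_complex[OF this] lnle
  have "emeasure lborel S \<le> ennreal ((ln 2 + ln 8) * (2 * (pi/3)))"
    by simp
  also have "\<dots> \<le> ennreal (8 * pi / 3)"
    using mult_right_mono[OF ln16, of "2 * (pi/3)"] by (intro ennreal_leI) simp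
  finally have A: "emeasure lborel S \<le> ennreal (8 * pi / 3)" .
  define \<Phi> where "\<Phi> = (\<lambda>\<zeta>. ennreal (indicator S \<zeta> * (dyadic_weight m N (f (z0 + c * exp \<zeta>) - f z0) * (stretch (z0 + c * exp \<zeta>) * cmod (c * exp \<zeta>)))))"
  have \<Phi>m: "\<Phi> \<in> borel_measurable borel" unfolding \<Phi>_def by (rule measurable_log_weight[OF S SV])
  \<comment> \<open>\<open>\<epsilon> = \<pi> / (24 K)\<close> makes the first term \<open>N \<pi> / 3\<close>, half of the lower bound \<open>2 N \<pi> / 3\<close> found below\<close>
  have upper: "(\<integral>\<^sup>+\<zeta>. \<Phi> \<zeta> \<partial>lborel) \<le> ennreal (8 * (pi / (24 * K)) * K * real N + (8 * pi / 3) / (2 * (pi / (24 * K))))"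
    unfolding \<Phi>_def by (rule log_length_area[OF c(1) S SV strip A]) (use m K1 in auto)
  \<comment> \<open>beyond radius \<open>|zt|\<close> the image stays outside all the annuli; the horizontal paths are followed
      until they reach the slightly larger radius \<open>s < 1\<close>\<close>
  define C where "C = {z \<in> ball 0 1. cmod (f z - f z0) \<le> m * 2 ^ N}"
  have "compact C" unfolding C_def by (rule compact_preimage_cball[OF bd m(2)])
  moreover have "z0 \<in> C" using z0 m by (simp add: C_def)
  ultimately obtain zt where zt: "zt \<in> C" "\<And>z. z \<in> C \<Longrightarrow> cmod z \<le> cmod zt"
    using continuous_attains_sup[of C cmod] by (metis continuous_on_norm_id empty_iff)
  define s where "s = (cmod zt + 1) / 2"
  have s: "cmod zt < s" "s < 1" using zt(1) by (auto simp: s_def C_def)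
  have outC: "cmod (f z - f z0) > m * 2 ^ N" if "cmod z = s" for z
    using zt(2)[of z] that s by (force simp: C_def)
  have line: "ennreal (real N) \<le> (\<integral>\<^sup>+x. \<Phi> (Complex x y) \<partial>lborel)" if y: "y \<in> {- (pi/3)..pi/3}" for y
  proof -
    have cy: "cos y \<ge> 1/2"
    proof -
      have "cos (pi/3) \<le> cos \<bar>y\<bar>" using y by (intro cos_monotone_0_pi_le) auto
      then show ?thesis by (simp add: cos_60)
    qed
    define \<phi> where "\<phi> x = cmod (E (Complex x y))" for x
    have c\<phi>: "continuous_on X \<phi>" for X unfolding \<phi>_def E_def Complex_eq by (intro continuous_intros)
    have start: "E (Complex (- ln 8) y) \<in> cball z0 (R/8)"
      using c by (simp add: E_def dist_norm norm_mult exp_minus)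
    then have fs: "cmod (f (E (Complex (- ln 8) y)) - f z0) \<le> m" using small by (simp add: R_def)
    have "m * 1 \<le> m * 2 ^ N" using m by (intro mult_left_mono) auto
    moreover have "E (Complex (- ln 8) y) \<in> ball 0 1"
    proof -
      have "cmod (E (Complex (- ln 8) y)) \<le> cmod z0 + cmod (E (Complex (- ln 8) y) - z0)"
        by (metis add.commute diff_add_cancel norm_triangle_ineq)
      also have "\<dots> \<le> cmod z0 + R/8" using start by (simp add: dist_norm norm_minus_commute)
      also have "\<dots> < cmod z0 + R" using R by simp
      also have "\<dots> = 1" by (simp add: R_def)
      finally show ?thesis by simp
    qed
    ultimately have "E (Complex (- ln 8) y) \<in> C" using fs by (simp add: C_def)
    then have lo: "\<phi> (- ln 8) \<le> s" using zt(2) s unfolding \<phi>_def by fastforce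
    have hi: "s \<le> \<phi> (ln 2)"
    proof -
      have "E (Complex (ln 2) y) = u * (of_real (cmod z0) + of_real (2 * R) * cis y)"
        unfolding E_def c_def exp_eq_polar by (subst u(2)) (simp add: algebra_simps)
      then have "\<phi> (ln 2) = cmod (of_real (cmod z0) + of_real (2 * R) * cis y)"
        unfolding \<phi>_def by (simp add: norm_mult u(1) del: of_real_mult)
      also have "\<dots> \<ge> Re (of_real (cmod z0) + of_real (2 * R) * cis y)" by (rule complex_Re_le_cmod)
      also have "Re (of_real (cmod z0) + of_real (2 * R) * cis y) = cmod z0 + 2 * R * cos y" by simp
      finally have "cmod z0 + 2 * R * cos y \<le> \<phi> (ln 2)" .
      moreover have "2 * R * (1/2) \<le> 2 * R * cos y" using cy R by (intro mult_left_mono) auto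
      ultimately show ?thesis using s by (simp add: R_def)
    qed
    obtain x1 where x1: "- ln 8 \<le> x1" "x1 \<le> ln 2" "\<phi> x1 = s"
      using IVT'[of \<phi> "- ln 8" s "ln 2", OF lo hi lnle c\<phi>] by blast
    have coord: "\<i> * of_real y + of_real x * 1 = Complex x y" for x by (simp add: complex_eq_iff)
    have inS: "Complex x y \<in> S" if "x \<in> {- ln 8..x1}" for x
    proof -
      define l where "l = exp (x - x1)"
      have l: "0 \<le> l" "l \<le> 1" using that by (auto simp: l_def)
      have "exp (Complex x y) = of_real l * exp (Complex x1 y)"
        by (simp add: l_def exp_eq_polar exp_diff)
      then have "E (Complex x y) = (1 - l) *\<^sub>R z0 + l *\<^sub>R E (Complex x1 y)"
        by (simp add: E_def algebra_simps scaleR_conv_of_real)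
      moreover have "E (Complex x1 y) \<in> ball 0 1" using x1(3) s by (simp add: \<phi>_def)
      ultimately have "E (Complex x y) \<in> ball 0 1"
        using convexD_alt[OF convex_ball, of z0 0 1 "E (Complex x1 y)" l] z0 l by simp
      then show ?thesis using that x1 y by (auto simp: S_def)
    qed
    have "ennreal (real N) \<le> (\<integral>\<^sup>+x. ennreal (indicator {- ln 8..x1} x * (dyadic_weight m N (f (z0 + c * exp (\<i> * of_real y + of_real x * 1)) - f z0) *
      (stretch (z0 + c * exp (\<i> * of_real y + of_real x * 1)) * cmod (c * exp (\<i> * of_real y + of_real x * 1))))) \<partial>lborel)"
    proof (rule log_crossing)
      show "z0 + c * exp (\<i> * of_real y + of_real x * 1) \<in> ball 0 1" if "x \<in> {- ln 8..x1}" for x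
        unfolding coord by (rule SV[OF inS[OF that]])
      have "m * 2 ^ N < cmod (f (E (Complex x1 y)) - f z0)" by (rule outC) (use x1 in \<open>simp add: \<phi>_def\<close>)
      then show "cmod (f (z0 + c * exp (\<i> * of_real y + of_real (- ln 8) * 1)) - f z0) \<le> m \<and>
          m * 2 ^ N \<le> cmod (f (z0 + c * exp (\<i> * of_real y + of_real x1 * 1)) - f z0) \<or>
          m * 2 ^ N \<le> cmod (f (z0 + c * exp (\<i> * of_real y + of_real (- ln 8) * 1)) - f z0) \<and>
          cmod (f (z0 + c * exp (\<i> * of_real y + of_real x1 * 1)) - f z0) \<le> m"
        unfolding coord using fs by (simp add: E_def)
    qed (use x1 m in auto)
    also have "\<dots> \<le> (\<integral>\<^sup>+x. \<Phi> (Complex x y) \<partial>lborel)"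
      unfolding \<Phi>_def coord
      by (intro nn_integral_mono ennreal_leI mult_right_mono mult_nonneg_nonneg dyadic_weight_nonneg stretch_nonneg m)
         (use inS in \<open>auto simp: indicator_def\<close>)
    finally show ?thesis .
  qed
  have "ennreal (real N * (pi/3 - (- (pi/3)))) \<le> (\<integral>\<^sup>+\<zeta>. \<Phi> \<zeta> \<partial>lborel)"
    by (rule nn_integral_complex_ge(2)[OF \<Phi>m _ _ line]) auto
  also note upper
  finally have "real N * (pi/3 - (- (pi/3))) \<le> 8 * (pi / (24 * K)) * K * real N + (8 * pi / 3) / (2 * (pi / (24 * K)))"
    using K1 by (subst (asm) ennreal_le_iff) (auto intro!: add_nonneg_nonneg)
  then have "real N * pi * (1/3) \<le> 32 * K"
    using K1 by (simp add: field_simps)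
  moreover have "real N * 3 * (1/3) \<le> real N * pi * (1/3)"
    using pi_gt3 by (intro mult_right_mono mult_left_mono) auto
  ultimately show False using N by simp
qed

end

section \<open>Stretching and distance to the boundary\<close>

context harmonic_qc
begin

lemma has_derivative_f:
  assumes "z \<in> V"
  shows "(f has_derivative (\<lambda>v. deriv h z * v + cnj (deriv g z * v))) (at z within S)"
  unfolding f_def[abs_def]
  using holomorphic_derivI[OF holh openV assms] holomorphic_derivI[OF holg openV assms]
  by (rule has_derivative_harmonic)

lemma norm_derivative_f_le: "cmod (deriv h z * v + cnj (deriv g z * v)) \<le> stretch z * cmod v"
proof -
  have "cmod (deriv h z * v + cnj (deriv g z * v)) \<le> cmod (deriv h z * v) + cmod (cnj (deriv g z * v))"
    by (rule norm_triangle_ineq)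
  also have "\<dots> = stretch z * cmod v" by (simp only: complex_mod_cnj norm_mult stretch_def distrib_right)
  finally show ?thesis .
qed

lemma f_lipschitz_segment:
  assumes seg: "closed_segment a b \<subseteq> V" and B: "\<And>z. z \<in> closed_segment a b \<Longrightarrow> stretch z \<le> B"
  shows "cmod (f b - f a) \<le> B * cmod (b - a)"
proof (rule differentiable_bound[OF convex_closed_segment])
  fix z assume z: "z \<in> closed_segment a b"
  show "(f has_derivative (\<lambda>v. deriv h z * v + cnj (deriv g z * v))) (at z within closed_segment a b)"
    by (rule has_derivative_f) (use z seg in auto)
  show "onorm (\<lambda>v. deriv h z * v + cnj (deriv g z * v)) \<le> B"
  proof (rule onorm_le)
    fix v
    have "stretch z * cmod v \<le> B * cmod v" by (intro mult_right_mono B z) auto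
    then show "cmod (deriv h z * v + cnj (deriv g z * v)) \<le> B * cmod v"
      using norm_derivative_f_le[of z v] by linarith
  qed
qed auto

lemma stretch_le_deriv_h: "z \<in> V \<Longrightarrow> stretch z \<le> 2 * cmod (deriv h z)"
proof -
  assume z: "z \<in> V"
  have "0 \<le> K * ((cmod (deriv h z))\<^sup>2 - (cmod (deriv g z))\<^sup>2)"
    using dil[OF z] zero_le_power2 order_trans by blast
  then have "(cmod (deriv g z))\<^sup>2 \<le> (cmod (deriv h z))\<^sup>2"
    using K1 by (simp add: zero_le_mult_iff)
  then have "cmod (deriv g z) \<le> cmod (deriv h z)" by (rule power2_le_imp_le) simp
  then show ?thesis by (simp add: stretch_def)
qed

text \<open>An integer above the thresholds of both \<open>omitted_value_harnack\<close> and \<open>image_not_compressed\<close>.\<close>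
definition harnack_exponent :: nat where "harnack_exponent = nat \<lceil>64 * pi * K\<rceil> + 1"

lemma harnack_exponent: "real harnack_exponent > 64 * pi * K" "real harnack_exponent > 32 * K"
proof -
  show 1: "real harnack_exponent > 64 * pi * K" unfolding harnack_exponent_def by linarith
  have "32 * K \<le> 64 * pi * K" using pi_gt3 K1 by (intro mult_right_mono) auto
  with 1 show "real harnack_exponent > 32 * K" by linarith
qed

definition koebe_const :: real where "koebe_const = 36 * 2 ^ harnack_exponent"

lemma koebe_const_ge_1: "koebe_const \<ge> 1"
proof -
  have "(1::real) \<le> 2 ^ harnack_exponent" by simp
  then show ?thesis unfolding koebe_const_def by linarith
qed

text \<open>By injectivity, \<open>f z'\<close> is an omitted value on the open ball about \<open>z\<close> that has \<open>z'\<close> on its boundary.\<close>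

lemma stretch_le_dist:
  assumes "ball z (dist z z') \<subseteq> V" "z' \<in> V"
  shows "stretch z * dist z z' \<le> koebe_const * dist (f z) (f z')"
proof (cases "z = z'")
  case False
  have "f z' \<notin> f ` ball z (dist z z')"
  proof
    assume "f z' \<in> f ` ball z (dist z z')"
    then obtain y where y: "y \<in> ball z (dist z z')" "f z' = f y" by auto
    then have "z' = y" using inj_onD[OF inj_f, of z' y] assms by auto
    then show False using y by auto
  qed
  from stretch_le_omitted_value[OF assms(1) _ this harnack_exponent(1)] False
  show ?thesis by (simp add: koebe_const_def dist_norm)
qed (simp add: koebe_const_def)

end

locale bounded_harmonic_qc_disk = harmonic_qc_disk +
  assumes bounded_image: "bounded (f ` ball 0 1)"
    and deriv_h_nonzero: "\<And>z. cmod z < 1 \<Longrightarrow> deriv h z \<noteq> 0"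
begin

definition bdist :: "complex \<Rightarrow> real" where "bdist z = infdist (f z) (frontier (f ` ball 0 1))"

lemma open_image: "open (f ` ball 0 1)"
  by (intro invariance_of_domain continuous_f inj_f) auto

lemma frontier_nonempty: "frontier (f ` ball 0 1) \<noteq> {}"
  using bounded_image not_bounded_UNIV frontier_eq_empty[of "f ` ball 0 1"] by (metis ball_eq_empty image_is_empty not_one_le_zero)

lemma bdist_attained:
  obtains w where "w \<notin> f ` ball 0 1" "w \<in> frontier (f ` ball 0 1)" "bdist z = cmod (f z - w)"
proof -
  obtain w where w: "w \<in> frontier (f ` ball 0 1)" "infdist (f z) (frontier (f ` ball 0 1)) = dist (f z) w"
    using infdist_attains_inf[OF frontier_closed frontier_nonempty] by blast
  moreover have "w \<notin> f ` ball 0 1" using w open_image by (simp add: frontier_def interior_open)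
  ultimately show thesis using that by (auto simp: bdist_def dist_norm)
qed

lemma bdist_le: "w \<in> frontier (f ` ball 0 1) \<Longrightarrow> bdist z \<le> cmod (f z - w)"
  unfolding bdist_def dist_norm[symmetric] by (rule infdist_le)

lemma bdist_pos: "cmod z < 1 \<Longrightarrow> bdist z > 0"
  by (rule bdist_attained[of z]) auto

lemma ball_bdist: "cmod z < 1 \<Longrightarrow> ball (f z) (bdist z) \<subseteq> f ` ball 0 1"
proof (rule ccontr)
  assume z: "cmod z < 1" and "\<not> ball (f z) (bdist z) \<subseteq> f ` ball 0 1"
  then have "ball (f z) (bdist z) - f ` ball 0 1 \<noteq> {}" by auto
  moreover have "f z \<in> ball (f z) (bdist z) \<inter> f ` ball 0 1" using z bdist_pos[OF z] by auto
  ultimately have "ball (f z) (bdist z) \<inter> frontier (f ` ball 0 1) \<noteq> {}"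
    by (intro connected_Int_frontier connected_ball) (rule notI, simp only: empty_iff)
  then obtain w where "w \<in> frontier (f ` ball 0 1)" "cmod (f z - w) < bdist z" by (auto simp: dist_norm)
  then show False using bdist_le[of w z] by simp
qed

lemma ball_in_disk: "ball z (1 - cmod z) \<subseteq> ball 0 1"
proof
  fix y assume "y \<in> ball z (1 - cmod z)"
  moreover have "cmod y - cmod z \<le> cmod (z - y)" by (metis norm_minus_commute norm_triangle_ineq2)
  ultimately show "y \<in> ball 0 1" by (simp add: dist_norm)
qed

lemma stretch_le_bdist:
  assumes "cmod z < 1"
  shows "stretch z * (1 - cmod z) \<le> koebe_const * bdist z"
proof -
  obtain w where w: "w \<notin> f ` ball 0 1" "bdist z = cmod (f z - w)" using bdist_attained by metis
  have "w \<notin> f ` ball z (1 - cmod z)" using w ball_in_disk by blast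
  from stretch_le_omitted_value[OF ball_in_disk _ this harnack_exponent(1)] assms w
  show ?thesis by (simp add: koebe_const_def)
qed

text \<open>A boundary point closest to \<open>f z\<close> is an omitted value, and it is at least as far from \<open>f z'\<close> as the
  boundary is.\<close>

lemma bdist_compare:
  assumes "cmod z < 1" "z' \<in> cball z ((1 - cmod z) / 2)"
  shows "bdist z' \<le> 2 ^ harnack_exponent * bdist z"
proof -
  obtain w where w: "w \<notin> f ` ball 0 1" "w \<in> frontier (f ` ball 0 1)" "bdist z = cmod (f z - w)"
    using bdist_attained by metis
  have "bdist z' \<le> cmod (f z' - w)" by (rule bdist_le[OF w(2)])
  also have "\<dots> \<le> 2 ^ harnack_exponent * cmod (f z - w)"
    by (rule omitted_value_harnack[OF ball_in_disk _ _ assms(2) _ harnack_exponent(1)])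
      (use assms w ball_in_disk[of z] in auto)
  finally show ?thesis by (simp add: w)
qed

definition upper_const :: real where "upper_const = 2 * koebe_const\<^sup>2 * 32 ^ harnack_exponent"

text \<open>Let \<open>R = 1 - |z0|\<close> and \<open>d = bdist z0\<close>. On the ball of radius \<open>R / 2\<close> the stretching is at most a multiple
  \<open>B\<close> of \<open>d / R\<close>. Because the ball of radius \<open>R / 8\<close> is not compressed, the mean value inequality yields a
  point \<open>z1\<close> in it where the stretching is at least a multiple of \<open>d / R\<close>. The zero-free function
  \<open>h' / (2 B)\<close> is less than 1 in modulus, and Harnack's inequality transports its lower bound from
  \<open>z1\<close> to \<open>z0\<close>.\<close>

lemma bdist_le_stretch:
  assumes z0: "cmod z0 < 1"
  shows "bdist z0 \<le> upper_const * ((1 - cmod z0) * stretch z0)"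
proof -
  define R where "R = 1 - cmod z0"
  define d where "d = bdist z0"
  define n where "n = harnack_exponent"
  define m where "m = d / 2 ^ Suc n"
  define B where "B = 2 * koebe_const * 2 ^ n * d / R"
  have R: "R > 0" using z0 by (simp add: R_def)
  have d: "d > 0" using bdist_pos[OF z0] by (simp add: d_def)
  have m: "m > 0" "m * 2 ^ n < d" using d by (auto simp: m_def)
  have B: "B > 0" using koebe_const_ge_1 d R by (simp add: B_def)
  have disk: "cmod z < 1" if "z \<in> ball z0 R" for z using ball_in_disk[of z0] that by (auto simp: R_def)
  have stretchB: "stretch z \<le> B" if z: "z \<in> ball z0 (R/2)" for z
  proof -
    have z1: "cmod z < 1" using z R by (intro disk) auto
    have "cmod z \<le> cmod z0 + cmod (z - z0)" by (metis add.commute diff_add_cancel norm_triangle_ineq)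
    also have "cmod (z - z0) \<le> R/2" using z by (simp add: dist_norm norm_minus_commute)
    finally have "R/2 \<le> 1 - cmod z" by (simp add: R_def field_simps)
    then have "stretch z * (R/2) \<le> stretch z * (1 - cmod z)" by (intro mult_left_mono stretch_nonneg)
    also have "\<dots> \<le> koebe_const * bdist z" by (rule stretch_le_bdist[OF z1])
    also have "\<dots> \<le> koebe_const * (2 ^ n * d)"
      unfolding n_def d_def using z koebe_const_ge_1 by (intro mult_left_mono bdist_compare z0) (auto simp: R_def)
    finally show ?thesis using R by (simp add: B_def field_simps)
  qed
  obtain zs where zs: "zs \<in> cball z0 (R/8)" "cmod (f zs - f z0) > m"
    using image_not_compressed[OF z0 ball_bdist[OF z0] m[unfolded d_def n_def]] harnack_exponent(2)
    unfolding R_def by blast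
  have seg: "closed_segment z0 zs \<subseteq> cball z0 (R/8)"
    using zs R by (intro closed_segment_subset) auto
  have "\<exists>z1\<in>closed_segment z0 zs. stretch z1 > 8 * m / R"
  proof (rule ccontr)
    assume "\<not> ?thesis"
    then have le: "stretch z1 \<le> 8 * m / R" if "z1 \<in> closed_segment z0 zs" for z1 using that by force
    have "cmod (f zs - f z0) \<le> 8 * m / R * cmod (zs - z0)"
    proof (rule f_lipschitz_segment[OF _ le])
      show "closed_segment z0 zs \<subseteq> ball 0 1"
        using seg disk R by (fastforce simp: subset_iff)
    qed
    also have "\<dots> \<le> 8 * m / R * (R / 8)"
      using zs m R by (intro mult_left_mono) (auto simp: dist_norm norm_minus_commute)
    also have "\<dots> = m" using R by simp
    finally show False using zs by simp
  qed
  then obtain z1 where z1: "z1 \<in> cball z0 (R/8)" "stretch z1 > 8 * m / R" using seg by blast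
  have z1d: "cmod z1 < 1" using z1 R by (intro disk) auto
  have h1: "cmod (deriv h z1) \<ge> 4 * m / R" using stretch_le_deriv_h[of z1] z1 z1d by simp
  have sub: "z \<in> ball z0 (R/2)" if "z \<in> ball z1 (R/4)" for z
  proof -
    have "dist z0 z \<le> dist z0 z1 + dist z1 z" by (rule dist_triangle)
    also have "\<dots> < R/8 + R/4" using z1 that by (intro add_le_less_mono) auto
    finally show ?thesis using R by simp
  qed
  define \<phi> where "\<phi> z = deriv h z / of_real (2 * B)" for z
  have "cmod (\<phi> z1) ^ 3 \<le> cmod (\<phi> z0)"
  proof (rule zero_free_harnack[where \<phi> = \<phi> and r = "R/4"])
    have "deriv h holomorphic_on ball 0 1" using holh by (intro holomorphic_deriv) auto
    moreover have "ball z1 (R/4) \<subseteq> ball 0 1" using sub disk R by force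
    ultimately have "deriv h holomorphic_on ball z1 (R/4)" by (rule holomorphic_on_subset)
    then show "\<phi> holomorphic_on ball z1 (R/4)" unfolding \<phi>_def using B by (intro holomorphic_on_divide holomorphic_on_const) auto
    show "z0 \<in> cball z1 (R/4/2)" using z1 by (simp add: dist_commute)
    fix z assume z: "z \<in> ball z1 (R/4)"
    have zz: "z \<in> ball z0 (R/2)" by (rule sub[OF z])
    then have "cmod z < 1" using R by (intro disk) auto
    then show "\<phi> z \<noteq> 0" using deriv_h_nonzero B by (simp add: \<phi>_def)
    have "cmod (deriv h z) \<le> stretch z" by (simp add: stretch_def)
    also have "\<dots> \<le> B" by (rule stretchB[OF zz])
    finally show "cmod (\<phi> z) < 1" using B by (simp add: \<phi>_def norm_divide divide_less_eq)
  qed (use R in auto)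
  then have "(cmod (deriv h z1) / (2 * B)) ^ 3 \<le> cmod (deriv h z0) / (2 * B)"
    using B by (simp add: \<phi>_def norm_divide)
  moreover have "(4 * m / R / (2 * B)) ^ 3 \<le> (cmod (deriv h z1) / (2 * B)) ^ 3"
    using h1 B m R by (intro power_mono divide_right_mono) auto
  ultimately have "(4 * m / R / (2 * B)) ^ 3 \<le> cmod (deriv h z0) / (2 * B)" by linarith
  then have "(4 * m / R / (2 * B)) ^ 3 * (2 * B) \<le> cmod (deriv h z0)"
    using B by (simp add: pos_le_divide_eq)
  also have "\<dots> \<le> stretch z0" by (simp add: stretch_def)
  finally have *: "(4 * m / R / (2 * B)) ^ 3 * (2 * B) \<le> stretch z0" .
  define k where "k = koebe_const"
  define p where "p = (2::real) ^ n"
  have kp: "k > 0" "p > 0" using koebe_const_ge_1 by (auto simp: k_def p_def)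
  \<comment> \<open>the powers of \<open>R\<close> cancel, and \<open>upper_const\<close> is chosen to make this an equality\<close>
  have "(4 * m / R / (2 * B)) ^ 3 * (2 * B) * (2 * k\<^sup>2 * p ^ 5 * R) = d"
    using kp R d unfolding m_def B_def k_def[symmetric] power_Suc p_def[symmetric]
    by (simp add: field_simps power2_eq_square eval_nat_numeral)
  then have "d \<le> stretch z0 * (2 * k\<^sup>2 * p ^ 5 * R)"
    using mult_right_mono[OF *, of "2 * k\<^sup>2 * p ^ 5 * R"] kp R by simp
  moreover have "p ^ 5 = 32 ^ n" unfolding p_def by (simp add: power_mult[symmetric] mult.commute[of n]) (simp add: power_mult)
  ultimately show ?thesis
    by (simp add: upper_const_def d_def k_def n_def R_def mult_ac)
qed

end

section \<open>Length of curves\<close>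

text \<open>The values of \<open>\<Psi>\<close> telescope along every partition.\<close>

lemma curve_length_le:
  assumes "\<And>s t. 0 \<le> s \<Longrightarrow> s \<le> t \<Longrightarrow> t \<le> 1 \<Longrightarrow> dist (\<gamma> s) (\<gamma> t) \<le> \<Psi> t - \<Psi> s"
  shows "curve_length \<gamma> \<le> ennreal (\<Psi> 1 - \<Psi> 0)"
  unfolding curve_length_def
proof (rule SUP_least)
  fix ts :: "real list" assume "ts \<in> {ts. sorted ts \<and> set ts \<subseteq> {0..1}}"
  then have ts: "sorted ts" "set ts \<subseteq> {0..1}" by auto
  show "(\<Sum>i<length ts - 1. ennreal (dist (\<gamma> (ts ! i)) (\<gamma> (ts ! Suc i)))) \<le> ennreal (\<Psi> 1 - \<Psi> 0)"
  proof (cases "ts = []")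
    case False
    have mem: "0 \<le> ts ! i" "ts ! i \<le> 1" if "i < length ts" for i
      using ts(2) nth_mem[OF that] by auto
    have mono: "\<Psi> s \<le> \<Psi> t" if "0 \<le> s" "s \<le> t" "t \<le> 1" for s t
      using assms[OF that] zero_le_dist[of "\<gamma> s" "\<gamma> t"] by linarith
    have "(\<Sum>i<length ts - 1. dist (\<gamma> (ts ! i)) (\<gamma> (ts ! Suc i))) \<le> (\<Sum>i<length ts - 1. \<Psi> (ts ! Suc i) - \<Psi> (ts ! i))"
      using ts(1) mem by (intro sum_mono assms sorted_nth_mono) auto
    also have "\<dots> = \<Psi> (ts ! (length ts - 1)) - \<Psi> (ts ! 0)" by (rule sum_lessThan_telescope)
    also have "\<dots> \<le> \<Psi> 1 - \<Psi> 0"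
      using mem[of 0] mem[of "length ts - 1"] False by (intro diff_mono mono) auto
    finally have "ennreal (\<Sum>i<length ts - 1. dist (\<gamma> (ts ! i)) (\<gamma> (ts ! Suc i))) \<le> ennreal (\<Psi> 1 - \<Psi> 0)"
      by (rule ennreal_leI)
    then show ?thesis by (simp add: sum_ennreal)
  qed simp
qed

lemma curve_length_ge:
  assumes mono: "\<And>i j. i \<le> j \<Longrightarrow> j \<le> p \<Longrightarrow> \<tau> i \<le> \<tau> j" and rng: "\<And>i. i \<le> p \<Longrightarrow> \<tau> i \<in> {0..1}"
  shows "ennreal (\<Sum>i<p. dist (\<gamma> (\<tau> i)) (\<gamma> (\<tau> (Suc i)))) \<le> curve_length \<gamma>"
  unfolding curve_length_def
proof (rule SUP_upper2)
  let ?ts = "map \<tau> [0..<Suc p]"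
  have nth: "?ts ! i = \<tau> i" if "i \<le> p" for i using that by (simp del: upt_Suc)
  have "sorted ?ts"
    unfolding sorted_iff_nth_mono using mono nth by (simp del: upt_Suc)
  then show "?ts \<in> {ts. sorted ts \<and> set ts \<subseteq> {0..1}}" using rng by (auto simp del: upt_Suc)
  have "(\<Sum>i<length ?ts - 1. ennreal (dist (\<gamma> (?ts ! i)) (\<gamma> (?ts ! Suc i)))) = (\<Sum>i<p. ennreal (dist (\<gamma> (\<tau> i)) (\<gamma> (\<tau> (Suc i)))))"
    using nth by (intro sum.cong) (auto simp del: upt_Suc)
  then show "ennreal (\<Sum>i<p. dist (\<gamma> (\<tau> i)) (\<gamma> (\<tau> (Suc i)))) \<le> (\<Sum>i<length ?ts - 1. ennreal (dist (\<gamma> (?ts ! i)) (\<gamma> (?ts ! Suc i))))"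
    by (simp add: sum_ennreal)
qed

section \<open>John disks and growth of the stretching\<close>

text \<open>If \<open>S n\<close> denotes the tail sum starting at \<open>a n\<close>, the hypothesis reads \<open>S n \<le> A (S n - S (n + 1))\<close>, that is,
  \<open>S (n + 1) \<le> (1 - 1/A) S n\<close>.\<close>

lemma geometric_decay:
  fixes a :: "nat \<Rightarrow> real"
  assumes a0: "\<And>n. a n \<ge> 0" and A: "A \<ge> 1" and tail: "\<And>n p. (\<Sum>k<p. a (n + k)) \<le> A * a n"
  shows "a n \<le> A * (1 - 1 / A) ^ n * a 0"
proof -
  have summable: "summable (\<lambda>k. a (n + k))" for n
    by (rule summableI_nonneg_bounded[OF a0 tail])
  define S where "S n = (\<Sum>k. a (n + k))" for n
  have SA: "S n \<le> A * a n" for n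
    unfolding S_def by (rule suminf_le_const[OF summable tail])
  have step: "S (Suc n) \<le> (1 - 1 / A) * S n" for n
  proof -
    have "S (Suc n) = S n - a n"
      using suminf_split_head[OF summable[of n]] by (simp add: S_def)
    moreover have "S n / A \<le> a n" using SA[of n] A by (simp add: divide_le_eq mult.commute)
    moreover have "(1 - 1 / A) * S n = S n - S n / A" by (simp add: left_diff_distrib)
    ultimately show ?thesis by linarith
  qed
  have q: "1 - 1 / A \<ge> 0" using A by simp
  have "S n \<le> (1 - 1 / A) ^ n * S 0" for n
  proof (induction n)
    case (Suc n)
    have "S (Suc n) \<le> (1 - 1 / A) * S n" by (rule step)
    also have "\<dots> \<le> (1 - 1 / A) * ((1 - 1 / A) ^ n * S 0)" by (intro mult_left_mono Suc q)
    finally show ?case by (simp add: mult.assoc)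
  qed simp
  moreover have "a n \<le> S n"
    using sum_le_suminf[OF summable, of "{0}" n] a0 by (simp add: S_def)
  ultimately have "a n \<le> (1 - 1 / A) ^ n * S 0" using order_trans by blast
  also have "\<dots> \<le> (1 - 1 / A) ^ n * (A * a 0)" using q by (intro mult_left_mono SA) auto
  finally show ?thesis by (simp add: mult_ac)
qed

context bounded_harmonic_qc_disk
begin

text \<open>At the points \<open>z n\<close> of the radius with \<open>1 - |z n| = (1 - r) / 2\<^sup>n\<close> the quantity
  \<open>a n = (1 - |z n|) stretch (z n)\<close> is comparable with \<open>bdist (z n)\<close>, and it is at most a multiple of the
  distance from \<open>f (z n)\<close> to \<open>f (z (n + 1))\<close>. Hence inscribed polygons of the image of the radius bound the
  tail sums of \<open>a\<close>, and the John condition makes \<open>a\<close> decay geometrically.\<close>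

lemma growth_of_John:
  assumes F: "\<And>z. cmod z < 1 \<Longrightarrow> F z = f z" and c: "c \<ge> 1"
    and John: "\<And>z1 z. cmod z1 < 1 \<Longrightarrow> z \<in> closed_segment 0 z1 \<Longrightarrow> curve_length (F \<circ> linepath z1 z) \<le> ennreal (c * bdist z)"
  shows "\<exists>M>0. \<exists>\<delta>. 0 < \<delta> \<and> \<delta> < 1 \<and>
       (\<forall>\<zeta>\<in>sphere 0 1. \<forall>r \<rho>. 0 \<le> r \<and> r \<le> \<rho> \<and> \<rho> < 1 \<longrightarrow>
          stretch (of_real \<rho> * \<zeta>) \<le> M * stretch (of_real r * \<zeta>) * ((1 - \<rho>) / (1 - r)) powr (\<delta> - 1))"
proof -
  have uc: "upper_const \<ge> 1"
  proof -
    have "1 * 1 \<le> koebe_const\<^sup>2 * (32::real) ^ harnack_exponent"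
      using koebe_const_ge_1 by (intro mult_mono) auto
    then show ?thesis by (simp add: upper_const_def)
  qed
  \<comment> \<open>the tail estimate yields the factor 2; enlarging it to 3 makes \<open>q > 1/2\<close>, which means \<open>\<delta> < 1\<close>\<close>
  define A where "A = 3 * koebe_const * c * upper_const"
  have A: "A \<ge> 3"
  proof -
    have "1 * 1 * 1 \<le> koebe_const * c * upper_const"
      using koebe_const_ge_1 c uc by (intro mult_mono) auto
    then show ?thesis by (simp add: A_def)
  qed
  define q where "q = 1 - 1 / A"
  have q: "1/2 < q" "q < 1" using A by (auto simp: q_def field_simps)
  define \<delta> where "\<delta> = - log 2 q"
  have \<delta>: "0 < \<delta>" "\<delta> < 1"
  proof -
    have "log 2 q < log 2 1" using q by (subst log_less_cancel_iff) auto
    then show "0 < \<delta>" by (simp add: \<delta>_def)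
    have "log 2 (1/2) < log 2 q" using q by (subst log_less_cancel_iff) auto
    then show "\<delta> < 1" by (simp add: \<delta>_def log_divide)
  qed
  have qpow: "q ^ n = ((1/2) ^ n) powr \<delta>" for n
  proof -
    have "q = 2 powr (log 2 q)" using q by simp
    also have "\<dots> = (1/2) powr \<delta>" by (simp add: \<delta>_def powr_divide powr_minus_divide)
    finally have "q ^ n = ((1/2) powr \<delta>) ^ n" by simp
    then show ?thesis by (simp add: powr_powr powr_realpow[symmetric] mult.commute)
  qed
  define M where "M = 2 * koebe_const * 2 ^ harnack_exponent * upper_const * A"
  have M: "M > 0" using koebe_const_ge_1 uc A by (simp add: M_def)
  have "stretch (of_real \<rho> * \<zeta>) \<le> M * stretch (of_real r * \<zeta>) * ((1 - \<rho>) / (1 - r)) powr (\<delta> - 1)"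
    if \<zeta>: "cmod \<zeta> = 1" and r: "0 \<le> r" "r \<le> \<rho>" "\<rho> < 1" for \<zeta> r \<rho>
  proof -
    define s where "s n = 1 - (1 - r) / 2 ^ n" for n :: nat
    define z where "z n = of_real (s n) * \<zeta>" for n
    have s1: "s n < 1" "0 \<le> s n" for n
    proof -
      show "s n < 1" using r by (simp add: s_def)
      have "(1 - r) / 2 ^ n \<le> (1 - r) / 1" using r by (intro divide_left_mono) auto
      moreover have "(1 - r) / 1 \<le> 1" using r by simp
      ultimately show "0 \<le> s n" unfolding s_def by linarith
    qed
    have smono: "s i \<le> s j" if "i \<le> j" for i j
      using that r by (auto simp: s_def intro!: divide_left_mono power_increasing)
    have sdiff: "s (Suc n) - s n = (1 - s n) / 2" for n by (simp add: s_def field_simps)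
    have zn: "cmod (z n) = s n" for n using s1[of n] \<zeta> by (simp add: z_def norm_mult)
    have dz: "dist (of_real x * \<zeta>) (of_real y * \<zeta>) = \<bar>x - y\<bar>" for x y
    proof -
      have "of_real x * \<zeta> - of_real y * \<zeta> = of_real (x - y) * \<zeta>" by (simp add: algebra_simps)
      then show ?thesis using \<zeta> by (simp only: dist_norm norm_mult norm_of_real) simp
    qed
    define a where "a n = stretch (z n) * (1 - s n)" for n
    have a0: "a n \<ge> 0" for n using stretch_nonneg s1[of n] by (simp add: a_def)
    have step: "a n \<le> 2 * koebe_const * dist (f (z (Suc n))) (f (z n))" for n
    proof -
      have d: "dist (z n) (z (Suc n)) = (1 - s n) / 2"
        using dz[of "s n" "s (Suc n)"] sdiff[of n] s1[of n] by (simp add: z_def)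
      have "ball (z n) (dist (z n) (z (Suc n))) \<subseteq> ball (z n) (1 - cmod (z n))"
        unfolding d zn using s1[of n] by (intro subset_ball) auto
      also have "\<dots> \<subseteq> ball 0 1" by (rule ball_in_disk)
      finally have "stretch (z n) * dist (z n) (z (Suc n)) \<le> koebe_const * dist (f (z n)) (f (z (Suc n)))"
        by (intro stretch_le_dist) (use zn s1 in auto)
      then show ?thesis unfolding d by (simp add: a_def dist_commute)
    qed
    have tail: "(\<Sum>k<p. a (n + k)) \<le> A * a n" for n p
    proof (cases "p = 0")
      case False
      have len: "s (n + p) - s n > 0"
      proof -
        have "s (Suc n) \<le> s (n + p)" using False by (intro smono) auto
        moreover have "0 < s (Suc n) - s n" unfolding sdiff using s1(1)[of n] by simp
        ultimately show ?thesis by linarith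
      qed
      \<comment> \<open>the path runs inwards, so the parameter \<open>\<tau> i\<close> belongs to the point with index \<open>n + p - i\<close>\<close>
      define \<tau> where "\<tau> i = (s (n + p) - s (n + p - i)) / (s (n + p) - s n)" for i
      have lp: "linepath (z (n + p)) (z n) (\<tau> i) = z (n + p - i)" for i
      proof -
        define D where "D = s (n + p) - s n"
        have "\<tau> i * D = s (n + p) - s (n + p - i)" using len by (simp add: \<tau>_def D_def)
        then have "(1 - \<tau> i) * s (n + p) + \<tau> i * s n = s (n + p - i)" by (simp add: D_def algebra_simps)
        then have "of_real ((1 - \<tau> i) * s (n + p) + \<tau> i * s n) * \<zeta> = z (n + p - i)" by (simp only: z_def)
        then show ?thesis by (simp add: linepath_def z_def scaleR_conv_of_real algebra_simps)
      qed
      have "ennreal (\<Sum>i<p. dist ((F \<circ> linepath (z (n + p)) (z n)) (\<tau> i)) ((F \<circ> linepath (z (n + p)) (z n)) (\<tau> (Suc i))))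
          \<le> curve_length (F \<circ> linepath (z (n + p)) (z n))"
      proof (rule curve_length_ge)
        show "\<tau> i \<le> \<tau> j" if "i \<le> j" "j \<le> p" for i j
          unfolding \<tau>_def using that len by (intro divide_right_mono diff_left_mono smono) auto
        show "\<tau> i \<in> {0..1}" if "i \<le> p" for i
          using smono[of "n + p - i" "n + p"] smono[of n "n + p - i"] that len by (auto simp: \<tau>_def divide_le_eq)
      qed
      also have "\<dots> \<le> ennreal (c * bdist (z n))"
      proof (rule John)
        show "cmod (z (n + p)) < 1" using zn s1 by simp
        have "z n = (s n / s (n + p)) *\<^sub>R z (n + p)"
          using len s1(2)[of n] by (simp add: z_def scaleR_conv_of_real)
        moreover have "0 \<le> s n / s (n + p)" "s n / s (n + p) \<le> 1"
          using len s1(2)[of n] by (auto simp: divide_le_eq)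
        ultimately show "z n \<in> closed_segment 0 (z (n + p))" by (auto simp: in_segment)
      qed
      finally have "(\<Sum>i<p. dist ((F \<circ> linepath (z (n + p)) (z n)) (\<tau> i)) ((F \<circ> linepath (z (n + p)) (z n)) (\<tau> (Suc i)))) \<le> c * bdist (z n)"
        using c bdist_pos[of "z n"] zn s1 by (subst (asm) ennreal_le_iff) auto
      moreover have "(\<Sum>i<p. dist ((F \<circ> linepath (z (n + p)) (z n)) (\<tau> i)) ((F \<circ> linepath (z (n + p)) (z n)) (\<tau> (Suc i))))
          = (\<Sum>k<p. dist (f (z (Suc (n + k)))) (f (z (n + k))))"
      proof -
        have "(\<Sum>k<p. dist (f (z (Suc (n + k)))) (f (z (n + k)))) = (\<Sum>i<p. dist (f (z (Suc (n + (p - Suc i))))) (f (z (n + (p - Suc i)))))"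
          by (rule sum.nat_diff_reindex[symmetric])
        also have "\<dots> = (\<Sum>i<p. dist ((F \<circ> linepath (z (n + p)) (z n)) (\<tau> i)) ((F \<circ> linepath (z (n + p)) (z n)) (\<tau> (Suc i))))"
        proof (rule sum.cong[OF refl])
          fix i assume "i \<in> {..<p}"
          then have "Suc (n + (p - Suc i)) = n + p - i" "n + (p - Suc i) = n + p - Suc i" by auto
          then show "dist (f (z (Suc (n + (p - Suc i))))) (f (z (n + (p - Suc i)))) = dist ((F \<circ> linepath (z (n + p)) (z n)) (\<tau> i)) ((F \<circ> linepath (z (n + p)) (z n)) (\<tau> (Suc i)))"
            using zn s1 by (simp add: lp F)
        qed
        finally show ?thesis by simp
      qed
      ultimately have sum_le: "(\<Sum>k<p. dist (f (z (Suc (n + k)))) (f (z (n + k)))) \<le> c * bdist (z n)" by simp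
      have "(\<Sum>k<p. a (n + k)) \<le> (\<Sum>k<p. 2 * koebe_const * dist (f (z (Suc (n + k)))) (f (z (n + k))))"
        by (intro sum_mono step)
      also have "\<dots> = 2 * koebe_const * (\<Sum>k<p. dist (f (z (Suc (n + k)))) (f (z (n + k))))"
        by (simp add: sum_distrib_left)
      also have "\<dots> \<le> 2 * koebe_const * (c * bdist (z n))"
        using koebe_const_ge_1 by (intro mult_left_mono sum_le) auto
      also have "\<dots> \<le> 2 * koebe_const * (c * (upper_const * a n))"
        using bdist_le_stretch[of "z n"] zn s1 koebe_const_ge_1 c
        by (intro mult_left_mono) (auto simp: a_def mult_ac)
      also have "\<dots> \<le> A * a n"
        using koebe_const_ge_1 c uc a0[of n] by (simp add: A_def mult_ac mult_left_mono)
      finally show ?thesis .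
    qed (use a0 A in simp)
    have decay: "a n \<le> A * q ^ n * a 0" for n
      unfolding q_def by (rule geometric_decay[OF a0 _ tail]) (use A in auto)
    define x where "x = (1 - \<rho>) / (1 - r)"
    have x: "0 < x" "x \<le> 1" using r by (auto simp: x_def divide_le_eq)
    have x\<rho>: "1 - \<rho> = x * (1 - r)" using r by (simp add: x_def)
    \<comment> \<open>the index with \<open>s n \<le> \<rho> < s (n + 1)\<close>\<close>
    define n where "n = (LEAST n. (1/2) ^ Suc n < x)"
    have ex: "\<exists>n. (1/2) ^ Suc n < x"
    proof -
      obtain n where "(1/2) ^ n < x" using real_arch_pow_inv[OF x(1), of "1/2"] by auto
      then have "(1/2) ^ Suc n < x" using x(1) by simp
      then show ?thesis by blast
    qed
    have n1: "(1/2) ^ Suc n < x" unfolding n_def by (rule LeastI_ex[OF ex])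
    have n2: "x \<le> (1/2) ^ n"
    proof (cases n)
      case (Suc k)
      then have "k < n" by simp
      from not_less_Least[OF this[unfolded n_def]] have "\<not> (1/2) ^ n < x" unfolding Suc .
      then show ?thesis by simp
    qed (use x in simp)
    have sn: "1 - s n = (1/2) ^ n * (1 - r)" by (simp add: s_def power_divide)
    have "x * (1 - r) \<le> (1/2) ^ n * (1 - r)" using n2 r by (intro mult_right_mono) auto
    then have \<rho>1: "s n \<le> \<rho>" using sn x\<rho> by linarith
    have "(1/2) ^ Suc n * (1 - r) \<le> x * (1 - r)" using n1 r by (intro mult_right_mono) auto
    then have "(1 - s n) / 2 \<le> 1 - \<rho>" using sn x\<rho> by simp
    then have \<rho>2: "\<rho> - s n \<le> (1 - s n) / 2" by (simp add: field_simps)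
    define y where "y = of_real \<rho> * \<zeta>"
    have yn: "cmod y = \<rho>" using r \<zeta> by (simp add: y_def norm_mult)
    have "dist (z n) y \<le> (1 - s n) / 2"
      using \<rho>1 \<rho>2 unfolding y_def z_def dz by simp
    then have "y \<in> cball (z n) ((1 - cmod (z n)) / 2)" by (simp add: zn)
    then have bdist_y: "bdist y \<le> 2 ^ harnack_exponent * bdist (z n)"
      using zn s1 by (intro bdist_compare) auto
    have "stretch y * (1 - \<rho>) \<le> koebe_const * bdist y" using stretch_le_bdist[of y] yn r by simp
    also have "\<dots> \<le> koebe_const * (2 ^ harnack_exponent * bdist (z n))"
      using koebe_const_ge_1 bdist_y by (intro mult_left_mono) auto
    also have "\<dots> \<le> koebe_const * (2 ^ harnack_exponent * (upper_const * a n))"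
      using bdist_le_stretch[of "z n"] zn s1 koebe_const_ge_1 by (intro mult_left_mono) (auto simp: a_def mult_ac)
    also have "\<dots> \<le> koebe_const * (2 ^ harnack_exponent * (upper_const * (A * q ^ n * a 0)))"
      using koebe_const_ge_1 uc by (intro mult_left_mono decay) auto
    also have "\<dots> \<le> koebe_const * (2 ^ harnack_exponent * (upper_const * (A * (2 * x powr \<delta>) * a 0)))"
    proof -
      have "q ^ n \<le> (2 * x) powr \<delta>" unfolding qpow using n1 \<delta> by (intro powr_mono2) auto
      also have "\<dots> = 2 powr \<delta> * x powr \<delta>" using x by (simp add: powr_mult)
      also have "\<dots> \<le> 2 powr 1 * x powr \<delta>" using \<delta> by (intro mult_right_mono powr_mono) auto
      finally have "q ^ n \<le> 2 * x powr \<delta>" by simp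
      then show ?thesis using koebe_const_ge_1 uc A a0 by (intro mult_left_mono mult_right_mono) auto
    qed
    also have "\<dots> = M * x powr \<delta> * a 0" by (simp add: M_def mult_ac)
    also have "a 0 = stretch (of_real r * \<zeta>) * (1 - r)" by (simp add: a_def z_def s_def)
    also have "x powr \<delta> = x powr (\<delta> - 1) * x" using x by (simp add: powr_diff)
    finally have "stretch y * (1 - \<rho>) \<le> M * stretch (of_real r * \<zeta>) * x powr (\<delta> - 1) * (x * (1 - r))"
      by (simp add: mult_ac)
    then have "stretch y * (1 - \<rho>) \<le> (M * stretch (of_real r * \<zeta>) * x powr (\<delta> - 1)) * (1 - \<rho>)"
      by (simp only: x\<rho>)
    then have "stretch y \<le> M * stretch (of_real r * \<zeta>) * x powr (\<delta> - 1)"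
      using r by (simp add: mult_le_cancel_right)
    then show ?thesis by (simp add: y_def x_def)
  qed
  then show ?thesis using M \<delta> by (intro exI[of _ M] conjI exI[of _ \<delta>]) auto
qed

lemma rectifiable_radius:
  assumes F: "\<And>z. cmod z < 1 \<Longrightarrow> F z = f z" and z1: "cmod z1 < 1"
  shows "rectifiable (F \<circ> linepath 0 z1)"
proof -
  have seg: "closed_segment 0 z1 \<subseteq> ball 0 1" using z1 by (intro closed_segment_subset) auto
  have lp: "linepath 0 z1 t \<in> closed_segment 0 z1" if "0 \<le> t" "t \<le> 1" for t
    using that by (metis atLeastAtMost_iff linepath_in_path)
  have eq: "F (linepath 0 z1 t) = f (linepath 0 z1 t)" if "0 \<le> t" "t \<le> 1" for t
    using lp[OF that] seg by (intro F) auto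
  have cont: "continuous_on (closed_segment 0 z1) stretch" by (rule continuous_on_subset[OF continuous_stretch seg])
  obtain zm where zm: "\<And>z. z \<in> closed_segment 0 z1 \<Longrightarrow> stretch z \<le> stretch zm"
    using continuous_attains_sup[OF compact_segment _ cont] by (metis ends_in_segment(1) empty_iff)
  define L where "L = stretch zm * cmod z1"
  have "curve_length (F \<circ> linepath 0 z1) \<le> ennreal (L * 1 - L * 0)"
  proof (rule curve_length_le)
    fix s t :: real assume st: "0 \<le> s" "s \<le> t" "t \<le> 1"
    have sub: "closed_segment (linepath 0 z1 s) (linepath 0 z1 t) \<subseteq> closed_segment 0 z1"
      using st lp by (intro closed_segment_subset) auto
    have "cmod (f (linepath 0 z1 t) - f (linepath 0 z1 s)) \<le> stretch zm * cmod (linepath 0 z1 t - linepath 0 z1 s)"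
      by (rule f_lipschitz_segment) (use sub seg zm in auto)
    also have "linepath 0 z1 t - linepath 0 z1 s = (t - s) *\<^sub>R z1" by (simp add: linepath_def algebra_simps)
    also have "stretch zm * cmod ((t - s) *\<^sub>R z1) = L * t - L * s"
      using st unfolding norm_scaleR by (simp add: L_def algebra_simps)
    finally have "cmod (f (linepath 0 z1 t) - f (linepath 0 z1 s)) \<le> L * t - L * s" .
    then show "dist ((F \<circ> linepath 0 z1) s) ((F \<circ> linepath 0 z1) t) \<le> L * t - L * s"
      using st by (simp only: o_def eq dist_norm norm_minus_commute)
  qed
  then have "curve_length (F \<circ> linepath 0 z1) < \<infinity>" using le_less_trans by (metis ennreal_less_top infinity_ennreal_def)
  moreover have "path (F \<circ> linepath 0 z1)"
    unfolding path_def
  proof (rule continuous_on_eq)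
    have "linepath 0 z1 ` {0..1} \<subseteq> ball 0 1" using lp seg by auto
    then show "continuous_on {0..1} (\<lambda>t. f (linepath 0 z1 t))"
      by (rule continuous_on_compose2[OF continuous_f continuous_on_linepath])
  qed (use eq in auto)
  ultimately show ?thesis by (simp add: rectifiable_def)
qed

text \<open>The bound for the stretching along the radius has the antiderivative \<open>\<phi> t = - L (1 - t)\<^sup>\<delta>\<close>. By the mean value
  inequality, \<open>\<phi>\<close> then bounds the increments of \<open>f\<close>, so that no arc length integral is needed.\<close>

lemma John_of_growth:
  assumes F: "\<And>z. cmod z < 1 \<Longrightarrow> F z = f z" and M: "M > 0" and \<delta>: "0 < \<delta>"
    and growth: "\<And>\<zeta> r \<rho>. cmod \<zeta> = 1 \<Longrightarrow> 0 \<le> r \<Longrightarrow> r \<le> \<rho> \<Longrightarrow> \<rho> < 1 \<Longrightarrow>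
          stretch (of_real \<rho> * \<zeta>) \<le> M * stretch (of_real r * \<zeta>) * ((1 - \<rho>) / (1 - r)) powr (\<delta> - 1)"
    and z1: "cmod z1 < 1" and z: "z \<in> closed_segment 0 z1"
  shows "curve_length (F \<circ> linepath z1 z) \<le> ennreal (M * koebe_const / \<delta> * bdist z)"
proof -
  define \<zeta> where "\<zeta> = (if z1 = 0 then 1 else sgn z1)"
  define R where "R = cmod z1"
  have \<zeta>: "cmod \<zeta> = 1" by (simp add: \<zeta>_def norm_sgn)
  have z1e: "z1 = of_real R * \<zeta>" by (simp add: \<zeta>_def R_def sgn_eq)
  obtain u where u: "0 \<le> u" "u \<le> 1" "z = u *\<^sub>R z1" using z by (auto simp: in_segment)
  define r where "r = u * R"
  have ze: "z = of_real r * \<zeta>" by (simp add: u r_def z1e scaleR_conv_of_real)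
  have r: "0 \<le> r" "r \<le> R" "R < 1" using u z1 by (auto simp: r_def R_def mult_left_le_one_le)
  define L where "L = M * stretch z * (1 - r) powr (1 - \<delta>) / \<delta>"
  have L: "L \<ge> 0" using M \<delta> stretch_nonneg by (simp add: L_def)
  define \<phi> where "\<phi> t = - L * (1 - t) powr \<delta>" for t
  have incr: "cmod (f (of_real b * \<zeta>) - f (of_real a * \<zeta>)) \<le> \<phi> b - \<phi> a" if ab: "r \<le> a" "a < b" "b \<le> R" for a b
  proof (rule differentiable_bound_general[OF ab(2)])
    have inb: "of_real t * \<zeta> \<in> ball 0 1" if "t \<in> {a..b}" for t
      using that ab r \<zeta> by (simp add: norm_mult)
    show "continuous_on {a..b} (\<lambda>t. f (of_real t * \<zeta>))"
      by (rule continuous_on_compose2[OF continuous_f]) (use inb in \<open>auto intro!: continuous_intros\<close>)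
    show "continuous_on {a..b} \<phi>"
      unfolding \<phi>_def using ab r by (intro continuous_intros) auto
    fix t assume t: "a < t" "t < b"
    show "(\<phi> has_vector_derivative (M * stretch z * ((1 - t) / (1 - r)) powr (\<delta> - 1))) (at t)"
    proof -
      have "((\<lambda>t. - L * (1 - t) powr \<delta>) has_real_derivative L * (\<delta> * (1 - t) powr (\<delta> - 1))) (at t)"
        using t ab r by (auto intro!: derivative_eq_intros)
      moreover have "L * (\<delta> * (1 - t) powr (\<delta> - 1)) = M * stretch z * ((1 - t) / (1 - r)) powr (\<delta> - 1)"
        using t ab r \<delta> by (simp add: L_def powr_divide powr_minus_divide[of "1 - r" "\<delta> - 1"] powr_diff)
      ultimately show ?thesis unfolding \<phi>_def has_real_derivative_iff_has_vector_derivative by simp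
    qed
    have tb: "of_real t * \<zeta> \<in> ball 0 1" using t by (intro inb) auto
    have "((\<lambda>t. of_real t * \<zeta>) has_vector_derivative \<zeta>) (at t)"
      by (auto intro!: derivative_eq_intros simp: has_vector_derivative_def scaleR_conv_of_real)
    from vector_derivative_diff_chain_within[OF this, of f]
    have "((f \<circ> (\<lambda>t. of_real t * \<zeta>)) has_vector_derivative (deriv h (of_real t * \<zeta>) * \<zeta> + cnj (deriv g (of_real t * \<zeta>) * \<zeta>))) (at t)"
      using has_derivative_f[OF tb] by blast
    then show "((\<lambda>t. f (of_real t * \<zeta>)) has_vector_derivative (deriv h (of_real t * \<zeta>) * \<zeta> + cnj (deriv g (of_real t * \<zeta>) * \<zeta>))) (at t)"
      by (simp add: o_def)
    have "cmod (deriv h (of_real t * \<zeta>) * \<zeta> + cnj (deriv g (of_real t * \<zeta>) * \<zeta>)) \<le> stretch (of_real t * \<zeta>) * cmod \<zeta>"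
      by (rule norm_derivative_f_le)
    also have "\<dots> \<le> M * stretch z * ((1 - t) / (1 - r)) powr (\<delta> - 1)"
      unfolding \<zeta> ze mult_1_right by (rule growth) (use \<zeta> t ab r in auto)
    finally show "cmod (deriv h (of_real t * \<zeta>) * \<zeta> + cnj (deriv g (of_real t * \<zeta>) * \<zeta>)) \<le> \<dots>" .
  qed
  define \<sigma> where "\<sigma> t = R - t * (R - r)" for t
  have lp: "linepath z1 z t = of_real (\<sigma> t) * \<zeta>" for t
    by (simp add: linepath_def z1e ze \<sigma>_def scaleR_conv_of_real algebra_simps)
  have \<sigma>mono: "\<sigma> t \<le> \<sigma> s" if "s \<le> t" for s t
    using that r by (simp add: \<sigma>_def mult_right_mono)
  have \<sigma>01: "\<sigma> 0 = R" "\<sigma> 1 = r" by (auto simp: \<sigma>_def)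
  have "curve_length (F \<circ> linepath z1 z) \<le> ennreal (- \<phi> (\<sigma> 1) - (- \<phi> (\<sigma> 0)))"
  proof (rule curve_length_le)
    fix s t :: real assume st: "0 \<le> s" "s \<le> t" "t \<le> 1"
    have b: "r \<le> \<sigma> t" "\<sigma> t \<le> \<sigma> s" "\<sigma> s \<le> R"
      using \<sigma>mono[of t 1] \<sigma>mono[of s t] \<sigma>mono[of 0 s] st \<sigma>01 by auto
    have eq: "F (of_real x * \<zeta>) = f (of_real x * \<zeta>)" if "r \<le> x" "x \<le> R" for x
      using that r \<zeta> by (intro F) (simp add: norm_mult)
    have "cmod (f (of_real (\<sigma> s) * \<zeta>) - f (of_real (\<sigma> t) * \<zeta>)) \<le> \<phi> (\<sigma> s) - \<phi> (\<sigma> t)"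
      using incr[of "\<sigma> t" "\<sigma> s"] b by (cases "\<sigma> t = \<sigma> s") auto
    then show "dist ((F \<circ> linepath z1 z) s) ((F \<circ> linepath z1 z) t) \<le> - \<phi> (\<sigma> t) - - \<phi> (\<sigma> s)"
      using b by (simp add: lp eq dist_norm)
  qed
  also have "\<dots> \<le> ennreal (M * koebe_const / \<delta> * bdist z)"
  proof (rule ennreal_leI)
    have "- \<phi> (\<sigma> 1) - (- \<phi> (\<sigma> 0)) \<le> L * (1 - r) powr \<delta>"
      using L by (simp add: \<phi>_def \<sigma>01)
    also have "\<dots> = M / \<delta> * (stretch z * ((1 - r) powr (1 - \<delta>) * (1 - r) powr \<delta>))"
      by (simp add: L_def)
    also have "(1 - r) powr (1 - \<delta>) * (1 - r) powr \<delta> = 1 - r"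
      using r by (simp add: powr_add[symmetric])
    also have "M / \<delta> * (stretch z * (1 - r)) \<le> M / \<delta> * (koebe_const * bdist z)"
    proof -
      have "cmod z = r" using \<zeta> r by (simp add: ze norm_mult)
      then show ?thesis using stretch_le_bdist[of z] M \<delta> r by (intro mult_left_mono) auto
    qed
    finally show "- \<phi> (\<sigma> 1) - (- \<phi> (\<sigma> 0)) \<le> M * koebe_const / \<delta> * bdist z" by simp
  qed
  finally show ?thesis .
qed

end

section \<open>Zeros of the derivative of the analytic part\<close>

lemma winding_number_power_circle:
  assumes c: "c \<noteq> 0"
  shows "winding_number (\<lambda>t. c * exp (2 * of_real pi * \<i> * of_nat n * of_real t)) 0 = of_nat n"
proof -
  define e where "e = (\<lambda>t::real. c * exp (2 * of_real pi * \<i> * of_nat n * of_real t))"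
  have der: "(e has_vector_derivative (2 * of_real pi * \<i> * of_nat n * e t)) (at t within S)" for t S
  proof -
    have "((\<lambda>x. c * exp (2 * of_real pi * \<i> * of_nat n * x)) has_field_derivative (2 * of_real pi * \<i> * of_nat n * e t)) (at (of_real t))"
      unfolding e_def by (auto intro!: derivative_eq_intros)
    from has_vector_derivative_real_field[OF this] show ?thesis
      unfolding e_def by (rule has_vector_derivative_at_within)
  qed
  have "e C1_differentiable_on {0..1}"
    unfolding C1_differentiable_on_def
    by (intro exI[of _ "\<lambda>t. 2 * of_real pi * \<i> * of_nat n * e t"] conjI ballI der)
       (auto simp: e_def intro!: continuous_intros)
  then have vp: "valid_path e" by (simp add: valid_path_def C1_differentiable_imp_piecewise)
  have nz: "0 \<notin> path_image e" using c by (auto simp: path_image_def e_def)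
  have "((\<lambda>t. 1 / (e t - 0) * vector_derivative e (at t within {0..1})) has_integral (2 * of_real pi * \<i> * of_nat n)) {0..1}"
  proof (rule has_integral_eq)
    show "((\<lambda>t::real. 2 * of_real pi * \<i> * of_nat n) has_integral (2 * of_real pi * \<i> * of_nat n :: complex)) {0..1}"
      using has_integral_const_real[of "2 * of_real pi * \<i> * of_nat n :: complex" 0 1] by simp
    fix t :: real assume t: "t \<in> {0..1}"
    have "vector_derivative e (at t within {0..1}) = 2 * of_real pi * \<i> * of_nat n * e t"
      by (rule vector_derivative_within_closed_interval[OF _ t der]) simp
    moreover have "e t \<noteq> 0" using c by (simp add: e_def)
    ultimately show "2 * of_real pi * \<i> * of_nat n = 1 / (e t - 0) * vector_derivative e (at t within {0..1})" by simp
  qed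
  then have "((\<lambda>w. 1 / (w - 0)) has_contour_integral (2 * of_real pi * \<i> * of_nat n)) e"
    by (simp add: has_contour_integral_def)
  then have "contour_integral e (\<lambda>w. 1 / (w - 0)) = 2 * of_real pi * \<i> * of_nat n"
    by (rule contour_integral_unique)
  then show ?thesis
    unfolding winding_number_valid_path[OF vp nz, unfolded e_def] e_def by simp
qed

context harmonic_qc
begin

text \<open>Let \<open>h w - h z = (w - z)\<^sup>n \<phi> w\<close> with \<open>\<phi> z = c \<noteq> 0\<close>. Since \<open>|g'| \<le> k |h'|\<close> with
  \<open>k = (K - 1) / (K + 1) < 1\<close>, integration along radii shows that \<open>|g w - g z|\<close> is asymptotically at most
  \<open>k |c| |w - z|\<^sup>n\<close>. So on a small circle \<open>f w - f z\<close> differs from \<open>c (w - z)\<^sup>n\<close> by less than the modulus of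
  the latter, and both curves wind \<open>n\<close> times around the origin. Preserving the orientation means \<open>n = 1\<close>,
  and then \<open>h' z = c\<close>.\<close>

lemma deriv_h_nonzero_of_sense_preserving:
  assumes z: "z \<in> V"
    and wind: "eventually (\<lambda>r. winding_number (f \<circ> circlepath z r) (f z) = 1) (at_right 0)"
  shows "deriv h z \<noteq> 0"
proof -
  obtain R where R: "R > 0" "ball z R \<subseteq> V" using openV z open_contains_ball by blast
  have nonconst: "\<not> (\<lambda>w. h w - h z) constant_on ball z R"
  proof
    assume "(\<lambda>w. h w - h z) constant_on ball z R"
    then obtain C where C: "\<And>w. w \<in> ball z R \<Longrightarrow> h w - h z = C" by (auto simp: constant_on_def)
    have hz: "h w = h z" if "w \<in> ball z R" for w using C[OF that] C[of z] R by simp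
    have dh: "deriv h w = 0" if w: "w \<in> ball z R" for w
    proof (rule DERIV_imp_deriv)
      have "((\<lambda>_. h z) has_field_derivative 0) (at w)" by simp
      then show "(h has_field_derivative 0) (at w)"
        by (rule has_field_derivative_transform_within_open[OF _ open_ball w]) (simp add: hz)
    qed
    have stretch0: "stretch w \<le> 0" if "w \<in> ball z R" for w
      using stretch_le_deriv_h[of w] dh[OF that] R that by auto
    define w where "w = z + of_real (R/2)"
    have w: "w \<in> ball z R" "w \<noteq> z" using R by (auto simp: w_def dist_norm)
    have seg: "closed_segment z w \<subseteq> ball z R" using w R by (intro closed_segment_subset) auto
    have "cmod (f w - f z) \<le> 0 * cmod (w - z)"
      by (rule f_lipschitz_segment) (use seg R stretch0 in auto)
    then have "f w = f z" by simp
    then have "w = z" using inj_onD[OF inj_f] w R by (metis centre_in_ball subsetD)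
    with w show False by simp
  qed
  have hol: "(\<lambda>w. h w - h z) holomorphic_on ball z R"
    by (intro holomorphic_intros holomorphic_on_subset[OF holh R(2)])
  obtain \<phi> r0 n where n: "0 < n" and r0: "0 < r0" "ball z r0 \<subseteq> ball z R" and \<phi>: "\<phi> holomorphic_on ball z r0"
    and fac: "\<And>w. w \<in> ball z r0 \<Longrightarrow> h w - h z = (w - z) ^ n * \<phi> w" and \<phi>nz: "\<And>w. w \<in> ball z r0 \<Longrightarrow> \<phi> w \<noteq> 0"
    by (rule holomorphic_factor_zero_nonconstant[OF hol open_ball connected_ball _ _ nonconst, of z]) (use R in auto)
  define c where "c = \<phi> z"
  have c: "c \<noteq> 0" using \<phi>nz[of z] r0 by (simp add: c_def)
  define k where "k = (K - 1) / (K + 1)"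
  have k: "0 \<le> k" "k < 1" using K1 by (auto simp: k_def)
  have gk: "cmod (deriv g w) \<le> k * cmod (deriv h w)" if w: "w \<in> V" for w
  proof (cases "stretch w = 0")
    case True
    then show ?thesis using k by (simp add: stretch_def add_nonneg_eq_0_iff)
  next
    case False
    then have pos: "stretch w > 0" using stretch_nonneg[of w] by simp
    have "stretch w * stretch w \<le> K * (cmod (deriv h w) - cmod (deriv g w)) * stretch w"
      using dil[OF w] by (simp add: stretch_def power2_eq_square algebra_simps)
    then have "stretch w \<le> K * (cmod (deriv h w) - cmod (deriv g w))" using pos by (simp add: mult_le_cancel_right)
    then show ?thesis using K1 by (simp add: stretch_def k_def field_simps)
  qed
  \<comment> \<open>tolerance for the relative error of the leading terms of \<open>h\<close> and of its derivative\<close>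
  define \<eta> where "\<eta> = (1 - k) / 4"
  have \<eta>: "0 < \<eta>" "\<eta> + k * (1 + \<eta>) < 1"
  proof -
    show "0 < \<eta>" using k by (simp add: \<eta>_def)
    have "k * \<eta> \<le> 1 * \<eta>" using k \<open>0 < \<eta>\<close> by (intro mult_right_mono) auto
    moreover have "2 * \<eta> < 1 - k" using k by (simp add: \<eta>_def)
    ultimately show "\<eta> + k * (1 + \<eta>) < 1" by (simp add: algebra_simps)
  qed
  have d\<phi>: "(\<phi> has_field_derivative deriv \<phi> w) (at w)" if "w \<in> ball z r0" for w
    by (rule holomorphic_derivI[OF \<phi> open_ball that])
  define \<xi> where "\<xi> w = of_nat n * \<phi> w + (w - z) * deriv \<phi> w" for w
  have dh: "deriv h w = (w - z) ^ (n - 1) * \<xi> w" if w: "w \<in> ball z r0" for w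
  proof (rule DERIV_imp_deriv)
    have pw: "(w - z) ^ n = (w - z) ^ (n - 1) * (w - z)" using n by (metis power_minus_mult)
    have "of_nat n * (w - z) ^ (n - 1) * \<phi> w + (w - z) ^ n * deriv \<phi> w = (w - z) ^ (n - 1) * \<xi> w"
      unfolding pw \<xi>_def by (simp add: distrib_left mult_ac)
    moreover have "((\<lambda>w. h z + (w - z) ^ n * \<phi> w) has_field_derivative
        (of_nat n * (w - z) ^ (n - 1) * \<phi> w + (w - z) ^ n * deriv \<phi> w)) (at w)"
      by (auto intro!: derivative_eq_intros d\<phi>[OF w])
    ultimately have "((\<lambda>w. h z + (w - z) ^ n * \<phi> w) has_field_derivative (w - z) ^ (n - 1) * \<xi> w) (at w)"
      by simp
    then show "(h has_field_derivative (w - z) ^ (n - 1) * \<xi> w) (at w)"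
      by (rule has_field_derivative_transform_within_open[OF _ open_ball w]) (use fac in \<open>auto simp: algebra_simps\<close>)
  qed
  have cont: "isCont \<phi> z" "isCont \<xi> z"
  proof -
    have "continuous_on (ball z r0) \<phi>" "continuous_on (ball z r0) (deriv \<phi>)"
      using \<phi> holomorphic_deriv[OF \<phi> open_ball] by (simp_all add: holomorphic_on_imp_continuous_on)
    then have "continuous_on (ball z r0) \<phi>" "continuous_on (ball z r0) \<xi>"
      unfolding \<xi>_def by (auto intro!: continuous_intros)
    then show "isCont \<phi> z" "isCont \<xi> z" using r0 by (auto simp: continuous_on_eq_continuous_at)
  qed
  have "\<exists>r1>0. \<forall>w. dist w z < r1 \<longrightarrow> dist (\<phi> w) (\<phi> z) < \<eta> * cmod c"
    using cont(1) \<eta> c unfolding continuous_at_eps_delta by (metis mult_pos_pos zero_less_norm_iff)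
  then obtain r1 where r1: "r1 > 0" "\<And>w. dist w z < r1 \<Longrightarrow> dist (\<phi> w) (\<phi> z) < \<eta> * cmod c" by blast
  have "0 < \<eta> * real n * cmod c" using \<eta> n c by simp
  then have "\<exists>r2>0. \<forall>w. dist w z < r2 \<longrightarrow> dist (\<xi> w) (\<xi> z) < \<eta> * real n * cmod c"
    using cont(2) unfolding continuous_at_eps_delta by metis
  then obtain r2 where r2: "r2 > 0" "\<And>w. dist w z < r2 \<Longrightarrow> dist (\<xi> w) (\<xi> z) < \<eta> * real n * cmod c" by blast
  define r3 where "r3 = min r0 (min r1 r2)"
  have r3: "r3 > 0" using r0 r1 r2 by (simp add: r3_def)
  have \<xi>le: "cmod (\<xi> w) \<le> (1 + \<eta>) * real n * cmod c" if "dist w z < r3" for w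
  proof -
    have "cmod (\<xi> w) \<le> cmod (\<xi> z) + cmod (\<xi> w - \<xi> z)" by (metis add.commute diff_add_cancel norm_triangle_ineq)
    also have "cmod (\<xi> w - \<xi> z) \<le> \<eta> * real n * cmod c" using r2(2)[of w] that by (simp add: dist_norm r3_def)
    also have "cmod (\<xi> z) = real n * cmod c" by (simp add: \<xi>_def c_def norm_mult)
    finally show ?thesis by (simp add: algebra_simps)
  qed
  have gle: "cmod (g w - g z) \<le> k * (1 + \<eta>) * cmod c * cmod (w - z) ^ n" if w: "dist w z < r3" "w \<noteq> z" for w
  proof -
    define s where "s = cmod (w - z)"
    define v where "v = sgn (w - z)"
    have v: "cmod v = 1" using w by (simp add: v_def norm_sgn)
    have ws: "w = z + of_real s * v" by (simp add: s_def v_def sgn_eq)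
    have s: "0 < s" "s < r3" using w by (auto simp: s_def dist_norm)
    define C where "C = k * (1 + \<eta>) * cmod c"
    have "cmod (g (z + of_real s * v) - g (z + of_real 0 * v)) \<le> C * s ^ n - C * 0 ^ n"
    proof (rule differentiable_bound_general[OF s(1), where f = "\<lambda>t. g (z + of_real t * v)" and \<phi> = "\<lambda>t. C * t ^ n"])
      have inb: "z + of_real t * v \<in> V" "dist (z + of_real t * v) z < r3" "z + of_real t * v \<in> ball z r0" if "t \<in> {0..s}" for t
      proof -
        show d: "dist (z + of_real t * v) z < r3" using that s v by (simp add: dist_norm norm_mult)
        then show "z + of_real t * v \<in> ball z r0" by (simp add: r3_def dist_commute)
        then show "z + of_real t * v \<in> V" using r0 R by auto
      qed
      show "continuous_on {0..s} (\<lambda>t. g (z + of_real t * v))"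
        by (rule continuous_on_compose2[OF holomorphic_on_imp_continuous_on[OF holg]]) (use inb in \<open>auto intro!: continuous_intros\<close>)
      show "continuous_on {0..s} (\<lambda>t. C * t ^ n)" by (intro continuous_intros)
      fix t assume t: "0 < t" "t < s"
      show "((\<lambda>t. C * t ^ n) has_vector_derivative C * (real n * t ^ (n - 1))) (at t)"
        unfolding has_real_derivative_iff_has_vector_derivative[symmetric] by (auto intro!: derivative_eq_intros)
      have tb: "z + of_real t * v \<in> V" using t by (intro inb) auto
      have "((\<lambda>x. g (z + x * v)) has_field_derivative deriv g (z + of_real t * v) * v) (at (of_real t))"
        by (rule DERIV_chain2[where g = "\<lambda>x. z + x * v"]) (auto intro!: derivative_eq_intros holomorphic_derivI[OF holg openV tb])
      from has_vector_derivative_real_field[OF this]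
      show "((\<lambda>t. g (z + of_real t * v)) has_vector_derivative deriv g (z + of_real t * v) * v) (at t)" .
      have "cmod (deriv g (z + of_real t * v) * v) \<le> k * cmod (deriv h (z + of_real t * v))"
        using gk[OF tb] v by (simp add: norm_mult)
      also have "deriv h (z + of_real t * v) = (of_real t * v) ^ (n - 1) * \<xi> (z + of_real t * v)"
        using dh[OF inb(3), of t] t by simp
      also have "k * cmod ((of_real t * v) ^ (n - 1) * \<xi> (z + of_real t * v)) \<le> k * (t ^ (n - 1) * ((1 + \<eta>) * real n * cmod c))"
        unfolding norm_mult norm_power using t v k by (intro mult_left_mono mult_mono \<xi>le inb) auto
      finally show "cmod (deriv g (z + of_real t * v) * v) \<le> C * (real n * t ^ (n - 1))"
        by (simp add: C_def mult_ac)
    qed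
    then have "cmod (g (z + of_real s * v) - g z) \<le> C * s ^ n" using n by (simp add: zero_power)
    then show ?thesis unfolding ws[symmetric] C_def s_def[symmetric] .
  qed
  obtain b where b: "b > 0" "\<And>r. 0 < r \<Longrightarrow> r < b \<Longrightarrow> winding_number (f \<circ> circlepath z r) (f z) = 1"
    using wind unfolding eventually_at_right_field by blast
  define r where "r = min b r3 / 2"
  have r: "0 < r" "r < b" "r < r3" using b r3 by (auto simp: r_def)
  have on: "circlepath z r t - z = of_real r * exp (2 * of_real pi * \<i> * of_real t)" for t
    by (simp add: circlepath)
  have ncirc: "cmod (circlepath z r t - z) = r" for t
    unfolding on using r by (simp add: norm_mult)
  have circ: "dist (circlepath z r t) z < r3" "circlepath z r t \<noteq> z" "circlepath z r t \<in> ball z r0" "circlepath z r t \<in> V" for t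
  proof -
    show d: "dist (circlepath z r t) z < r3" using ncirc[of t] r by (simp add: dist_norm)
    show "circlepath z r t \<noteq> z" using ncirc[of t] r by auto
    show "circlepath z r t \<in> ball z r0" using d by (simp add: r3_def dist_commute)
    then show "circlepath z r t \<in> V" using r0 R by auto
  qed
  define c' where "c' = c * of_real r ^ n"
  define e where "e = (\<lambda>t::real. c' * exp (2 * of_real pi * \<i> * of_nat n * of_real t))"
  have e: "e t = c * (circlepath z r t - z) ^ n" for t
    by (simp add: e_def c'_def on power_mult_distrib exp_of_nat_mult[symmetric] mult_ac)
  have "winding_number (f \<circ> circlepath z r) (f z) = winding_number (\<lambda>t. (f \<circ> circlepath z r) t - f z) 0"
    by (rule winding_number_offset)
  also have "\<dots> = winding_number e 0"
  proof (rule winding_number_nearby_loops_eq)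
    show "path e" unfolding path_def e_def by (intro continuous_intros)
    have "continuous_on {0..1} (\<lambda>t. f (circlepath z r t))"
      by (rule continuous_on_compose2[OF continuous_f]) (use circ path_circlepath[of z r] in \<open>auto simp: path_def\<close>)
    then show "path (\<lambda>t. (f \<circ> circlepath z r) t - f z)" unfolding path_def o_def by (intro continuous_intros)
    have ends: "circlepath z r 0 = circlepath z r 1"
      using pathfinish_circlepath[of z r] pathstart_circlepath[of z r] by (simp add: pathstart_def pathfinish_def)
    show "pathfinish e = pathstart e" unfolding pathfinish_def pathstart_def e ends ..
    show "pathfinish (\<lambda>t. (f \<circ> circlepath z r) t - f z) = pathstart (\<lambda>t. (f \<circ> circlepath z r) t - f z)"
      unfolding pathfinish_def pathstart_def o_def ends ..
    fix t :: real
    define w where "w = circlepath z r t"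
    have w: "dist w z < r3" "w \<noteq> z" "w \<in> ball z r0" "cmod (w - z) = r"
      using circ ncirc by (auto simp: w_def)
    have "(f \<circ> circlepath z r) t - f z - e t = (\<phi> w - \<phi> z) * (w - z) ^ n + cnj (g w - g z)"
      using fac[OF w(3)] by (simp add: e w_def[symmetric] f_def c_def algebra_simps)
    then have "cmod ((f \<circ> circlepath z r) t - f z - e t) \<le> cmod ((\<phi> w - \<phi> z) * (w - z) ^ n) + cmod (cnj (g w - g z))"
      by (metis norm_triangle_ineq)
    also have "\<dots> = cmod (\<phi> w - \<phi> z) * r ^ n + cmod (g w - g z)"
      by (simp only: norm_mult norm_power w complex_mod_cnj)
    also have "\<dots> \<le> \<eta> * cmod c * r ^ n + k * (1 + \<eta>) * cmod c * r ^ n"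
      using r1(2)[of w] w gle[of w] r by (intro add_mono mult_right_mono) (auto simp: r3_def dist_norm)
    also have "\<dots> = (\<eta> + k * (1 + \<eta>)) * (cmod c * r ^ n)" by (simp add: algebra_simps)
    also have "\<dots> < 1 * (cmod c * r ^ n)" using \<eta> c r by (intro mult_strict_right_mono) auto
    also have "\<dots> = cmod (e t - 0)" by (simp add: e w_def[symmetric] norm_mult norm_power w)
    finally show "cmod ((f \<circ> circlepath z r) t - f z - e t) < cmod (e t - 0)" .
  qed
  also have "\<dots> = of_nat n" unfolding e_def by (rule winding_number_power_circle) (use c r in \<open>simp add: c'_def\<close>)
  finally have "n = 1" using b(2)[OF r(1,2)] by simp
  then have "deriv h z = c" using dh[of z] r0 by (simp add: \<xi>_def c_def)
  then show ?thesis using c by simp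
qed

end

section \<open>Characterization of radial John disks\<close>

lemma dz_dzbar_canonical:
  assumes rep: "canonical_rep F h g" and z: "cmod z < 1"
  shows "dz F z = deriv h z" "dzbar F z = cnj (deriv g z)"
proof -
  have "h holomorphic_on ball 0 1" "g holomorphic_on ball 0 1" using rep by (auto simp: canonical_rep_def)
  then have "(h has_field_derivative deriv h z) (at z)" "(g has_field_derivative deriv g z) (at z)"
    using z by (auto intro: holomorphic_derivI[OF _ open_ball])
  then have "((\<lambda>z. h z + cnj (g z)) has_derivative (\<lambda>v. deriv h z * v + cnj (deriv g z * v))) (at z)"
    by (rule has_derivative_harmonic)
  then have F': "(F has_derivative (\<lambda>v. deriv h z * v + cnj (deriv g z * v))) (at z)"
    by (rule has_derivative_transform_within_open[OF _ open_ball[of 0 1]]) (use z rep in \<open>auto simp: canonical_rep_def\<close>)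
  have dir: "vector_derivative (\<lambda>t. F (z + a * of_real t)) (at 0) = deriv h z * a + cnj (deriv g z * a)" for a
  proof (rule vector_derivative_at)
    have "((\<lambda>t. z + a * of_real t) has_derivative (\<lambda>t. a * of_real t)) (at (0::real))"
      by (auto intro!: derivative_eq_intros)
    moreover have "(F has_derivative (\<lambda>v. deriv h z * v + cnj (deriv g z * v))) (at (z + a * of_real 0))" using F' by simp
    ultimately have "((\<lambda>t. F (z + a * of_real t)) has_derivative (\<lambda>t. deriv h z * (a * of_real t) + cnj (deriv g z * (a * of_real t)))) (at (0::real))"
      by (rule has_derivative_compose)
    then show "((\<lambda>t. F (z + a * of_real t)) has_vector_derivative deriv h z * a + cnj (deriv g z * a)) (at 0)"
      unfolding has_vector_derivative_def by (simp add: scaleR_conv_of_real algebra_simps)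
  qed
  have d: "dx F z = deriv h z + cnj (deriv g z)" "dy F z = \<i> * deriv h z - \<i> * cnj (deriv g z)"
    using dir[of 1] dir[of \<i>] by (simp_all add: dx_def dy_def algebra_simps)
  show "dz F z = deriv h z" "dzbar F z = cnj (deriv g z)"
    unfolding dz_def dzbar_def d by (simp_all add: algebra_simps)
qed

text \<open>The set where the inequality fails is open and null, hence empty.\<close>

lemma AE_le_imp_le_on_open:
  fixes u v :: "complex \<Rightarrow> real"
  assumes S: "open S" and cont: "continuous_on S u" "continuous_on S v"
    and ae: "AE z in lebesgue. z \<in> S \<longrightarrow> u z \<le> v z" and z: "z \<in> S"
  shows "u z \<le> v z"
proof (rule ccontr)
  assume "\<not> u z \<le> v z"
  define A where "A = {w \<in> S. v w < u w}"
  have "A = S \<inter> (\<lambda>w. u w - v w) -` {0<..}" by (auto simp: A_def)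
  moreover have "continuous_on S (\<lambda>w. u w - v w)" using cont by (intro continuous_intros)
  ultimately have "open A" using continuous_open_preimage[OF _ S open_greaterThan] by metis
  moreover have "negligible A"
  proof -
    have "AE w in lebesgue. w \<notin> A" using ae by (rule AE_mp) (auto simp: A_def)
    moreover have "A \<in> sets lebesgue" using \<open>open A\<close> by auto
    ultimately show ?thesis by (simp add: negligible_iff_null_sets AE_iff_null_sets)
  qed
  moreover have "A \<noteq> {}" using z \<open>\<not> u z \<le> v z\<close> by (auto simp: A_def)
  ultimately show False using open_not_negligible \<open>open A\<close> by blast
qed

theorem theorem1:
  fixes K :: real and f :: "complex \<Rightarrow> complex" and \<Omega> :: "complex set"
  assumes "K \<ge> 1"
    and "f \<in> S_H0"
    and "quasiconformal K unit_disk \<Omega> f"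
    and "bounded \<Omega>"
  shows "radial_John_disk f \<Omega> \<longleftrightarrow>
    (\<exists>M>0. \<exists>\<delta>. 0 < \<delta> \<and> \<delta> < 1 \<and>
       (\<forall>\<zeta>\<in>sphere 0 1. \<forall>r \<rho>. 0 \<le> r \<and> r \<le> \<rho> \<and> \<rho> < 1 \<longrightarrow>
          norm_D f (of_real \<rho> * \<zeta>)
            \<le> M * norm_D f (of_real r * \<zeta>) * ((1 - \<rho>) / (1 - r)) powr (\<delta> - 1)))"
proof -
  obtain h g where rep: "canonical_rep f h g" and injf: "inj_on f unit_disk"
    and sp: "sense_preserving_on unit_disk f"
    using assms(2) by (auto simp: S_H0_def S_H_def)
  have hol: "h holomorphic_on unit_disk" "g holomorphic_on unit_disk"
    using rep by (auto simp: canonical_rep_def)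
  have fe: "f z = h z + cnj (g z)" if "cmod z < 1" for z
    using rep that by (auto simp: canonical_rep_def)
  have nD: "norm_D f z = cmod (deriv h z) + cmod (deriv g z)"
    and dD: "det_D f z = (cmod (deriv h z))\<^sup>2 - (cmod (deriv g z))\<^sup>2" if "cmod z < 1" for z
    using dz_dzbar_canonical[OF rep that] by (simp_all add: norm_D_def det_D_def)
  have dil: "(cmod (deriv h z) + cmod (deriv g z))\<^sup>2 \<le> K * ((cmod (deriv h z))\<^sup>2 - (cmod (deriv g z))\<^sup>2)"
    if "z \<in> unit_disk" for z
  proof (rule AE_le_imp_le_on_open[OF open_ball _ _ _ that])
    have c: "continuous_on unit_disk (deriv h)" "continuous_on unit_disk (deriv g)"
      using holomorphic_deriv[OF hol(1) open_ball] holomorphic_deriv[OF hol(2) open_ball]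
      by (simp_all add: holomorphic_on_imp_continuous_on)
    show "continuous_on unit_disk (\<lambda>z. (cmod (deriv h z) + cmod (deriv g z))\<^sup>2)"
      "continuous_on unit_disk (\<lambda>z. K * ((cmod (deriv h z))\<^sup>2 - (cmod (deriv g z))\<^sup>2))"
      using c by (auto intro!: continuous_intros)
    have "AE z in lebesgue. z \<in> unit_disk \<longrightarrow> (norm_D f z)\<^sup>2 \<le> K * det_D f z"
      using assms(3) by (simp add: quasiconformal_def)
    then show "AE z in lebesgue. z \<in> unit_disk \<longrightarrow> (cmod (deriv h z) + cmod (deriv g z))\<^sup>2 \<le> K * ((cmod (deriv h z))\<^sup>2 - (cmod (deriv g z))\<^sup>2)"
      by (rule AE_mp) (auto simp: nD dD)
  qed
  obtain f' where homeo: "homeomorphism unit_disk \<Omega> f f'" using assms(3) by (auto simp: quasiconformal_def)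
  then have \<Omega>: "\<Omega> = f ` unit_disk" by (simp add: homeomorphism_def)
  have "inj_on (\<lambda>z. h z + cnj (g z)) unit_disk"
    using injf by (rule inj_on_cong[THEN iffD1, rotated]) (simp add: fe)
  then interpret Q: harmonic_qc unit_disk K h g
    using hol assms(1) dil by unfold_locales auto
  have fQ: "f z = Q.f z" if "cmod z < 1" for z using fe[OF that] by (simp add: Q.f_def)
  have image: "Q.f ` unit_disk = \<Omega>" unfolding \<Omega> using fQ by (intro image_cong) auto
  have nonzero: "deriv h z \<noteq> 0" if z: "cmod z < 1" for z
  proof (rule Q.deriv_h_nonzero_of_sense_preserving)
    show "z \<in> unit_disk" using z by simp
    have "eventually (\<lambda>r. winding_number (f \<circ> circlepath z r) (f z) = 1) (at_right 0)"
      using sp z by (simp add: sense_preserving_on_def)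
    moreover have "eventually (\<lambda>r. r \<in> {0<..<1 - cmod z}) (at_right 0)"
      using z by (intro eventually_at_right_real) auto
    ultimately show "eventually (\<lambda>r. winding_number (Q.f \<circ> circlepath z r) (Q.f z) = 1) (at_right 0)"
    proof eventually_elim
      case (elim r)
      have "winding_number (Q.f \<circ> circlepath z r) (Q.f z) = winding_number (f \<circ> circlepath z r) (Q.f z)"
      proof (rule winding_number_cong)
        fix t :: real
        have "cmod (circlepath z r t) \<le> cmod z + cmod (circlepath z r t - z)"
          by (metis add.commute diff_add_cancel norm_triangle_ineq)
        also have "cmod (circlepath z r t - z) = r"
          using elim by (simp add: circlepath norm_mult)
        finally have "cmod (circlepath z r t) < 1" using elim by simp
        then show "(Q.f \<circ> circlepath z r) t = (f \<circ> circlepath z r) t" by (simp add: fQ)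
      qed
      then show ?case using elim fQ[OF z] by simp
    qed
  qed
  interpret H: bounded_harmonic_qc_disk K h g
    using assms(4) nonzero image by unfold_locales auto
  have norm_D_stretch: "norm_D f z = Q.stretch z" if "cmod z < 1" for z
    using nD[OF that] by (simp add: Q.stretch_def)
  have bd: "H.bdist z = infdist (f z) (frontier \<Omega>)" if "cmod z < 1" for z
    using fQ[OF that] by (simp add: H.bdist_def image)
  have \<rho>\<zeta>: "cmod (of_real \<rho> * \<zeta>) < 1" if "cmod \<zeta> = 1" "0 \<le> \<rho>" "\<rho> < 1" for \<rho> and \<zeta> :: complex
    using that by (simp add: norm_mult)
  have seg: "cmod z < 1" if "cmod z1 < 1" "z \<in> closed_segment 0 z1" for z z1 :: complex
    using segment_bound(1)[OF that(2)] that(1) by simp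
  show ?thesis
  proof
    assume "radial_John_disk f \<Omega>"
    then obtain c where c: "radial_c_John_disk c f \<Omega>" by (auto simp: radial_John_disk_def)
    have "\<exists>M>0. \<exists>\<delta>. 0 < \<delta> \<and> \<delta> < 1 \<and> (\<forall>\<zeta>\<in>sphere 0 1. \<forall>r \<rho>. 0 \<le> r \<and> r \<le> \<rho> \<and> \<rho> < 1 \<longrightarrow>
          Q.stretch (of_real \<rho> * \<zeta>) \<le> M * Q.stretch (of_real r * \<zeta>) * ((1 - \<rho>) / (1 - r)) powr (\<delta> - 1))"
    proof (rule H.growth_of_John[where c = c, OF fQ])
      show "c \<ge> 1" using c by (simp add: radial_c_John_disk_def)
      fix z1 z :: complex assume z1: "cmod z1 < 1" and z: "z \<in> closed_segment 0 z1"
      have "\<forall>z1\<in>unit_disk. \<forall>z\<in>closed_segment 0 z1. curve_length (f \<circ> linepath z1 z) \<le> ennreal (c * infdist (f z) (frontier \<Omega>))"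
        using c unfolding radial_c_John_disk_def by blast
      then show "curve_length (f \<circ> linepath z1 z) \<le> ennreal (c * H.bdist z)"
        using z1 z unfolding bd[OF seg[OF z1 z]] by simp
    qed
    then obtain M \<delta> where M: "M > 0" and \<delta>: "0 < \<delta>" "\<delta> < 1" and growth: "\<And>\<zeta> r \<rho>. \<zeta> \<in> sphere 0 1 \<Longrightarrow> 0 \<le> r \<and> r \<le> \<rho> \<and> \<rho> < 1 \<Longrightarrow>
        Q.stretch (of_real \<rho> * \<zeta>) \<le> M * Q.stretch (of_real r * \<zeta>) * ((1 - \<rho>) / (1 - r)) powr (\<delta> - 1)"
      by blast
    show "\<exists>M>0. \<exists>\<delta>. 0 < \<delta> \<and> \<delta> < 1 \<and> (\<forall>\<zeta>\<in>sphere 0 1. \<forall>r \<rho>. 0 \<le> r \<and> r \<le> \<rho> \<and> \<rho> < 1 \<longrightarrow>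
          norm_D f (of_real \<rho> * \<zeta>) \<le> M * norm_D f (of_real r * \<zeta>) * ((1 - \<rho>) / (1 - r)) powr (\<delta> - 1))"
    proof (rule exI[of _ M], intro conjI M, rule exI[of _ \<delta>], intro conjI \<delta> ballI allI impI)
      fix \<zeta> :: complex and r \<rho> :: real
      assume \<zeta>: "\<zeta> \<in> sphere 0 1" and r: "0 \<le> r \<and> r \<le> \<rho> \<and> \<rho> < 1"
      then have "cmod (of_real \<rho> * \<zeta>) < 1" "cmod (of_real r * \<zeta>) < 1" by (auto intro!: \<rho>\<zeta>)
      then show "norm_D f (of_real \<rho> * \<zeta>) \<le> M * norm_D f (of_real r * \<zeta>) * ((1 - \<rho>) / (1 - r)) powr (\<delta> - 1)"
        using growth[OF \<zeta> r] by (simp only: norm_D_stretch)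
    qed
  next
    assume "\<exists>M>0. \<exists>\<delta>. 0 < \<delta> \<and> \<delta> < 1 \<and> (\<forall>\<zeta>\<in>sphere 0 1. \<forall>r \<rho>. 0 \<le> r \<and> r \<le> \<rho> \<and> \<rho> < 1 \<longrightarrow>
          norm_D f (of_real \<rho> * \<zeta>) \<le> M * norm_D f (of_real r * \<zeta>) * ((1 - \<rho>) / (1 - r)) powr (\<delta> - 1))"
    then obtain M \<delta> where M: "M > 0" and \<delta>: "0 < \<delta>" "\<delta> < 1" and growth: "\<And>\<zeta> r \<rho>. \<zeta> \<in> sphere 0 1 \<Longrightarrow> 0 \<le> r \<and> r \<le> \<rho> \<and> \<rho> < 1 \<Longrightarrow>
        norm_D f (of_real \<rho> * \<zeta>) \<le> M * norm_D f (of_real r * \<zeta>) * ((1 - \<rho>) / (1 - r)) powr (\<delta> - 1)"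
      by blast
    have growth': "Q.stretch (of_real \<rho> * \<zeta>) \<le> M * Q.stretch (of_real r * \<zeta>) * ((1 - \<rho>) / (1 - r)) powr (\<delta> - 1)"
      if "cmod \<zeta> = 1" "0 \<le> r" "r \<le> \<rho>" "\<rho> < 1" for \<zeta> r \<rho>
    proof -
      have "cmod (of_real \<rho> * \<zeta>) < 1" "cmod (of_real r * \<zeta>) < 1" using that by (auto intro!: \<rho>\<zeta>)
      then show ?thesis using growth[of \<zeta> r \<rho>] that by (simp only: norm_D_stretch) simp
    qed
    define c where "c = max 1 (M * Q.koebe_const / \<delta>)"
    have "simply_connected \<Omega>"
      by (rule homeomorphic_simply_connected[of unit_disk])
        (use homeo in \<open>auto simp: homeomorphic_def convex_imp_simply_connected\<close>)
    moreover have "rectifiable (f \<circ> linepath 0 z1)" if "cmod z1 < 1" for z1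
      by (rule H.rectifiable_radius[OF fQ that])
    moreover have "curve_length (f \<circ> linepath z1 z) \<le> ennreal (c * infdist (f z) (frontier \<Omega>))"
      if z1: "cmod z1 < 1" and z: "z \<in> closed_segment 0 z1" for z1 z
    proof -
      have "curve_length (f \<circ> linepath z1 z) \<le> ennreal (M * Q.koebe_const / \<delta> * H.bdist z)"
        by (rule H.John_of_growth[OF fQ M \<delta>(1) growth' z1 z])
      also have "\<dots> \<le> ennreal (c * infdist (f z) (frontier \<Omega>))"
        unfolding bd[OF seg[OF z1 z]] by (intro ennreal_leI mult_right_mono) (auto simp: c_def infdist_nonneg)
      finally show ?thesis .
    qed
    ultimately have "radial_c_John_disk c f \<Omega>"
      using injf assms(4) \<Omega> by (simp add: radial_c_John_disk_def c_def)
    then show "radial_John_disk f \<Omega>" by (auto simp: radial_John_disk_def)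
  qed
qed

end
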